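(* Every smooth centrally symmetric lattice $3$-polytope $P\subset\mathbb{R}^3$ has a unimodular cover.
   Context: The lattice is $\mathbb{Z}^3\subset\mathbb{R}^3$. A lattice polytope is the convex hull of finitely many lattice points; a lattice $3$-polytope is a $3$-dimensional lattice polytope. A lattice polytope is smooth if it is simple and the primitive edge directions at every vertex form a linear basis for the lattice. A unimodular tetrahedron is a lattice tetrahedron whose edge vectors from one vertex form a basis of $\mathbb{Z}^3$ (normalized volume $1$). A unimodular cover of a lattice $3$-polytope $P$ is a collection of unimodular tetrahedra whose union equals $P$. *)

theory Defs
  imports "HOL-Analysis.Analysis"
begin

definition int_lattice :: "(real^3) set" where
  "int_lattice = {x. \<forall>i. x $ i \<in> \<int>}"

definition lattice_basis :: "(real^3) set \<Rightarrow> bool" where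
  "lattice_basis B \<longleftrightarrow> finite B \<and> independent B \<and>
     {x. \<exists>c :: real^3 \<Rightarrow> int. x = (\<Sum>b\<in>B. of_int (c b) *\<^sub>R b)} = int_lattice"

definition lattice_polytope :: "(real^3) set \<Rightarrow> bool" where
  "lattice_polytope P \<longleftrightarrow> (\<exists>V. finite V \<and> V \<subseteq> int_lattice \<and> P = convex hull V)"

definition lattice_3_polytope :: "(real^3) set \<Rightarrow> bool" where
  "lattice_3_polytope P \<longleftrightarrow> lattice_polytope P \<and> aff_dim P = 3"

definition simple_polytope :: "(real^3) set \<Rightarrow> bool" where
  "simple_polytope P \<longleftrightarrow> polytope P \<and>
     (\<forall>v. v extreme_point_of P \<longrightarrow> int (card {e. e edge_of P \<and> v \<in> e}) = aff_dim P)"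

(* The zero vector is excluded, since 0 = 2 * 0. *)
definition primitive :: "real^3 \<Rightarrow> bool" where
  "primitive u \<longleftrightarrow> u \<in> int_lattice \<and>
     (\<forall>(k::nat) w. w \<in> int_lattice \<and> u = real k *\<^sub>R w \<longrightarrow> k = 1)"

(* Meant for a vertex v; requiring t > 0 orients each edge away from v. *)
definition primitive_edge_directions :: "(real^3) set \<Rightarrow> real^3 \<Rightarrow> (real^3) set" where
  "primitive_edge_directions P v =
     {u. primitive u \<and> (\<exists>e. e edge_of P \<and> v \<in> e \<and> (\<exists>t>0. v + t *\<^sub>R u \<in> e))}"

definition smooth_polytope :: "(real^3) set \<Rightarrow> bool" where
  "smooth_polytope P \<longleftrightarrow> lattice_polytope P \<and> simple_polytope P \<and>
     (\<forall>v. v extreme_point_of P \<longrightarrow> lattice_basis (primitive_edge_directions P v))"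

(* The centre of symmetry c is arbitrary; neither c = 0 nor c in the lattice is required. *)
definition centrally_symmetric :: "(real^3) set \<Rightarrow> bool" where
  "centrally_symmetric P \<longleftrightarrow> (\<exists>c. (\<lambda>x. 2 *\<^sub>R c - x) ` P = P)"

(* The four vertices are automatically distinct: a lattice basis has three elements. *)
definition unimodular_tetrahedron :: "(real^3) set \<Rightarrow> bool" where
  "unimodular_tetrahedron T \<longleftrightarrow>
     (\<exists>v\<^sub>0 v\<^sub>1 v\<^sub>2 v\<^sub>3. {v\<^sub>0, v\<^sub>1, v\<^sub>2, v\<^sub>3} \<subseteq> int_lattice \<and> T = convex hull {v\<^sub>0, v\<^sub>1, v\<^sub>2, v\<^sub>3} \<and>
        lattice_basis {v\<^sub>1 - v\<^sub>0, v\<^sub>2 - v\<^sub>0, v\<^sub>3 - v\<^sub>0})"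

definition unimodular_cover :: "(real^3) set set \<Rightarrow> (real^3) set \<Rightarrow> bool" where
  "unimodular_cover \<T> P \<longleftrightarrow> (\<forall>T\<in>\<T>. unimodular_tetrahedron T) \<and> \<Union>\<T> = P"

end

theory Submission imports Defs
begin

text \<open>
The main tool is a descent on volumes. Let \<open>x\<close> lie in a lattice tetrahedron. If a lattice
point \<open>q\<close> has all its barycentric coordinates less than 1, then some vertex with positive
coordinate can be replaced by \<open>q\<close> such that \<open>x\<close> remains in the tetrahedron,
and the volume is multiplied by that coordinate (lemmas \<open>tet_fun_upd\<close> and
\<open>replace_vertex\<close>). Volumes are integers, so a convex region \<open>Q\<close> spanned by
lattice points is covered by unimodular tetrahedra as soon as every other lattice tetrahedron in
\<open>Q\<close> admits such a point \<open>q\<close> in \<open>Q\<close>. Such a tetrahedron contains a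
further lattice point, which serves as \<open>q\<close>, or it has a weighted sum \<open>s =
\<Sum>t\<^sub>i v\<^sub>i\<close> of its vertices in the lattice with \<open>0 < t\<^sub>i < 1\<close>
and \<open>\<Sum>t\<^sub>i = 2\<close>. In the second case each \<open>s - v\<^sub>j\<close> is
admissible as \<open>q\<close>, and so are the points from the weights \<open>1 - t\<^sub>i\<close>; it
remains to find one of these eight points in \<open>Q\<close>. This is done for two kinds of regions:
lattice parallelepipeds (\<open>parallelepiped_covered\<close>), and frustums between a unimodular
triangle and an integral multiple of it at lattice height 1 (\<open>frustum_covered\<close>).

Now let \<open>c\<close> be the centre of \<open>P\<close>. Every \<open>x\<close> in \<open>P\<close>
lies on a segment from \<open>c\<close> to a point \<open>y\<close> of a facet \<open>F\<close>. If
\<open>y\<close> is in a lattice parallelogram \<open>A\<close> contained in \<open>F\<close>, then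
\<open>x\<close> is in the lattice parallelepiped spanned by \<open>A\<close> and its reflection
\<open>2c - A\<close>, and this parallelepiped is contained in \<open>P\<close>. A facet of a smooth
polytope is a smooth polygon, and every point of it lies in a unimodular triangle in it. If
\<open>F\<close> is not itself a unimodular triangle, then \<open>F\<close> also contains one of the
three reflections of that triangle in its edges (\<open>reflected_triangle\<close>), and the two
together form the parallelogram \<open>A\<close>.

Finally suppose that \<open>F\<close> is a unimodular triangle. The neighbouring facets meet the lattice
plane at height 1 over \<open>F\<close> in a triangle of integral size \<open>1 + K\<close> whose
corners are in \<open>P\<close>, and central symmetry forces \<open>K \<ge> 1\<close>
(\<open>triangle_facet_wedge\<close>). If \<open>x\<close> has height at most 1, it lies in a frustum
contained in \<open>P\<close>. Otherwise the segment from \<open>c\<close> to \<open>y\<close> passes,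
beyond \<open>x\<close>, through the larger triangle; that one is of size at least 2 and therefore a
union of lattice parallelograms, which take the place of \<open>A\<close>.
\<close>

section \<open>Lattice bases and their coordinate functionals\<close>

definition det3 :: "real^3 \<Rightarrow> real^3 \<Rightarrow> real^3 \<Rightarrow> real" where
  "det3 a b c = det (vector [a, b, c] :: real^3^3)"

lemma det3_components:
  "det3 a b c = a$1 * (b$2 * c$3 - b$3 * c$2) + a$2 * (b$3 * c$1 - b$1 * c$3) + a$3 * (b$1 * c$2 - b$2 * c$1)"
  by (simp add: det3_def det_3 algebra_simps)

lemma det3_cramer:
  "det3 a b c *\<^sub>R x = det3 x b c *\<^sub>R a + det3 a x c *\<^sub>R b + det3 a b x *\<^sub>R c"
  by (simp add: vec_eq_iff forall_3 det3_components algebra_simps)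

lemma det3_eq_0D:
  assumes "det3 a b c = 0"
  obtains x y z :: real where "x *\<^sub>R a + y *\<^sub>R b + z *\<^sub>R c = 0" "x \<noteq> 0 \<or> y \<noteq> 0 \<or> z \<noteq> 0"
proof -
  let ?A = "vector [a, b, c] :: real^3^3"
  have "\<not> invertible ?A" using assms by (simp add: invertible_det_nz det3_def)
  then have "\<not> (\<exists>B. ?A ** B = mat 1)"
    by (simp add: invertible_right_inverse)
  then obtain k where k: "sum (\<lambda>i. k i *s row i ?A) UNIV = 0" "\<not> (\<forall>i. k i = 0)"
    unfolding matrix_right_invertible_independent_rows by blast
  have "k 1 *\<^sub>R a + k 2 *\<^sub>R b + k 3 *\<^sub>R c = 0"
    using k(1) by (simp add: sum_3 row_def vec_eq_iff forall_3)
  then show ?thesis using that k(2) by (auto simp: forall_3)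
qed

lemma det3_linear:
  "det3 (a + a') b c = det3 a b c + det3 a' b c" "det3 (r *\<^sub>R a) b c = r * det3 a b c"
  "det3 a (b + b') c = det3 a b c + det3 a b' c" "det3 a (r *\<^sub>R b) c = r * det3 a b c"
  "det3 a b (c + c') = det3 a b c + det3 a b c'" "det3 a b (r *\<^sub>R c) = r * det3 a b c"
  by (simp_all add: det3_components algebra_simps)

lemma det3_same: "det3 a a c = 0" "det3 a b a = 0" "det3 a b b = 0"
  by (simp_all add: det3_components algebra_simps)

text \<open>A lattice basis together with its dual basis. The functionals \<open>f\<close>,
\<open>g\<close>, \<open>h\<close> are kept as arguments because all later geometry is done in these
coordinates, which identify the lattice with \<open>\<int>\<^sup>3\<close>.\<close>
definition lattice_frame ::
  "real^3 \<Rightarrow> real^3 \<Rightarrow> real^3 \<Rightarrow> (real^3 \<Rightarrow> real) \<Rightarrow> (real^3 \<Rightarrow> real) \<Rightarrow> (real^3 \<Rightarrow> real) \<Rightarrow> bool" where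
  "lattice_frame a b c f g h \<longleftrightarrow> linear f \<and> linear g \<and> linear h \<and> {a, b, c} \<subseteq> int_lattice \<and>
     f a = 1 \<and> f b = 0 \<and> f c = 0 \<and> g a = 0 \<and> g b = 1 \<and> g c = 0 \<and> h a = 0 \<and> h b = 0 \<and> h c = 1 \<and>
     (\<forall>x. f x *\<^sub>R a + g x *\<^sub>R b + h x *\<^sub>R c = x) \<and>
     (\<forall>x\<in>int_lattice. f x \<in> \<int> \<and> g x \<in> \<int> \<and> h x \<in> \<int>)"

lemma det3_coordinates:
  assumes "det3 a b c \<noteq> 0"
  obtains f g h where "linear f" "linear g" "linear h"
     "f a = 1" "f b = 0" "f c = 0" "g a = 0" "g b = 1" "g c = 0" "h a = 0" "h b = 0" "h c = 1"
     "\<And>x. f x *\<^sub>R a + g x *\<^sub>R b + h x *\<^sub>R c = x"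
proof
  let ?d = "det3 a b c"
  show "linear (\<lambda>x. det3 x b c / ?d)" "linear (\<lambda>x. det3 a x c / ?d)" "linear (\<lambda>x. det3 a b x / ?d)"
    by (intro linearI; simp add: det3_linear add_divide_distrib)+
  show "(det3 x b c / ?d) *\<^sub>R a + (det3 a x c / ?d) *\<^sub>R b + (det3 a b x / ?d) *\<^sub>R c = x" for x
  proof -
    have "x = (1 / ?d) *\<^sub>R (?d *\<^sub>R x)" using assms by simp
    also have "\<dots> = (1 / ?d) *\<^sub>R (det3 x b c *\<^sub>R a + det3 a x c *\<^sub>R b + det3 a b x *\<^sub>R c)"
      by (rule arg_cong[OF det3_cramer])
    finally show ?thesis by (simp add: scaleR_add_right)
  qed
qed (use assms in \<open>simp_all add: det3_same\<close>)

lemma det3_nonzero_if_independent: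
  assumes "independent {a, b, c}" "a \<noteq> b" "a \<noteq> c" "b \<noteq> c"
  shows "det3 a b c \<noteq> 0"
proof
  assume "det3 a b c = 0"
  then obtain x y z :: real where 0: "x *\<^sub>R a + y *\<^sub>R b + z *\<^sub>R c = 0" and nz: "x \<noteq> 0 \<or> y \<noteq> 0 \<or> z \<noteq> 0"
    by (rule det3_eq_0D)
  define u where "u = (\<lambda>v. if v = a then x else if v = b then y else z)"
  have "(\<Sum>v\<in>{a,b,c}. u v *\<^sub>R v) = 0"
    using 0 assms(2-4) by (auto simp: u_def add.assoc)
  then have "u v = 0" if "v \<in> {a,b,c}" for v
    using independentD[OF assms(1) _ subset_refl _ that] by simp
  then have "u a = 0" "u b = 0" "u c = 0" by blast+
  then show False using nz assms(2-4) by (auto simp: u_def)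
qed

lemma lattice_frameD:
  assumes "lattice_frame a b c f g h"
  shows "linear f" "linear g" "linear h" "a \<in> int_lattice" "b \<in> int_lattice" "c \<in> int_lattice"
    "f a = 1" "f b = 0" "f c = 0" "g a = 0" "g b = 1" "g c = 0" "h a = 0" "h b = 0" "h c = 1"
    "\<And>x. f x *\<^sub>R a + g x *\<^sub>R b + h x *\<^sub>R c = x"
    "\<And>x. x \<in> int_lattice \<Longrightarrow> f x \<in> \<int>" "\<And>x. x \<in> int_lattice \<Longrightarrow> g x \<in> \<int>"
    "\<And>x. x \<in> int_lattice \<Longrightarrow> h x \<in> \<int>"
  using assms unfolding lattice_frame_def insert_subset by blast+

lemma int_lattice_closed:
  "0 \<in> int_lattice" "x \<in> int_lattice \<Longrightarrow> y \<in> int_lattice \<Longrightarrow> x + y \<in> int_lattice"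
  "x \<in> int_lattice \<Longrightarrow> y \<in> int_lattice \<Longrightarrow> x - y \<in> int_lattice"
  "x \<in> int_lattice \<Longrightarrow> - x \<in> int_lattice"
  "x \<in> int_lattice \<Longrightarrow> r \<in> \<int> \<Longrightarrow> r *\<^sub>R x \<in> int_lattice"
  by (auto simp: int_lattice_def)

lemma int_lattice_sum: "(\<And>i. i \<in> I \<Longrightarrow> w i \<in> int_lattice) \<Longrightarrow> sum w I \<in> int_lattice"
  by (induction I rule: infinite_finite_induct) (auto simp: int_lattice_closed)

lemma frame_independent:
  assumes "lattice_frame a b c f g h"
  shows "independent {a, b, c}" "a \<noteq> b" "a \<noteq> c" "b \<noteq> c"
proof -
  have lin: "linear f" "linear g" "linear h" 
   and v: "f a = 1" "f b = 0" "f c = 0" "g a = 0" "g b = 1" "g c = 0" "h a = 0" "h b = 0" "h c = 1"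
    using lattice_frameD[OF assms] by blast+
  show d: "a \<noteq> b" "a \<noteq> c" "b \<noteq> c" using v by auto
  show "independent {a, b, c}"
  proof (rule independent_if_scalars_zero)
    fix u x assume "(\<Sum>v\<in>{a,b,c}. u v *\<^sub>R v) = 0" and x: "x \<in> {a,b,c}"
    then have 0: "u a *\<^sub>R a + (u b *\<^sub>R b + u c *\<^sub>R c) = 0" using d by (simp add: add.assoc)
    have "f (u a *\<^sub>R a + (u b *\<^sub>R b + u c *\<^sub>R c)) = 0" "g (u a *\<^sub>R a + (u b *\<^sub>R b + u c *\<^sub>R c)) = 0"
       "h (u a *\<^sub>R a + (u b *\<^sub>R b + u c *\<^sub>R c)) = 0"
      unfolding 0 using lin by (simp_all add: linear_0)
    then have "u a = 0" "u b = 0" "u c = 0" using lin by (simp_all add: linear_add linear_scale v)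
    then show "u x = 0" using x by blast
  qed auto
qed

lemma frame_lattice_basis:
  assumes "lattice_frame a b c f g h"
  shows "lattice_basis {a, b, c}"
  unfolding lattice_basis_def
proof (intro conjI)
  show "independent {a, b, c}" by (rule frame_independent[OF assms])
  note d = frame_independent(2-4)[OF assms]
  show "{x. \<exists>k :: real^3 \<Rightarrow> int. x = (\<Sum>b\<in>{a,b,c}. of_int (k b) *\<^sub>R b)} = int_lattice" (is "?S = _")
  proof (intro subset_antisym subsetI)
    fix x assume "x \<in> ?S"
    then obtain k :: "real^3 \<Rightarrow> int" where x: "x = (\<Sum>b\<in>{a,b,c}. of_int (k b) *\<^sub>R b)" by blast
    show "x \<in> int_lattice" unfolding x
      by (rule int_lattice_sum, rule int_lattice_closed(5)) (use lattice_frameD(4-6)[OF assms] in auto)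
  next
    fix x assume x: "x \<in> int_lattice"
    then have "f x \<in> \<int>" "g x \<in> \<int>" "h x \<in> \<int>" using lattice_frameD[OF assms] by blast+
    then obtain i j k where ijk: "f x = of_int i" "g x = of_int j" "h x = of_int k" 
      by (auto elim!: Ints_cases)
    have "x = f x *\<^sub>R a + g x *\<^sub>R b + h x *\<^sub>R c" using lattice_frameD(16)[OF assms] by (rule sym)
    also have "\<dots> = (\<Sum>v\<in>{a,b,c}. of_int ((\<lambda>v. if v = a then i else if v = b then j else k) v) *\<^sub>R v)"
      using d ijk by (auto simp: add.assoc)
    finally show "x \<in> ?S" unfolding mem_Collect_eq
      by (rule exI[of _ "\<lambda>v. if v = a then i else if v = b then j else k"])
  qed
qed auto

lemma lattice_basis_subset:
  assumes "lattice_basis B" shows "B \<subseteq> int_lattice"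
proof
  fix v assume v: "v \<in> B"
  have "finite B" using assms by (simp add: lattice_basis_def)
  have "(\<Sum>b\<in>B. of_int (if b = v then 1 else 0) *\<^sub>R b) = (\<Sum>b\<in>B. if b = v then b else 0)"
    by (intro sum.cong) auto
  also have "\<dots> = v" using v \<open>finite B\<close> by simp
  finally have "\<exists>k :: real^3 \<Rightarrow> int. v = (\<Sum>b\<in>B. of_int (k b) *\<^sub>R b)" by (intro exI[of _ "\<lambda>b. if b = v then 1 else 0"]) (rule sym)
  then show "v \<in> int_lattice" using assms unfolding lattice_basis_def by blast
qed

lemma lattice_basis_card:
  assumes "lattice_basis B" shows "card B = 3"
proof -
  have "axis i 1 \<in> span B" for i :: 3
  proof -
    have "axis i 1 \<in> int_lattice" by (auto simp: int_lattice_def axis_def)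
    then obtain k :: "real^3 \<Rightarrow> int" where "axis i 1 = (\<Sum>b\<in>B. of_int (k b) *\<^sub>R b)"
      using assms unfolding lattice_basis_def by blast
    then show ?thesis by (simp add: span_sum span_scale span_base)
  qed
  then have "Basis \<subseteq> span B" by (auto simp: Basis_vec_def)
  then have "span B = UNIV" 
    using span_minimal[of Basis "span B"] by auto
  moreover have "independent B" using assms by (simp add: lattice_basis_def)
  ultimately show ?thesis 
    using dim_span_eq_card_independent[of B] by simp
qed

lemma lattice_basis_frame:
  assumes "lattice_basis {a, b, c}"
  obtains f g h where "lattice_frame a b c f g h"
proof -
  have card: "card {a, b, c} = 3" using assms by (rule lattice_basis_card)
  have d: "a \<noteq> b" "a \<noteq> c" "b \<noteq> c" using card by (auto simp: card_insert_if split: if_splits)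
  have "independent {a, b, c}" using assms by (simp add: lattice_basis_def)
  then have "det3 a b c \<noteq> 0" using d by (rule det3_nonzero_if_independent)
  then obtain f g h where lin: "linear f" "linear g" "linear h" and 
     v: "f a = 1" "f b = 0" "f c = 0" "g a = 0" "g b = 1" "g c = 0" "h a = 0" "h b = 0" "h c = 1"
     and x: "\<And>x. f x *\<^sub>R a + g x *\<^sub>R b + h x *\<^sub>R c = x"
    by (rule det3_coordinates) auto
  have "f x \<in> \<int> \<and> g x \<in> \<int> \<and> h x \<in> \<int>" if "x \<in> int_lattice" for x
  proof -
    from that assms obtain k :: "real^3 \<Rightarrow> int" where "x = (\<Sum>b\<in>{a,b,c}. of_int (k b) *\<^sub>R b)"
      unfolding lattice_basis_def by blast
    then have "x = of_int (k a) *\<^sub>R a + (of_int (k b) *\<^sub>R b + of_int (k c) *\<^sub>R c)" using d by (simp add: add.assoc)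
    then have "f x = k a" "g x = k b" "h x = k c" using lin by (simp_all add: linear_add linear_scale v)
    then show ?thesis by auto
  qed
  then have "lattice_frame a b c f g h" unfolding lattice_frame_def 
    using lin v x lattice_basis_subset[OF assms] by blast
  then show ?thesis by (rule that)
qed

lemma lattice_frame_rotate:
  assumes "lattice_frame a b c f g h"
  shows "lattice_frame b c a g h f"
proof -
  note D = lattice_frameD[OF assms]
  have "g x *\<^sub>R b + h x *\<^sub>R c + f x *\<^sub>R a = x" for x
    using D(16)[of x] by (simp only: add_ac)
  then show ?thesis using D unfolding lattice_frame_def insert_subset by blast
qed

lemma lattice_frame_swap:
  assumes "lattice_frame a b c f g h"
  shows "lattice_frame b a c g f h"
proof -
  note D = lattice_frameD[OF assms]
  have "g x *\<^sub>R b + f x *\<^sub>R a + h x *\<^sub>R c = x" for x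
    using D(16)[of x] by (simp only: add_ac)
  then show ?thesis using D unfolding lattice_frame_def insert_subset by blast
qed

section \<open>Descent on the volume of a tetrahedron\<close>

(* The vertices of a tetrahedron are numbered by the numerals 0, 1, 2, 3. *)
declare One_nat_def [simp del]

lemma arg_cong3: "a = a' \<Longrightarrow> b = b' \<Longrightarrow> c = c' \<Longrightarrow> f a b c = f a' b' c'"
  by simp

lemma lessThan_4: "{..<4::nat} = {0, 1, 2, 3}" by auto

lemma sum_lessThan_4: "sum w {..<4::nat} = w 0 + w 1 + w 2 + w 3"
  for w :: "nat \<Rightarrow> 'a::comm_monoid_add"
  by (simp add: lessThan_4 add.assoc)

lemma all_lessThan_4: "(\<forall>i<4::nat. Q i) \<longleftrightarrow> Q 0 \<and> Q 1 \<and> Q 2 \<and> Q 3"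
proof -
  have "(\<forall>i<4. Q i) \<longleftrightarrow> (\<forall>i\<in>{..<4}. Q i)" by auto
  also have "\<dots> \<longleftrightarrow> Q 0 \<and> Q 1 \<and> Q 2 \<and> Q 3" unfolding lessThan_4 by blast
  finally show ?thesis .
qed

lemma sum_remove_index: "i < 4 \<Longrightarrow> sum w {..<4} = w i + sum w ({..<4::nat} - {i})"
  for w :: "nat \<Rightarrow> 'a::comm_monoid_add"
  by (rule sum.remove) auto

lemma det3_span:
  assumes "det3 a b c \<noteq> 0"
  shows "\<exists>p q r. p *\<^sub>R a + q *\<^sub>R b + r *\<^sub>R c = x"
  by (rule det3_coordinates[OF assms, of ?thesis]) metis

definition tet :: "(nat \<Rightarrow> real^3) \<Rightarrow> real" where
  "tet v = det3 (v 1 - v 0) (v 2 - v 0) (v 3 - v 0)"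

definition bary :: "(nat \<Rightarrow> real) \<Rightarrow> (nat \<Rightarrow> real^3) \<Rightarrow> real^3" where
  "bary c v = (\<Sum>i<4. c i *\<^sub>R v i)"

lemma bary_expand:
  "bary c v = sum c {..<4} *\<^sub>R v 0 + (c 1 *\<^sub>R (v 1 - v 0) + c 2 *\<^sub>R (v 2 - v 0) + c 3 *\<^sub>R (v 3 - v 0))"
  by (simp add: bary_def sum_lessThan_4 algebra_simps)

lemma bary_from_vertex_0:
  assumes "sum c {..<4} = 1"
  shows "bary c v = v 0 + c 1 *\<^sub>R (v 1 - v 0) + c 2 *\<^sub>R (v 2 - v 0) + c 3 *\<^sub>R (v 3 - v 0)"
  unfolding bary_expand[of c v] assms by (simp add: add.assoc)

lemma barycentric_coordinates:
  assumes "tet v \<noteq> 0"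
  obtains c where "sum c {..<4} = 1" "bary c v = x"
proof -
  let ?a = "v 1 - v 0" and ?b = "v 2 - v 0" and ?c = "v 3 - v 0"
  obtain p q r where pqr: "p *\<^sub>R ?a + q *\<^sub>R ?b + r *\<^sub>R ?c = x - v 0"
    using det3_span[OF assms[unfolded tet_def]] by blast
  have eq: "v 0 + p *\<^sub>R ?a + q *\<^sub>R ?b + r *\<^sub>R ?c = x"
    using arg_cong[OF pqr, of "(+) (v 0)"] by (simp only: add.assoc) simp
  define c where "c = (\<lambda>i::nat. if i = 0 then 1 - p - q - r else if i = 1 then p else if i = 2 then q else r)"
  have c: "sum c {..<4} = 1" by (simp add: c_def sum_lessThan_4)
  have "c 1 = p" "c 2 = q" "c 3 = r" by (simp_all add: c_def)
  then have "bary c v = x" unfolding bary_from_vertex_0[OF c] by (simp only: eq)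
  with c show ?thesis by (rule that)
qed

text \<open>Replacing a vertex by a point multiplies the signed volume by the barycentric coordinate of
the point at that vertex, because all other terms of the point lie in the opposite face plane.\<close>
lemma tet_fun_upd:
  assumes "sum c {..<4} = 1" "i < 4"
  shows "tet (v(i := bary c v)) = c i * tet v"
proof -
  define a b d p where "a = v 1 - v 0" and "b = v 2 - v 0" and "d = v 3 - v 0" and "p = v 0"
  have v: "v 1 = p + a" "v 2 = p + b" "v 3 = p + d" "v 0 = p" by (simp_all add: a_def b_def d_def p_def)
  have c0: "c 0 = 1 - c 1 - c 2 - c 3" using assms by (simp add: sum_lessThan_4)
  have q: "bary c v = p + c 1 *\<^sub>R a + c 2 *\<^sub>R b + c 3 *\<^sub>R d"
    unfolding bary_from_vertex_0[OF assms(1)] a_def b_def d_def p_def by simp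
  have perm: "det3 b a d = - det3 a b d" "det3 a d b = - det3 a b d" "det3 d b a = - det3 a b d"
    "det3 b d a = det3 a b d" "det3 d a b = det3 a b d"
    by (simp_all add: det3_components algebra_simps)
  consider "i = 0" | "i = 1" | "i = 2" | "i = 3" using assms(2) by linarith
  then show ?thesis
  proof cases
    case 1
    let ?q = "p + c 1 *\<^sub>R a + c 2 *\<^sub>R b + c 3 *\<^sub>R d"
    have "tet (v(i := bary c v)) = det3 (p + a - ?q) (p + b - ?q) (p + d - ?q)"
      by (simp add: tet_def 1 q v)
    also have "\<dots> = det3 ((1 - c 1) *\<^sub>R a + ((- c 2) *\<^sub>R b + (- c 3) *\<^sub>R d))
       ((- c 1) *\<^sub>R a + ((1 - c 2) *\<^sub>R b + (- c 3) *\<^sub>R d)) 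
       ((- c 1) *\<^sub>R a + ((- c 2) *\<^sub>R b + (1 - c 3) *\<^sub>R d))"
      by (rule arg_cong3[where f = det3]) (simp_all add: algebra_simps)
    also have "\<dots> = (1 - c 1 - c 2 - c 3) * det3 a b d"
      unfolding det3_linear det3_same perm by algebra
    also have "\<dots> = c i * tet v" by (simp add: 1 c0 tet_def v)
    finally show ?thesis .
  qed (simp_all add: tet_def q v det3_linear det3_same add.assoc)
qed

lemma convex_hull_tet:
  "convex hull (v ` {..<4}) = {bary c v | c. (\<forall>i<4. 0 \<le> c i) \<and> sum c {..<4} = 1}"
    (is "_ = ?R")
proof
  have "convex ?R"
  proof (rule convexI)
    fix x y :: "real^3" and p q :: real
    assume "x \<in> ?R" "y \<in> ?R" and pq: "0 \<le> p" "0 \<le> q" "p + q = 1"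
    from \<open>x \<in> ?R\<close> obtain c where c: "\<forall>i<4. 0 \<le> c i" "sum c {..<4} = 1" "x = bary c v" by blast
    from \<open>y \<in> ?R\<close> obtain d where d: "\<forall>i<4. 0 \<le> d i" "sum d {..<4} = 1" "y = bary d v" by blast
    note cd = c d
    have "p *\<^sub>R x + q *\<^sub>R y = bary (\<lambda>i. p * c i + q * d i) v"
      by (simp add: cd bary_def scaleR_add_left sum.distrib scaleR_sum_right)
    moreover have "(\<Sum>i<4. p * c i + q * d i) = 1"
      using pq by (simp add: sum.distrib sum_distrib_left[symmetric] cd)
    moreover have "\<forall>i<4. 0 \<le> p * c i + q * d i" using cd pq by simp
    ultimately show "p *\<^sub>R x + q *\<^sub>R y \<in> ?R" by blast
  qed
  moreover have "v ` {..<4} \<subseteq> ?R"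
  proof (rule image_subsetI)
    fix i :: nat assume i: "i \<in> {..<4}"
    have "bary (\<lambda>j. if j = i then 1 else 0) v = (\<Sum>j<4. if j = i then v j else 0)"
      unfolding bary_def by (rule sum.cong) auto
    also have "\<dots> = v i" using i by simp
    finally have "v i = bary (\<lambda>j. if j = i then 1 else 0) v" by simp
    moreover have "(\<Sum>j<4. if j = i then 1 else 0 :: real) = 1" using i by simp
    moreover have "\<forall>j<4. 0 \<le> (if j = i then 1 else 0 :: real)" by simp
    ultimately show "v i \<in> ?R" by blast
  qed
  ultimately show "convex hull (v ` {..<4}) \<subseteq> ?R" by (rule hull_minimal[rotated])
  show "?R \<subseteq> convex hull (v ` {..<4})"
    unfolding bary_def by (auto intro!: convex_sum[OF _ convex_convex_hull] intro: hull_inc[OF imageI])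
qed

lemma tet_in_Ints:
  assumes "\<forall>i<4. v i \<in> int_lattice" shows "tet v \<in> \<int>"
  using assms unfolding all_lessThan_4
  by (auto simp: tet_def det3_components int_lattice_def intro!: Ints_add Ints_diff Ints_mult)

lemma bary_diff:
  assumes "i < 4"
  shows "bary (\<lambda>j. t j - (if j = i then 1 else 0)) v = bary t v - v i"
proof -
  have "bary (\<lambda>j. t j - (if j = i then 1 else 0)) v = 
     (\<Sum>j<4. t j *\<^sub>R v j - (if j = i then v j else 0))"
    unfolding bary_def by (rule sum.cong) (auto simp: scaleR_left_diff_distrib)
  also have "\<dots> = bary t v - (\<Sum>j<4. if j = i then v j else 0)"
    by (simp add: bary_def sum_subtractf)
  also have "(\<Sum>j<4. if j = i then v j else 0) = v i" using assms by simp
  finally show ?thesis .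
qed

text \<open>The pivot rule of the simplex method. Moving from \<open>x\<close> away from \<open>q = bary
c v\<close>, the coordinates \<open>d\<^sub>i - m * c\<^sub>i\<close> stay nonnegative until the first
of the ratios \<open>d\<^sub>i / c\<^sub>i\<close> with \<open>c\<^sub>i > 0\<close> is reached; at that
moment the coordinate of vertex \<open>i\<close> vanishes, and \<open>x\<close> is a convex combination
of \<open>q\<close> and the remaining vertices. Where \<open>c\<^sub>i \<le> 0\<close> the coordinate
only grows, so \<open>q\<close> may lie outside the tetrahedron.\<close>
lemma replace_vertex:
  assumes x: "x \<in> convex hull (v ` {..<4})"
    and c: "sum c {..<4} = 1" "\<And>i. i < 4 \<Longrightarrow> c i < 1"
  obtains i where "i < 4" "0 < c i" "x \<in> convex hull ((v(i := bary c v)) ` {..<4})"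
proof -
  obtain d where d: "\<And>i. i < 4 \<Longrightarrow> 0 \<le> d i" "sum d {..<4} = 1" "bary d v = x"
    using x unfolding convex_hull_tet by auto
  define I where "I = {i\<in>{..<4::nat}. 0 < c i}"
  have "finite I" by (simp add: I_def)
  have "I \<noteq> {}"
  proof
    assume "I = {}"
    then have "\<And>i. i < 4 \<Longrightarrow> c i \<le> 0" unfolding I_def by (metis (mono_tags, lifting) emptyE lessThan_iff mem_Collect_eq not_less)
    then have "sum c {..<4} \<le> 0" by (intro sum_nonpos) simp
    then show False using c by simp
  qed
  define i where "i = arg_min_on (\<lambda>i. d i / c i) I"
  have i: "i \<in> I" "\<And>j. j \<in> I \<Longrightarrow> d i / c i \<le> d j / c j"
    unfolding i_def using arg_min_if_finite(1)[OF \<open>finite I\<close> \<open>I \<noteq> {}\<close>] 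
      arg_min_least[OF \<open>finite I\<close> \<open>I \<noteq> {}\<close>] by auto
  then have i4: "i < 4" and ci: "0 < c i" by (auto simp: I_def)
  define m where "m = d i / c i"
  have m: "0 \<le> m" "m * c i = d i" using d(1)[OF i4] ci by (auto simp: m_def)
  define e where "e = (\<lambda>j. if j = i then m else d j - m * c j)"
  have nonneg: "0 \<le> e j" if "j < 4" for j
  proof (cases "j = i")
    case False
    show ?thesis
    proof (cases "0 < c j")
      case True
      then have "m \<le> d j / c j" using i(2) that by (auto simp: m_def I_def)
      then show ?thesis using True False by (simp add: e_def field_simps)
    next
      case neg: False
      then have "m * c j \<le> 0" using m(1) by (simp add: mult_nonneg_nonpos)
      then show ?thesis using d(1)[OF that] False by (simp add: e_def)
    qed
  qed (simp add: e_def m)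
  note split = sum_remove_index[OF i4]
  have s1: "sum e {..<4} = 1"
  proof -
    have "sum e {..<4} = m + (\<Sum>j\<in>{..<4} - {i}. d j - m * c j)" 
      unfolding split[of e] by (intro arg_cong2[where f = "(+)"] sum.cong) (auto simp: e_def)
    also have "\<dots> = m + (\<Sum>j<4. d j - m * c j)" unfolding split[of "\<lambda>j. d j - m * c j"] using m(2) by simp
    also have "\<dots> = 1" by (simp add: sum_subtractf sum_distrib_left[symmetric] c d(2))
    finally show ?thesis .
  qed
  have "bary e (v(i := bary c v)) = m *\<^sub>R bary c v + (\<Sum>j\<in>{..<4} - {i}. (d j - m * c j) *\<^sub>R v j)"
    unfolding bary_def[of e] split[of "\<lambda>j. e j *\<^sub>R (v(i := bary c v)) j"]
    by (intro arg_cong2[where f = "(+)"] sum.cong) (auto simp: e_def)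
  also have "\<dots> = m *\<^sub>R bary c v + (\<Sum>j<4. (d j - m * c j) *\<^sub>R v j)"
    unfolding split[of "\<lambda>j. (d j - m * c j) *\<^sub>R v j"] using m(2) by simp
  also have "\<dots> = bary d v"
    by (simp add: bary_def[of c] bary_def[of d] scaleR_left_diff_distrib sum_subtractf scaleR_sum_right)
  finally have "x = bary e (v(i := bary c v))" using d(3) by simp
  then have "x \<in> convex hull ((v(i := bary c v)) ` {..<4})"
    unfolding convex_hull_tet mem_Collect_eq using nonneg s1 by (intro exI[of _ e]) simp
  then show ?thesis by (rule that[OF i4 ci])
qed

definition unimodular_vertices :: "(nat \<Rightarrow> real^3) \<Rightarrow> bool" where
  "unimodular_vertices v \<longleftrightarrow> (\<forall>i<4. v i \<in> int_lattice) \<and> lattice_basis {v 1 - v 0, v 2 - v 0, v 3 - v 0}"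

text \<open>The exchange multiplies the volume by some \<open>c\<^sub>i\<close> with \<open>0 <
c\<^sub>i < 1\<close>, and the volumes of nondegenerate lattice tetrahedra are positive integers, so the
exchange can be made only finitely often. It stops at a unimodular tetrahedron containing
\<open>x\<close>.\<close>
lemma volume_descent:
  assumes step: "\<And>v. \<lbrakk>\<forall>i<4. v i \<in> S; tet v \<noteq> 0; \<not> unimodular_vertices v\<rbrakk>
      \<Longrightarrow> \<exists>c. (\<forall>i<4. c i < 1) \<and> sum c {..<4} = 1 \<and> bary c v \<in> S"
    and S: "S \<subseteq> int_lattice"
    and v: "\<forall>i<4. v i \<in> S" "tet v \<noteq> 0" "x \<in> convex hull (v ` {..<4})"
  obtains w where "\<forall>i<4. w i \<in> S" "unimodular_vertices w" "x \<in> convex hull (w ` {..<4})"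
proof -
  have "\<exists>w. (\<forall>i<4. w i \<in> S) \<and> unimodular_vertices w \<and> x \<in> convex hull (w ` {..<4})"
    using v
  proof (induction "nat \<lfloor>\<bar>tet v\<bar>\<rfloor>" arbitrary: v rule: less_induct)
    case less
    show ?case
    proof (cases "unimodular_vertices v")
      case True
      then show ?thesis using less.prems by blast
    next
      case False
      then obtain c where c: "\<forall>i<4. c i < 1" "sum c {..<4} = 1" "bary c v \<in> S"
        using step less.prems by blast
      obtain i where i: "i < 4" "0 < c i" "x \<in> convex hull ((v(i := bary c v)) ` {..<4})"
        using replace_vertex[OF less.prems(3) c(2)] c(1) by blast
      let ?w = "v(i := bary c v)"
      have w: "\<forall>j<4. ?w j \<in> S" using less.prems(1) c(3) by simp
      have tw: "tet ?w = c i * tet v" by (rule tet_fun_upd[OF c(2) i(1)])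
      have "\<bar>tet ?w\<bar> < \<bar>tet v\<bar>" using tw c(1) i less.prems(2) by (simp add: abs_mult)
      moreover have "\<bar>tet ?w\<bar> \<in> \<int>" "\<bar>tet v\<bar> \<in> \<int>" 
        using tet_in_Ints[of ?w] tet_in_Ints[of v] w less.prems(1) S by (auto simp: Ints_abs subset_iff)
      ultimately have "nat \<lfloor>\<bar>tet ?w\<bar>\<rfloor> < nat \<lfloor>\<bar>tet v\<bar>\<rfloor>"
        by (metis Ints_cases abs_ge_zero floor_of_int nat_less_eq_zless of_int_0_le_iff of_int_less_iff)
      moreover have "tet ?w \<noteq> 0" using tw i less.prems(2) by simp
      ultimately show ?thesis using less.hyps[OF _ w _ i(3)] by simp
    qed
  qed
  then show ?thesis using that by blast
qed

text \<open>A tetrahedron that is not unimodular misses some lattice point \<open>s\<close> in its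
integral coordinates. The fractional parts of the coordinates of \<open>s\<close> give a lattice point
of the half-open fundamental parallelepiped; the weight of the vertex 0 is then chosen in \<open>[0,
1)\<close> so as to make the sum of the weights an integer.\<close>
lemma fractional_lattice_point:
  assumes v: "\<forall>i<4. v i \<in> int_lattice" and nondeg: "tet v \<noteq> 0" and not: "\<not> unimodular_vertices v"
  obtains t where "\<forall>i<4. 0 \<le> t i \<and> t i < 1" "sum t {..<4} \<in> \<int>" "0 < sum t {..<4}" "bary t v \<in> int_lattice"
proof -
  let ?a = "v 1 - v 0" and ?b = "v 2 - v 0" and ?c = "v 3 - v 0"
  have abc: "?a \<in> int_lattice" "?b \<in> int_lattice" "?c \<in> int_lattice" and v0: "v 0 \<in> int_lattice"
    using v by (auto simp: all_lessThan_4 int_lattice_closed)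
  have nb: "\<not> lattice_basis {?a, ?b, ?c}" using not v by (simp add: unimodular_vertices_def)
  show ?thesis
  proof (rule det3_coordinates[OF nondeg[unfolded tet_def]])
    fix f g h :: "real^3 \<Rightarrow> real"
    assume lin: "linear f" "linear g" "linear h"
     and val: "f ?a = 1" "f ?b = 0" "f ?c = 0" "g ?a = 0" "g ?b = 1" "g ?c = 0" "h ?a = 0" "h ?b = 0" "h ?c = 1"
     and co: "\<And>x. f x *\<^sub>R ?a + g x *\<^sub>R ?b + h x *\<^sub>R ?c = x"
    obtain s where s: "s \<in> int_lattice" and ni: "f s \<notin> \<int> \<or> g s \<notin> \<int> \<or> h s \<notin> \<int>"
    proof (rule ccontr)
      assume "\<not> thesis"
      then have "\<forall>x\<in>int_lattice. f x \<in> \<int> \<and> g x \<in> \<int> \<and> h x \<in> \<int>" using that by blast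
      then have "lattice_frame ?a ?b ?c f g h"
        unfolding lattice_frame_def insert_subset using lin val co abc by blast
      then show False using nb frame_lattice_basis by blast
    qed
    define \<sigma> where "\<sigma> = frac (f s) + frac (g s) + frac (h s)"
    define t where "t = (\<lambda>i::nat. if i = 0 then frac (- \<sigma>) else if i = 1 then frac (f s) else if i = 2 then frac (g s) else frac (h s))"
    have tv: "t 0 = frac (- \<sigma>)" "t 1 = frac (f s)" "t 2 = frac (g s)" "t 3 = frac (h s)" by (simp_all add: t_def)
    have sum: "sum t {..<4} = of_int (- \<lfloor>- \<sigma>\<rfloor>)" 
      unfolding sum_lessThan_4 tv by (simp add: frac_def[of "- \<sigma>"]) (simp add: \<sigma>_def)
    have "s - (of_int \<lfloor>f s\<rfloor> *\<^sub>R ?a + of_int \<lfloor>g s\<rfloor> *\<^sub>R ?b + of_int \<lfloor>h s\<rfloor> *\<^sub>R ?c) =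
       (f s *\<^sub>R ?a + g s *\<^sub>R ?b + h s *\<^sub>R ?c) - (of_int \<lfloor>f s\<rfloor> *\<^sub>R ?a + of_int \<lfloor>g s\<rfloor> *\<^sub>R ?b + of_int \<lfloor>h s\<rfloor> *\<^sub>R ?c)"
      by (simp only: co)
    also have "\<dots> = t 1 *\<^sub>R ?a + t 2 *\<^sub>R ?b + t 3 *\<^sub>R ?c"
      unfolding tv frac_def scaleR_left_diff_distrib by simp
    finally have eq: "t 1 *\<^sub>R ?a + t 2 *\<^sub>R ?b + t 3 *\<^sub>R ?c = 
       s - (of_int \<lfloor>f s\<rfloor> *\<^sub>R ?a + of_int \<lfloor>g s\<rfloor> *\<^sub>R ?b + of_int \<lfloor>h s\<rfloor> *\<^sub>R ?c)" ..
    show thesis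
    proof (rule that)
      show "\<forall>i<4. 0 \<le> t i \<and> t i < 1" unfolding all_lessThan_4 tv by (simp add: frac_lt_1)
      show "sum t {..<4} \<in> \<int>" unfolding sum by simp
      have "0 < t 1 \<or> 0 < t 2 \<or> 0 < t 3" using ni unfolding tv by (auto simp: frac_gt_0_iff)
      moreover have "0 \<le> t 0" "0 \<le> t 1" "0 \<le> t 2" "0 \<le> t 3" unfolding tv by simp_all
      ultimately show "0 < sum t {..<4}" unfolding sum_lessThan_4 by linarith
      have "sum t {..<4} *\<^sub>R v 0 \<in> int_lattice" unfolding sum using v0 by (intro int_lattice_closed) auto
      moreover have "t 1 *\<^sub>R ?a + t 2 *\<^sub>R ?b + t 3 *\<^sub>R ?c \<in> int_lattice"
        unfolding eq
        by (intro int_lattice_closed(3)[OF s] int_lattice_closed(2) int_lattice_closed(5) abc) auto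
      ultimately show "bary t v \<in> int_lattice" unfolding bary_expand[of t v] by (rule int_lattice_closed(2))
    qed
  qed
qed

text \<open>The sum of the four fractional weights is 1, 2 or 3. With sum 1 they describe a lattice
point of the tetrahedron itself. Subtracting them from 1 at all vertices of positive weight leads from
sum 3, and from sum 2 with a zero weight, back to sum 1. What remains is sum 2 with all weights
positive: this case occurs for tetrahedra without further lattice points, and is the only one that needs
lattice points from outside the tetrahedron.\<close>
lemma nonunimodular_lattice_point:
  assumes v: "\<forall>i<4. v i \<in> int_lattice" and nondeg: "tet v \<noteq> 0" and not: "\<not> unimodular_vertices v"
  shows "(\<exists>c. (\<forall>i<4. 0 \<le> c i \<and> c i < 1) \<and> sum c {..<4} = 1 \<and> bary c v \<in> int_lattice) \<or>
    (\<exists>t. (\<forall>i<4. 0 < t i \<and> t i < 1) \<and> sum t {..<4} = 2 \<and> bary t v \<in> int_lattice)"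
proof -
  obtain t where t: "\<forall>i<4. 0 \<le> t i \<and> t i < 1" "sum t {..<4} \<in> \<int>" "0 < sum t {..<4}" and bt: "bary t v \<in> int_lattice"
    using fractional_lattice_point[OF assms] by blast
  note t4 = t(1)[unfolded all_lessThan_4] and t3 = t(3)[unfolded sum_lessThan_4]
  obtain N :: int where N: "sum t {..<4} = of_int N" using t(2) by (auto elim: Ints_cases)
  note N4 = N[unfolded sum_lessThan_4]
  consider "sum t {..<4} = 1" | "sum t {..<4} = 2" "\<forall>i<4. 0 < t i" 
    | "sum t {..<4} = 2" "\<not> (\<forall>i<4. 0 < t i)" | "sum t {..<4} = 3"
  proof -
    have "0 < real_of_int N" "real_of_int N < 4" using N4 t4 t3 by linarith+
    then have "N = 1 \<or> N = 2 \<or> N = 3" by linarith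
    then show thesis using that N by auto
  qed
  note cases = this
  define e where "e = (\<lambda>i. if t i = 0 then 0 else 1 :: real)"
  define c where "c = (\<lambda>i. e i - t i)"
  have c4: "0 \<le> c i \<and> c i < 1" if "i < 4" for i
    using t(1) that by (auto simp: c_def e_def order_le_less)
  have "bary c v = bary e v - bary t v"
    by (simp add: c_def bary_def scaleR_left_diff_distrib sum_subtractf)
  moreover have "bary e v \<in> int_lattice"
    unfolding bary_def using v by (intro int_lattice_sum) (auto simp: e_def int_lattice_closed)
  ultimately have bc: "bary c v \<in> int_lattice" using bt int_lattice_closed(3) by simp
  have complement: ?thesis if "sum c {..<4} = 1" using that c4 bc by blast
  have sc: "sum c {..<4} = e 0 + e 1 + e 2 + e 3 - sum t {..<4}"
    by (simp add: c_def sum_subtractf) (simp add: sum_lessThan_4)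
  have e01: "e i = 0 \<and> t i = 0 \<or> e i = 1 \<and> t i > 0" if "i < 4" for i
    using t(1) that by (auto simp: e_def order_le_less)
  note e4 = e01[of 0] e01[of 1] e01[of 2] e01[of 3]
  from cases show ?thesis
  proof cases
    case 1 then show ?thesis using t bt by blast
  next
    case 2 then show ?thesis using t bt by blast
  next
    case 3
    then have "t 0 = 0 \<or> t 1 = 0 \<or> t 2 = 0 \<or> t 3 = 0" using t4 unfolding all_lessThan_4 by linarith
    then have "e 0 + e 1 + e 2 + e 3 = 3" using e4 t4 3(1) unfolding sum_lessThan_4 by (elim disjE; simp; linarith)
    then show ?thesis using 3 by (intro complement) (simp add: sc)
  next
    case 4
    then have "e 0 + e 1 + e 2 + e 3 = 4" using e4 t4 unfolding sum_lessThan_4 by auto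
    then show ?thesis using 4 by (intro complement) (simp add: sc)
  qed
qed

lemma affine_hull_tet: 
  assumes "tet w \<noteq> 0" "\<forall>i<4. w i \<in> W" shows "affine hull W = UNIV"
proof -
  have w: "w 0 \<in> affine hull W" "w 1 \<in> affine hull W" "w 2 \<in> affine hull W" "w 3 \<in> affine hull W"
    using assms(2) by (auto intro: hull_inc)
  have "x \<in> affine hull W" for x
  proof -
    obtain c where c: "sum c {..<4} = 1" "bary c w = x" using barycentric_coordinates[OF assms(1)] by blast
    have "w 0 + c 1 *\<^sub>R (w 1 - w 0) + c 2 *\<^sub>R (w 2 - w 0) + c 3 *\<^sub>R (w 3 - w 0) \<in> affine hull W"
      by (intro mem_affine_3_minus affine_affine_hull w)
    then show ?thesis using bary_from_vertex_0[OF c(1), of w] c(2) by simp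
  qed
  then show ?thesis by blast
qed

lemma caratheodory_independent:
  fixes x :: "'a::euclidean_space"
  assumes "x \<in> convex hull W"
  obtains S where "S \<subseteq> W" "x \<in> convex hull S" "\<not> affine_dependent S"
proof -
  let ?P = "\<lambda>S. finite S \<and> S \<subseteq> W \<and> x \<in> convex hull S"
  have "\<exists>S. ?P S" using assms unfolding caratheodory[of W] by blast
  then obtain S0 where S0: "?P S0" by blast
  obtain S where S: "?P S" and least: "\<And>T. ?P T \<Longrightarrow> card S \<le> card T"
    using ex_has_least_nat[of ?P S0 card] S0 by auto
  have "x \<in> convex hull S" using S by blast
  then have "\<exists>T. finite T \<and> T \<subseteq> S \<and> card T \<le> aff_dim S + 1 \<and> x \<in> convex hull T"
    by (subst (asm) caratheodory_aff_dim) simp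
  then obtain T where T: "finite T" "T \<subseteq> S" "card T \<le> aff_dim S + 1" "x \<in> convex hull T" by blast
  have "card S \<le> card T" using T S by (intro least) auto
  then have "int (card S) \<le> aff_dim S + 1" using T(3) by linarith
  moreover have "aff_dim S \<le> int (card S) - 1" using S by (intro aff_dim_le_card) auto
  ultimately have "\<not> affine_dependent S" using S by (simp add: affine_independent_iff_card)
  then show ?thesis using S by (intro that[of S]) simp_all
qed

lemma enumerate_tet:
  assumes "\<not> affine_dependent T" "affine hull T = UNIV"
  obtains v where "v ` {..<4} = T" "tet v \<noteq> 0"
proof -
  have fin: "finite T" using assms(1) by (rule aff_independent_finite)
  have "aff_dim T = 3" using assms(2) using aff_dim_affine_hull[of T] by simp
  then have "card T = 4" using assms(1) by (simp add: affine_independent_iff_card)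
  then obtain v where v: "bij_betw v {0..<4::nat} T" using ex_bij_betw_nat_finite[OF fin] by auto
  then have img: "v ` {..<4} = T" and inj: "inj_on v {..<4}" by (auto simp: bij_betw_def lessThan_atLeast0)
  have "tet v \<noteq> 0"
  proof
    assume "tet v = 0"
    then obtain x y z :: real where rel: "x *\<^sub>R (v 1 - v 0) + y *\<^sub>R (v 2 - v 0) + z *\<^sub>R (v 3 - v 0) = 0"
      and nz: "x \<noteq> 0 \<or> y \<noteq> 0 \<or> z \<noteq> 0"
      unfolding tet_def by (rule det3_eq_0D)
    define c where "c = (\<lambda>i::nat. if i = 0 then - x - y - z else if i = 1 then x else if i = 2 then y else z)"
    have c: "c 0 = - x - y - z" "c 1 = x" "c 2 = y" "c 3 = z" by (simp_all add: c_def)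
    have s0: "sum c {..<4} = 0" by (simp add: sum_lessThan_4 c)
    have b0: "bary c v = 0" unfolding bary_expand[of c v] s0 c using rel by simp
    define U where "U = c \<circ> inv_into {..<4} v"
    have U: "U (v i) = c i" if "i < 4" for i using inj that by (simp add: U_def)
    have "sum U T = 0" unfolding img[symmetric] by (subst sum.reindex[OF inj]) (use s0 U in simp)
    moreover have "(\<Sum>u\<in>T. U u *\<^sub>R u) = 0" unfolding img[symmetric]
      by (subst sum.reindex[OF inj]) (use b0 U in \<open>simp add: bary_def\<close>)
    moreover have "\<exists>u\<in>T. U u \<noteq> 0"
    proof -
      have "U (v 1) \<noteq> 0 \<or> U (v 2) \<noteq> 0 \<or> U (v 3) \<noteq> 0" using nz by (simp add: U c)
      then show ?thesis using img by auto
    qed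
    ultimately show False using assms(1) affine_dependent_explicit_finite[OF fin] by blast
  qed
  with img show ?thesis by (rule that)
qed

text \<open>A minimal set of generators in the sense of Caratheodory is affinely independent, and an
affinely independent set extends to an affine basis inside the given generating set.\<close>
lemma initial_tet:
  assumes x: "x \<in> convex hull W" and w: "\<forall>i<4. w i \<in> W" "tet w \<noteq> 0"
  obtains v where "\<forall>i<4. v i \<in> W" "tet v \<noteq> 0" "x \<in> convex hull (v ` {..<4})"
proof -
  obtain S where S: "S \<subseteq> W" "x \<in> convex hull S" "\<not> affine_dependent S"
    using caratheodory_independent[OF x] .
  obtain T where T: "\<not> affine_dependent T" "S \<subseteq> T" "T \<subseteq> W" "affine hull T = affine hull W"
    using extend_to_affine_basis[OF S(3,1)] .
  obtain v where v: "v ` {..<4} = T" "tet v \<noteq> 0"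
    using enumerate_tet[OF T(1)] T(4) affine_hull_tet[OF w(2,1)] by auto
  show ?thesis
  proof (rule that)
    show "\<forall>i<4. v i \<in> W" using v(1) T(3) by auto
    show "tet v \<noteq> 0" by fact
    show "x \<in> convex hull (v ` {..<4})" using v(1) S(2) hull_mono[OF T(2)] by auto
  qed
qed

definition unimodularly_covered :: "(real^3) set \<Rightarrow> real^3 \<Rightarrow> bool" where
  "unimodularly_covered P x \<longleftrightarrow> (\<exists>T. unimodular_tetrahedron T \<and> T \<subseteq> P \<and> x \<in> T)"

lemma unimodularly_covered_mono: "unimodularly_covered Q x \<Longrightarrow> Q \<subseteq> P \<Longrightarrow> unimodularly_covered P x"
  unfolding unimodularly_covered_def by blast

text \<open>The form in which the descent is used: \<open>W\<close> provides a first tetrahedron around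
\<open>x\<close>, and only the weights of sum 2 have to be treated for the convex region
\<open>Q\<close> at hand.\<close>
theorem unimodular_descent:
  assumes x: "x \<in> convex hull W" and W: "W \<subseteq> Q \<inter> int_lattice" and w: "\<forall>i<4. w i \<in> W" "tet w \<noteq> 0"
    and step: "\<And>v t. \<lbrakk>\<forall>i<4. v i \<in> Q \<inter> int_lattice; tet v \<noteq> 0; \<forall>i<4. 0 < t i \<and> t i < 1;
       sum t {..<4} = 2; bary t v \<in> int_lattice\<rbrakk>
      \<Longrightarrow> \<exists>c. (\<forall>i<4. c i < 1) \<and> sum c {..<4} = 1 \<and> bary c v \<in> Q \<inter> int_lattice"
    and Q: "convex Q"
  obtains v where "\<forall>i<4. v i \<in> Q \<inter> int_lattice" "unimodular_vertices v" "x \<in> convex hull (v ` {..<4})"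
proof -
  obtain v where v: "\<forall>i<4. v i \<in> W" "tet v \<noteq> 0" "x \<in> convex hull (v ` {..<4})"
    using initial_tet[OF x w] .
  have S: "Q \<inter> int_lattice \<subseteq> int_lattice" by blast
  show ?thesis
  proof (rule volume_descent[OF _ S _ v(2,3)])
    fix v assume v: "\<forall>i<4. v i \<in> Q \<inter> int_lattice" "tet v \<noteq> 0" "\<not> unimodular_vertices v"
    have hull: "convex hull (v ` {..<4}) \<subseteq> Q" using v(1) Q by (intro hull_minimal) auto
    have "\<forall>i<4. v i \<in> int_lattice" using v(1) by auto
    from nonunimodular_lattice_point[OF this v(2,3)]
    show "\<exists>c. (\<forall>i<4. c i < 1) \<and> sum c {..<4} = 1 \<and> bary c v \<in> Q \<inter> int_lattice"
    proof (elim disjE exE conjE)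
      fix c assume c: "\<forall>i<4. 0 \<le> c i \<and> c i < 1" "sum c {..<4} = 1" "bary c v \<in> int_lattice"
      then have "bary c v \<in> convex hull (v ` {..<4})" unfolding convex_hull_tet by blast
      with c hull show ?thesis by blast
    next
      fix t assume "\<forall>i<4. 0 < t i \<and> t i < 1" "sum t {..<4} = 2" "bary t v \<in> int_lattice"
      then show ?thesis using step v(1,2) by blast
    qed
  next
    show "\<forall>i<4. v i \<in> Q \<inter> int_lattice" using v(1) W by blast
  qed (rule that)
qed

lemma unimodular_vertices_covered:
  assumes "\<forall>i<4. v i \<in> Q" "convex Q" "unimodular_vertices v" "x \<in> convex hull (v ` {..<4})"
  shows "unimodularly_covered Q x"
  unfolding unimodularly_covered_def
proof (intro exI conjI)
  have img: "v ` {..<4} = {v 0, v 1, v 2, v 3}" by (simp add: lessThan_4)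
  show "unimodular_tetrahedron (convex hull (v ` {..<4}))"
    unfolding unimodular_tetrahedron_def img
    using assms(3) by (intro exI[of _ "v 0"] exI[of _ "v 1"] exI[of _ "v 2"] exI[of _ "v 3"])
      (simp add: unimodular_vertices_def all_lessThan_4)
  show "convex hull (v ` {..<4}) \<subseteq> Q" using assms(1,2) by (intro hull_minimal) auto
qed (rule assms(4))

section \<open>Four weighted points in three strips\<close>

text \<open>Weights \<open>t\<^sub>i\<close> of sum 2 and their complements \<open>1 - t\<^sub>i\<close>
yield two lattice points \<open>s = \<Sum>t\<^sub>i v\<^sub>i\<close> and \<open>s' = \<Sum>(1 -
t\<^sub>i) v\<^sub>i\<close>, from which the eight points \<open>s - v\<^sub>j\<close> and \<open>s' -
v\<^sub>j\<close> arise as candidates for the exchange. An affine function with values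
\<open>p\<^sub>i\<close> in \<open>[0, 1]\<close> on the vertices has the value \<open>S -
p\<^sub>j\<close> at \<open>s - v\<^sub>j\<close>, where \<open>S = \<Sum>t\<^sub>i p\<^sub>i\<close>.
The predicate says that the candidate violates the strip of this function.\<close>
definition outside :: "real \<Rightarrow> real \<Rightarrow> bool" where
  "outside S p \<longleftrightarrow> S < p \<or> 1 < S - p"

lemma outside_reflect: "outside (2 - S) (1 - p) \<longleftrightarrow> outside S p"
  by (auto simp: outside_def)

text \<open>One strip and four vertices. The vertices get names instead of indices, because the lemmas
below distinguish their roles; other roles are obtained by instantiation.\<close>
locale weighted_quadruple =
  fixes ta tb tc td pa pb pc pd :: real
  assumes t: "0 < ta" "ta < 1" "0 < tb" "tb < 1" "0 < tc" "tc < 1" "0 < td" "td < 1" 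
    and t2: "ta + tb + tc + td = 2"
    and p: "0 \<le> pa" "pa \<le> 1" "0 \<le> pb" "pb \<le> 1" "0 \<le> pc" "pc \<le> 1" "0 \<le> pd" "pd \<le> 1"
begin

definition "S = ta * pa + tb * pb + tc * pc + td * pd"
definition "S' = (1 - ta) * pa + (1 - tb) * pb + (1 - tc) * pc + (1 - td) * pd"

lemma S_sum: "S + S' = pa + pb + pc + pd" by (simp add: S_def S'_def algebra_simps)

lemma pos: "0 \<le> ta * pa" "0 \<le> tb * pb" "0 \<le> tc * pc" "0 \<le> td * pd"
   "0 \<le> (1 - ta) * pa" "0 \<le> (1 - tb) * pb" "0 \<le> (1 - tc) * pc" "0 \<le> (1 - td) * pd"
  using t p by auto

lemma pair_above_weight: assumes "S < pa" "S < pb" shows "ta + tb < 1"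
proof -
  define m where "m = min pa pb"
  have "ta * m \<le> ta * pa" "tb * m \<le> tb * pb" using t by (auto simp: m_def)
  then have le: "m * (ta + tb) \<le> S" using pos by (simp add: S_def algebra_simps)
  have "S < m" "0 \<le> S" using assms pos by (auto simp: m_def S_def)
  with le have "m * (ta + tb) < m * 1" "0 < m" by linarith+
  then show ?thesis by (simp only: mult_less_cancel_left_pos)
qed

lemma pair_above_other_smaller: assumes "S < pa" "S < pb" shows "pc < min pa pb" "pd < min pa pb"
proof -
  define m where "m = min pa pb"
  have m: "ta * m \<le> ta * pa" "tb * m \<le> tb * pb" and Sm: "S < m" "0 \<le> S" 
    using t assms pos by (auto simp: m_def S_def)
  show "pc < min pa pb"
  proof (rule ccontr)
    assume "\<not> ?thesis" then have "tc * m \<le> tc * pc" using t by (auto simp: m_def)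
    then have "m * (2 - td) \<le> S" using m pos(4) t2 unfolding S_def by (simp add: algebra_simps flip: t2)
    moreover have "m * 1 \<le> m * (2 - td)" using t Sm by (intro mult_left_mono) auto
    ultimately show False using Sm by linarith
  qed
  show "pd < min pa pb"
  proof (rule ccontr)
    assume "\<not> ?thesis" then have "td * m \<le> td * pd" using t by (auto simp: m_def)
    then have "m * (2 - tc) \<le> S" using m pos(3) t2 unfolding S_def by (simp add: algebra_simps flip: t2)
    moreover have "m * 1 \<le> m * (2 - tc)" using t Sm by (intro mult_left_mono) auto
    ultimately show False using Sm by linarith
  qed
qed

lemma pair_above_complement: assumes "S < pa" "S < pb" shows "\<not> outside S' pa"
proof
  assume "outside S' pa"
  then consider "S' < pa" | "1 < S' - pa" unfolding outside_def by blast
  then show False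
  proof cases
    case 1 then show False using assms p S_sum by linarith
  next
    case 2
    have "pc < pa" "pd < pa" using pair_above_other_smaller[OF assms] by auto
    then have "(1 - tc) * (1 - pa) \<le> (1 - tc) * (1 - pc)" "(1 - td) * (1 - pa) \<le> (1 - td) * (1 - pd)"
      using t by (auto intro!: mult_left_mono)
    moreover have "0 \<le> (1 - tb) * (1 - pb)" using t p by simp
    moreover have "0 \<le> tb * (1 - pa)" using t p by simp
    moreover have "(1 - ta) * (1 - pa) + (1 - tb) * (1 - pb) + (1 - tc) * (1 - pc) + (1 - td) * (1 - pd) = 2 - S'"
    proof -
      have "(1 - ta) * (1 - pa) + (1 - tb) * (1 - pb) + (1 - tc) * (1 - pc) + (1 - td) * (1 - pd)
          = 4 - (ta + tb + tc + td) - S'" by (simp add: S'_def algebra_simps)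
      then show ?thesis using t2 by simp
    qed
    moreover have "(1 - ta) * (1 - pa) + (1 - tc) * (1 - pa) + (1 - td) * (1 - pa) = (1 - pa) + tb * (1 - pa)"
    proof -
      have e: "tb = 2 - ta - tc - td" using t2 by simp
      show ?thesis unfolding e by (simp add: algebra_simps)
    qed
    ultimately show False using 2 by linarith
  qed
qed

lemma above_below_weights: 
  assumes "S < pa" "1 < S' - pb" "1 \<le> ta + tc" "1 \<le> ta + td" shows False
proof -
  have 1: "(1 - ta) * pc \<le> tc * pc" "(1 - ta) * pd \<le> td * pd" using assms p by (auto intro!: mult_right_mono)
  have 2: "(1 - tc) * pc \<le> ta * pc" "(1 - td) * pd \<le> ta * pd" using assms p by (auto intro!: mult_right_mono)
  have "(1 - ta) * (pc + pd) < (1 - ta) * pa" using assms(1) 1 pos(2) by (simp add: S_def algebra_simps)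
  then have "pc + pd < pa" using t by simp
  then have "ta * (pc + pd) < ta * pa" using t by simp
  moreover have "1 + tb * pb < (1 - ta) * pa + ta * (pc + pd)" using assms(2) 2 by (simp add: S'_def algebra_simps)
  ultimately show False using pos(2) p(2) by (simp add: algebra_simps)
qed

end

text \<open>The strip is symmetric under \<open>p \<mapsto> 1 - p\<close>, which exchanges its two
sides.\<close>
lemma weighted_quadruple_reflect:
  assumes "weighted_quadruple ta tb tc td pa pb pc pd"
  shows "weighted_quadruple ta tb tc td (1 - pa) (1 - pb) (1 - pc) (1 - pd)"
    "weighted_quadruple.S ta tb tc td (1 - pa) (1 - pb) (1 - pc) (1 - pd) = 2 - weighted_quadruple.S ta tb tc td pa pb pc pd"
    "weighted_quadruple.S' ta tb tc td (1 - pa) (1 - pb) (1 - pc) (1 - pd) = 2 - weighted_quadruple.S' ta tb tc td pa pb pc pd"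
proof -
  interpret weighted_quadruple ta tb tc td pa pb pc pd by fact
  show *: "weighted_quadruple ta tb tc td (1 - pa) (1 - pb) (1 - pc) (1 - pd)"
    using t t2 p by unfold_locales auto
  have e: "ta = 2 - tb - tc - td" using t2 by simp
  show "weighted_quadruple.S ta tb tc td (1 - pa) (1 - pb) (1 - pc) (1 - pd) = 2 - S"
    unfolding weighted_quadruple.S_def[OF *] S_def by (simp add: e algebra_simps)
  show "weighted_quadruple.S' ta tb tc td (1 - pa) (1 - pb) (1 - pc) (1 - pd) = 2 - S'"
    unfolding weighted_quadruple.S'_def[OF *] S'_def by (simp add: e algebra_simps)
qed

context weighted_quadruple
begin

interpretation flip: weighted_quadruple ta tb tc td "1 - pa" "1 - pb" "1 - pc" "1 - pd"
  by (rule weighted_quadruple_reflect) unfold_locales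

lemma flip_S: "flip.S = 2 - S" "flip.S' = 2 - S'"
  by (rule weighted_quadruple_reflect; unfold_locales)+

lemma outside_pair_cases:
  assumes "outside S pa" "outside S pb"
  shows "S < pa \<and> S < pb \<or> flip.S < 1 - pa \<and> flip.S < 1 - pb"
  using assms p unfolding outside_def flip_S by auto

text \<open>Two candidates of the same kind can only leave a strip on the same side. If it is the lower
side, then \<open>S < m = min p\<^sub>a p\<^sub>b\<close>, while \<open>S \<ge> t\<^sub>a p\<^sub>a +
t\<^sub>b p\<^sub>b \<ge> (t\<^sub>a + t\<^sub>b) m\<close>.\<close>
lemma outside_pair_weight: "outside S pa \<Longrightarrow> outside S pb \<Longrightarrow> ta + tb < 1"
  using outside_pair_cases pair_above_weight flip.pair_above_weight by blast

text \<open>On the lower side, the remaining values \<open>p\<^sub>c\<close> and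
\<open>p\<^sub>d\<close> must lie below \<open>p\<^sub>a\<close> and \<open>p\<^sub>b\<close> to keep
\<open>S\<close> small. This makes \<open>S'\<close> at most \<open>1 + p\<^sub>a\<close>, and \<open>S'
\<ge> p\<^sub>a\<close> since \<open>S + S'\<close> is the sum of the four values.\<close>
lemma outside_pair_complement: "outside S pa \<Longrightarrow> outside S pb \<Longrightarrow> \<not> outside S' pa"
  using outside_pair_cases pair_above_complement flip.pair_above_complement 
  unfolding flip_S outside_reflect by blast

text \<open>Candidates of different kinds at different vertices leave a strip only on opposite sides,
again by the value of \<open>S + S'\<close>. If \<open>S < p\<^sub>a\<close>, then the bounds
\<open>t\<^sub>c, t\<^sub>d \<ge> 1 - t\<^sub>a\<close> give \<open>p\<^sub>c + p\<^sub>d <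
p\<^sub>a\<close>; in \<open>S'\<close> the weights of \<open>p\<^sub>c\<close> and
\<open>p\<^sub>d\<close> are at most \<open>t\<^sub>a\<close>, so that \<open>S' - p\<^sub>b\<close>
stays below 1.\<close>
lemma outside_mixed:
  assumes "outside S pa" "outside S' pb" "1 \<le> ta + tc" "1 \<le> ta + td" shows False
proof -
  consider "S < pa" "S' < pb" | "S < pa" "1 < S' - pb" | "1 < S - pa" "S' < pb" | "1 < S - pa" "1 < S' - pb"
    using assms unfolding outside_def by blast
  then show False
  proof cases
    case 1 then show False using S_sum p by linarith
  next
    case 2 then show False using above_below_weights assms by blast
  next
    case 3 then show False using flip.above_below_weights assms unfolding flip_S by simp
  next
    case 4 then show False using S_sum p by linarith
  qed
qed

end

lemma index_split2:
  assumes "i < 4" "j < 4" "i \<noteq> (j::nat)"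
  obtains k l where "k < 4" "l < 4" "k \<noteq> i" "k \<noteq> j" "l \<noteq> i" "l \<noteq> j" "k \<noteq> l"
    "\<And>w :: nat \<Rightarrow> real. sum w {..<4} = w i + w j + w k + w l"
proof -
  have "finite ({..<4::nat} - {i, j})" "card ({..<4::nat} - {i, j}) = 2" using assms by auto
  then obtain k l where kl: "{..<4} - {i, j} = {k, l}" "k \<noteq> l" by (auto simp: card_2_iff)
  then have k: "k \<in> {..<4} - {i,j}" "l \<in> {..<4} - {i,j}" by auto
  have set: "{..<4} = {i, j, k, l}" using kl(1) assms by auto
  show ?thesis
  proof (rule that[of k l])
    show "sum w {..<4} = w i + w j + w k + w l" for w :: "nat \<Rightarrow> real"
      unfolding set using k kl(2) assms by auto
  qed (use k kl in auto)
qed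

context
  fixes t :: "nat \<Rightarrow> real" and \<phi> :: "nat \<Rightarrow> nat \<Rightarrow> real" and S S' :: "nat \<Rightarrow> real"
  assumes t: "\<forall>i<4. 0 < t i \<and> t i < 1" "sum t {..<4} = 2"
    and \<phi>: "\<And>k i. k < 3 \<Longrightarrow> i < 4 \<Longrightarrow> 0 \<le> \<phi> k i \<and> \<phi> k i \<le> 1"
    and S: "\<And>k. k < 3 \<Longrightarrow> S k = (\<Sum>i<4. t i * \<phi> k i)" and S': "\<And>k. k < 3 \<Longrightarrow> S' k = (\<Sum>i<4. (1 - t i) * \<phi> k i)"
begin

text \<open>The last statement is the first one for the complementary weights.\<close>
lemma outside_facts:
  assumes "i < 4" "j < 4" "i \<noteq> j" "k < 3"
  shows "outside (S k) (\<phi> k i) \<Longrightarrow> outside (S k) (\<phi> k j) \<Longrightarrow> t i + t j < 1"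
    and "outside (S k) (\<phi> k i) \<Longrightarrow> outside (S k) (\<phi> k j) \<Longrightarrow> \<not> outside (S' k) (\<phi> k i)"
    and "outside (S k) (\<phi> k i) \<Longrightarrow> outside (S' k) (\<phi> k j) \<Longrightarrow> \<forall>l<4. l \<noteq> i \<longrightarrow> 1 \<le> t i + t l \<Longrightarrow> False"
    and "outside (S' k) (\<phi> k i) \<Longrightarrow> outside (S' k) (\<phi> k j) \<Longrightarrow> 1 < t i + t j"
proof -
  obtain m l where ml: "m < 4" "l < 4" "m \<noteq> i" "m \<noteq> j" "l \<noteq> i" "l \<noteq> j" "m \<noteq> l"
    and sum: "\<And>w :: nat \<Rightarrow> real. sum w {..<4} = w i + w j + w m + w l"
    using index_split2[OF assms(1-3)] by metis
  note b = t(1)[rule_format, OF assms(1)] t(1)[rule_format, OF assms(2)] t(1)[rule_format, OF ml(1)] t(1)[rule_format, OF ml(2)]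
    \<phi>[OF assms(4,1)] \<phi>[OF assms(4,2)] \<phi>[OF assms(4) ml(1)] \<phi>[OF assms(4) ml(2)]
  have t2: "t i + t j + t m + t l = 2" using t(2) sum by simp
  interpret weighted_quadruple "t i" "t j" "t m" "t l" "\<phi> k i" "\<phi> k j" "\<phi> k m" "\<phi> k l"
    using b t2 by unfold_locales auto
  interpret c: weighted_quadruple "1 - t i" "1 - t j" "1 - t m" "1 - t l" "\<phi> k i" "\<phi> k j" "\<phi> k m" "\<phi> k l"
    using b t2 by unfold_locales auto
  have eqS: "S k = local.S" "S' k = local.S'" "S' k = c.S"
    using assms(4) by (simp_all add: \<open>\<And>k. k < 3 \<Longrightarrow> S k = _\<close> \<open>\<And>k. k < 3 \<Longrightarrow> S' k = _\<close> sum S_def S'_def c.S_def)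
  show "outside (S k) (\<phi> k i) \<Longrightarrow> outside (S k) (\<phi> k j) \<Longrightarrow> t i + t j < 1"
    using outside_pair_weight by (simp add: eqS)
  show "outside (S k) (\<phi> k i) \<Longrightarrow> outside (S k) (\<phi> k j) \<Longrightarrow> \<not> outside (S' k) (\<phi> k i)"
    using outside_pair_complement by (simp add: eqS(1,2))
  show "outside (S k) (\<phi> k i) \<Longrightarrow> outside (S' k) (\<phi> k j) \<Longrightarrow> \<forall>l<4. l \<noteq> i \<longrightarrow> 1 \<le> t i + t l \<Longrightarrow> False"
    using outside_mixed ml by (simp add: eqS(1,2))
  show "outside (S' k) (\<phi> k i) \<Longrightarrow> outside (S' k) (\<phi> k j) \<Longrightarrow> 1 < t i + t j"
    using c.outside_pair_weight by (simp add: eqS(3))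
qed

text \<open>A pigeonhole argument. Suppose that all eight candidates fail. The strip \<open>k1\<close>
that rejects the heavy vertex \<open>i\<close> rejects no candidate at another vertex, neither for
\<open>t\<close> nor for the complementary weights. So the three other vertices share the two remaining
strips, and one strip \<open>k\<close> rejects two of them, \<open>j\<close> and \<open>l\<close>. Their
complementary candidates pass the strip \<open>k\<close> as well as \<open>k1\<close>, hence are both
rejected by the third strip. This forces \<open>t\<^sub>j + t\<^sub>l < 1\<close> and \<open>t\<^sub>j +
t\<^sub>l > 1\<close>.\<close>
lemma three_strips_heavy:
  assumes i: "i < 4" and heavy: "\<forall>l<4. l \<noteq> i \<longrightarrow> 1 \<le> t i + t l"
  shows "(\<exists>j<4. \<forall>k<3. \<not> outside (S k) (\<phi> k j)) \<or> (\<exists>j<4. \<forall>k<3. \<not> outside (S' k) (\<phi> k j))"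
proof (rule ccontr)
  assume "\<not> ?thesis"
  then have A: "\<And>j. j < 4 \<Longrightarrow> \<exists>k<3. outside (S k) (\<phi> k j)" and B: "\<And>j. j < 4 \<Longrightarrow> \<exists>k<3. outside (S' k) (\<phi> k j)"
    by blast+
  obtain k1 where k1: "k1 < 3" "outside (S k1) (\<phi> k1 i)" using A[OF i] by blast
  have no1: "\<not> outside (S k1) (\<phi> k1 j)" "\<not> outside (S' k1) (\<phi> k1 j)" if "j < 4" "j \<noteq> i" for j
    using outside_facts(1)[OF i that(1) _ k1(1)] outside_facts(3)[OF i that(1) _ k1(1)] k1(2) heavy that by force+
  have no2: False if k: "k < 3" "k \<noteq> k1" and j: "j < 4" "j \<noteq> i" and l: "l < 4" "l \<noteq> i" "j \<noteq> l"
    and o: "outside (S k) (\<phi> k j)" "outside (S k) (\<phi> k l)" for k j l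
  proof -
    have "\<not> outside (S' k) (\<phi> k j)" "\<not> outside (S' k) (\<phi> k l)" and lt: "t j + t l < 1"
      using outside_facts(1,2)[OF j(1) l(1) l(3) k(1)] outside_facts(2)[OF l(1) j(1) l(3)[symmetric] k(1)] o by blast+
    moreover obtain kj where "kj < 3" "outside (S' kj) (\<phi> kj j)" using B[OF j(1)] by blast
    moreover obtain kl where "kl < 3" "outside (S' kl) (\<phi> kl l)" using B[OF l(1)] by blast
    moreover have "kj = kl"
    proof -
      have "kj \<noteq> k" "kj \<noteq> k1" "kl \<noteq> k" "kl \<noteq> k1" using calculation no1 j l by blast+
      then show ?thesis using k k1(1) \<open>kj < 3\<close> \<open>kl < 3\<close> by linarith
    qed
    ultimately have "1 < t j + t l" using outside_facts(4)[OF j(1) l(1) l(3)] by blast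
    with lt show False by simp
  qed
  obtain j1 where j1: "j1 < 4" "j1 \<noteq> i" by (metis zero_less_numeral one_less_numeral_iff semiring_norm(76) zero_neq_one)
  obtain j2 j3 where j23: "j2 < 4" "j3 < 4" "j2 \<noteq> i" "j2 \<noteq> j1" "j3 \<noteq> i" "j3 \<noteq> j1" "j2 \<noteq> j3"
    using index_split2[OF i j1(1) j1(2)[symmetric]] by metis
  obtain c1 c2 c3 where c: "c1 < 3" "outside (S c1) (\<phi> c1 j1)" "c2 < 3" "outside (S c2) (\<phi> c2 j2)" 
    "c3 < 3" "outside (S c3) (\<phi> c3 j3)"
    using A[OF j1(1)] A[OF j23(1)] A[OF j23(2)] by blast
  have "c1 \<noteq> k1" "c2 \<noteq> k1" "c3 \<noteq> k1" using c no1 j1 j23 by blast+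
  moreover from this have "c1 = c2 \<or> c1 = c3 \<or> c2 = c3" using c(1,3,5) k1(1) by linarith
  ultimately show False using no2 c j1 j23 by metis
qed

end

text \<open>A heavy vertex exists for \<open>t\<close> or for \<open>1 - t\<close>: compare the sum of
the largest and the smallest weight with 1.\<close>
lemma three_strips:
  fixes t :: "nat \<Rightarrow> real" and \<phi> :: "nat \<Rightarrow> nat \<Rightarrow> real"
  assumes t: "\<forall>i<4. 0 < t i \<and> t i < 1" "sum t {..<4} = 2"
    and \<phi>: "\<And>k i. k < 3 \<Longrightarrow> i < 4 \<Longrightarrow> 0 \<le> \<phi> k i \<and> \<phi> k i \<le> 1"
  shows "(\<exists>j<4. \<forall>k<3. \<not> outside (\<Sum>i<4. t i * \<phi> k i) (\<phi> k j)) \<or> 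
         (\<exists>j<4. \<forall>k<3. \<not> outside (\<Sum>i<4. (1 - t i) * \<phi> k i) (\<phi> k j))"
proof -
  define j where "j = arg_min_on t {..<4}"
  have fin: "finite {..<4::nat}" "{..<4::nat} \<noteq> {}" by (auto simp: lessThan_4)
  have j: "j < 4" "\<And>l. l < 4 \<Longrightarrow> t j \<le> t l"
    unfolding j_def using arg_min_if_finite(1)[OF fin] arg_min_least[OF fin] by auto
  have "\<exists>i\<in>{..<4}. \<forall>l\<in>{..<4}. t l \<le> t i"
    using Max_in[of "t ` {..<4}"] Max_ge[of "t ` {..<4}"] fin by fastforce
  then obtain i where i: "i < 4" "\<And>l. l < 4 \<Longrightarrow> t l \<le> t i" by auto
  show ?thesis
  proof (cases "1 \<le> t i + t j")
    case True
    then have "\<forall>l<4. l \<noteq> i \<longrightarrow> 1 \<le> t i + t l" using j(2) by force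
    then show ?thesis by (intro three_strips_heavy[of t \<phi> _ _ i]) (use t \<phi> i in auto)
  next
    case False
    then have "\<forall>l<4. l \<noteq> j \<longrightarrow> 1 \<le> (1 - t j) + (1 - t l)" using i(2) by force
    then have "(\<exists>j<4. \<forall>k<3. \<not> outside (\<Sum>i<4. (1 - t i) * \<phi> k i) (\<phi> k j)) \<or> 
         (\<exists>j<4. \<forall>k<3. \<not> outside (\<Sum>i<4. t i * \<phi> k i) (\<phi> k j))"
      by (intro three_strips_heavy[of "\<lambda>i. 1 - t i" \<phi> _ _ j]) (use t \<phi> j in \<open>auto simp: sum_subtractf\<close>)
    then show ?thesis by blast
  qed
qed

section \<open>Lattice parallelepipeds\<close>

lemma linear_bary:
  assumes "linear f" "sum c {..<4} = 1"
  shows "f (bary c v - p) = (\<Sum>i<4. c i * f (v i - p))"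
proof -
  have "(\<Sum>i<4. c i * f (v i - p)) = (\<Sum>i<4. c i * f (v i)) - sum c {..<4} * f p"
    using assms(1) by (simp add: linear_diff right_diff_distrib sum_subtractf sum_distrib_right)
  moreover have "f (bary c v) = (\<Sum>i<4. c i * f (v i))"
    using assms(1) by (simp add: bary_def linear_sum linear_scale)
  ultimately show ?thesis using assms by (simp add: linear_diff)
qed

text \<open>The barycentric coordinates of the candidate \<open>s - v\<^sub>j\<close>. They are less
than 1, and negative at the vertex \<open>j\<close>.\<close>
definition drop_vertex :: "(nat \<Rightarrow> real) \<Rightarrow> nat \<Rightarrow> nat \<Rightarrow> real" where
  "drop_vertex t j = (\<lambda>i. t i - (if i = j then 1 else 0))"

lemma sum_drop_vertex: 
  assumes "j < 4"
  shows "(\<Sum>i<4. drop_vertex t j i * w i) = (\<Sum>i<4. t i * w i) - w j"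
proof -
  have "(\<Sum>i<4. drop_vertex t j i * w i) = (\<Sum>i<4. t i * w i - (if i = j then w i else 0))"
    unfolding drop_vertex_def by (rule sum.cong) (auto simp: left_diff_distrib)
  also have "\<dots> = (\<Sum>i<4. t i * w i) - w j" using assms by (simp add: sum_subtractf)
  finally show ?thesis .
qed

lemma descent_candidate:
  assumes t: "\<forall>i<4. 0 < t i \<and> t i < 1" "sum t {..<4} = 2" "bary t v \<in> int_lattice"
    and v: "\<forall>i<4. v i \<in> Q \<inter> int_lattice" and j: "j < 4" and Q: "bary (drop_vertex t j) v \<in> Q"
  shows "\<exists>c. (\<forall>i<4. c i < 1) \<and> sum c {..<4} = 1 \<and> bary c v \<in> Q \<inter> int_lattice"
proof (intro exI[of _ "drop_vertex t j"] conjI)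
  show "\<forall>i<4. drop_vertex t j i < 1" using t(1) by (auto simp: drop_vertex_def)
  show "sum (drop_vertex t j) {..<4} = 1"
    using sum_drop_vertex[OF j, of t "\<lambda>_. 1"] t(2) by simp
  have "bary (drop_vertex t j) v = bary t v - v j" unfolding drop_vertex_def by (rule bary_diff[OF j])
  then show "bary (drop_vertex t j) v \<in> Q \<inter> int_lattice" using Q t(3) v j int_lattice_closed(3) by auto
qed

lemma complementary_weights:
  assumes t: "\<forall>i<4. 0 < t i \<and> t i < 1" "sum t {..<4} = 2" "bary t v \<in> int_lattice"
    and v: "\<forall>i<4. v i \<in> int_lattice"
  shows "\<forall>i<4. 0 < 1 - t i \<and> 1 - t i < 1" "(\<Sum>i<4. 1 - t i) = 2" "bary (\<lambda>i. 1 - t i) v \<in> int_lattice"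
proof -
  show "\<forall>i<4. 0 < 1 - t i \<and> 1 - t i < 1" using t(1) by auto
  show "(\<Sum>i<4. 1 - t i) = 2" using t(2) by (simp add: sum_subtractf)
  have "bary (\<lambda>i. 1 - t i) v = sum v {..<4} - bary t v"
    by (simp add: bary_def scaleR_left_diff_distrib sum_subtractf)
  then show "bary (\<lambda>i. 1 - t i) v \<in> int_lattice"
    using v t(3) by (auto intro!: int_lattice_closed(3) int_lattice_sum)
qed

definition parallelepiped :: "real^3 \<Rightarrow> real^3 \<Rightarrow> real^3 \<Rightarrow> real^3 \<Rightarrow> (real^3) set" where
  "parallelepiped p a b c = {p + \<alpha> *\<^sub>R a + \<beta> *\<^sub>R b + \<gamma> *\<^sub>R c | \<alpha> \<beta> \<gamma>. \<alpha> \<in> {0..1} \<and> \<beta> \<in> {0..1} \<and> \<gamma> \<in> {0..1}}"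

lemma convex_step: 
  assumes "convex C" "y \<in> C" "y + d \<in> C" "\<gamma> \<in> {0..1::real}" shows "y + \<gamma> *\<^sub>R d \<in> C"
proof -
  have "(1 - \<gamma>) *\<^sub>R y + \<gamma> *\<^sub>R (y + d) \<in> C" using assms by (intro convexD) auto
  then show ?thesis by (simp add: algebra_simps)
qed

definition corners :: "real^3 \<Rightarrow> real^3 \<Rightarrow> real^3 \<Rightarrow> real^3 \<Rightarrow> (real^3) set" where
  "corners p a b c = {p, p + a, p + b, p + a + b, p + c, p + a + c, p + b + c, p + a + b + c}"

lemma parallelepiped_subset_convex:
  assumes C: "convex C" and c: "corners p a b c \<subseteq> C"
  shows "parallelepiped p a b c \<subseteq> C"
proof
  fix x assume "x \<in> parallelepiped p a b c"
  then obtain \<alpha> \<beta> \<gamma> where x: "x = p + \<alpha> *\<^sub>R a + \<beta> *\<^sub>R b + \<gamma> *\<^sub>R c" and r: "\<alpha> \<in> {0..1}" "\<beta> \<in> {0..1}" "\<gamma> \<in> {0..1}"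
    unfolding parallelepiped_def by auto
  note step = convex_step[OF C]
  have 1: "y + \<alpha> *\<^sub>R a \<in> C" if "y \<in> C" "y + a \<in> C" for y using step[OF that r(1)] .
  have a: "p + \<alpha> *\<^sub>R a \<in> C" "p + b + \<alpha> *\<^sub>R a \<in> C" "p + c + \<alpha> *\<^sub>R a \<in> C" "p + b + c + \<alpha> *\<^sub>R a \<in> C"
    by (rule 1; use c in \<open>simp add: corners_def add_ac\<close>)+
  have b: "p + \<alpha> *\<^sub>R a + \<beta> *\<^sub>R b \<in> C" "p + c + \<alpha> *\<^sub>R a + \<beta> *\<^sub>R b \<in> C"
    by (rule step[OF _ _ r(2)]; use a in \<open>simp add: add_ac\<close>)+
  show "x \<in> C" unfolding x by (rule step[OF _ _ r(3)], use b in \<open>simp_all add: add_ac\<close>)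
qed

text \<open>In the dual coordinates of its edges a parallelepiped is the intersection of three strips,
so one of the eight candidates lies in it.\<close>
theorem parallelepiped_covered:
  assumes pabc: "p \<in> int_lattice" "a \<in> int_lattice" "b \<in> int_lattice" "c \<in> int_lattice"
    and nondeg: "det3 a b c \<noteq> 0" and x: "x \<in> parallelepiped p a b c"
  shows "unimodularly_covered (parallelepiped p a b c) x"
proof (rule det3_coordinates[OF nondeg])
  fix f g h :: "real^3 \<Rightarrow> real"
  assume lin: "linear f" "linear g" "linear h"
     and val: "f a = 1" "f b = 0" "f c = 0" "g a = 0" "g b = 1" "g c = 0" "h a = 0" "h b = 0" "h c = 1"
     and co: "\<And>x. f x *\<^sub>R a + g x *\<^sub>R b + h x *\<^sub>R c = x"
  let ?Q = "parallelepiped p a b c"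
  have Q: "y \<in> ?Q \<longleftrightarrow> f (y - p) \<in> {0..1} \<and> g (y - p) \<in> {0..1} \<and> h (y - p) \<in> {0..1}" for y
  proof
    assume "y \<in> ?Q"
    then obtain \<alpha> \<beta> \<gamma> where y: "y = p + \<alpha> *\<^sub>R a + \<beta> *\<^sub>R b + \<gamma> *\<^sub>R c" and r: "\<alpha> \<in> {0..1}" "\<beta> \<in> {0..1}" "\<gamma> \<in> {0..1}"
      unfolding parallelepiped_def by auto
    have "y - p = \<alpha> *\<^sub>R a + \<beta> *\<^sub>R b + \<gamma> *\<^sub>R c" by (simp add: y)
    then have "f (y - p) = \<alpha>" "g (y - p) = \<beta>" "h (y - p) = \<gamma>"
      using lin by (simp_all add: linear_add linear_scale val)
    then show "f (y - p) \<in> {0..1} \<and> g (y - p) \<in> {0..1} \<and> h (y - p) \<in> {0..1}" using r by simp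
  next
    assume r: "f (y - p) \<in> {0..1} \<and> g (y - p) \<in> {0..1} \<and> h (y - p) \<in> {0..1}"
    have "y = p + (f (y - p) *\<^sub>R a + g (y - p) *\<^sub>R b + h (y - p) *\<^sub>R c)" unfolding co by simp
    then show "y \<in> ?Q" unfolding parallelepiped_def mem_Collect_eq
      by (intro exI[of _ "f (y - p)"] exI[of _ "g (y - p)"] exI[of _ "h (y - p)"] conjI) (use r in \<open>simp_all add: add.assoc\<close>)
  qed
  have "convex ?Q"
  proof (rule convexI)
    fix y z :: "real^3" and u w :: real
    assume yz: "y \<in> ?Q" "z \<in> ?Q" and uw: "0 \<le> u" "0 \<le> w" "u + w = 1"
    have e: "u *\<^sub>R y + w *\<^sub>R z - p = u *\<^sub>R (y - p) + w *\<^sub>R (z - p)"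
      using arg_cong[OF uw(3), of "\<lambda>r. r *\<^sub>R p"] by (simp add: algebra_simps)
    have "u * r + w * s \<in> {0..1}" if "r \<in> {0..1}" "s \<in> {0..1}" for r s :: real
      using that uw convexD[OF convex_closed_interval[of 0 "1::real"], of r s u w] by (auto simp: cbox_interval)
    then show "u *\<^sub>R y + w *\<^sub>R z \<in> ?Q"
      using yz lin unfolding Q e by (simp add: linear_add linear_scale)
  qed
  have corners_Q: "corners p a b c \<subseteq> ?Q"
    unfolding corners_def insert_subset Q using lin by (simp add: linear_add linear_diff linear_0 val)
  show ?thesis
  proof (rule unimodular_descent[of x "corners p a b c" ?Q "(\<lambda>_. p)(1 := p + a, 2 := p + b, 3 := p + c)"])
    show "x \<in> convex hull corners p a b c"
      using parallelepiped_subset_convex[OF convex_convex_hull hull_subset] x by blast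
    show "corners p a b c \<subseteq> ?Q \<inter> int_lattice"
      using corners_Q pabc by (auto simp: corners_def intro!: int_lattice_closed)
    show "\<forall>i<4. ((\<lambda>_. p)(1 := p + a, 2 := p + b, 3 := p + c)) i \<in> corners p a b c"
      by (auto simp: corners_def)
    show "tet ((\<lambda>_. p)(1 := p + a, 2 := p + b, 3 := p + c)) \<noteq> 0" using nondeg by (simp add: tet_def)
    show "convex ?Q" by fact
  next
    fix v t assume v: "\<forall>i<4. v i \<in> ?Q \<inter> int_lattice" and t: "\<forall>i<4. 0 < t i \<and> t i < 1" "sum t {..<4} = 2" "bary t v \<in> int_lattice"
    define \<phi> where "\<phi> = (\<lambda>(k::nat) i. (if k = 0 then f else if k = 1 then g else h) (v i - p))"
    have \<phi>: "0 \<le> \<phi> k i \<and> \<phi> k i \<le> 1" if "i < 4" for k i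
      using v that by (auto simp: \<phi>_def Q)
    have inQ: "bary (drop_vertex s j) v \<in> ?Q" 
      if "j < 4" "\<forall>k<3. \<not> outside (\<Sum>i<4. s i * \<phi> k i) (\<phi> k j)" "sum s {..<4} = 2" for s j
    proof -
      have s1: "sum (drop_vertex s j) {..<4} = 1" using sum_drop_vertex[OF that(1), of s "\<lambda>_. 1"] that(3) by simp
      have k: "(\<Sum>i<4. drop_vertex s j i * \<phi> k i) \<in> {0..1}" if k: "k < 3" for k
        using \<open>\<forall>k<3. _ k\<close>[rule_format, OF k] unfolding sum_drop_vertex[OF \<open>j < 4\<close>] outside_def by auto
      have "f (bary (drop_vertex s j) v - p) = (\<Sum>i<4. drop_vertex s j i * \<phi> 0 i)"
        "g (bary (drop_vertex s j) v - p) = (\<Sum>i<4. drop_vertex s j i * \<phi> 1 i)"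
        "h (bary (drop_vertex s j) v - p) = (\<Sum>i<4. drop_vertex s j i * \<phi> 2 i)"
        using linear_bary[OF _ s1] lin by (simp_all add: \<phi>_def)
      then show ?thesis unfolding Q using k[of 0] k[of 1] k[of 2] by simp
    qed
    have vl: "\<forall>i<4. v i \<in> int_lattice" using v by auto
    consider j where "j < 4" "\<forall>k<3. \<not> outside (\<Sum>i<4. t i * \<phi> k i) (\<phi> k j)"
      | j where "j < 4" "\<forall>k<3. \<not> outside (\<Sum>i<4. (1 - t i) * \<phi> k i) (\<phi> k j)"
      using three_strips[OF t(1,2), of \<phi>] \<phi> by blast
    then show "\<exists>c. (\<forall>i<4. c i < 1) \<and> sum c {..<4} = 1 \<and> bary c v \<in> ?Q \<inter> int_lattice"
    proof cases
      case 1
      show ?thesis by (rule descent_candidate[OF t v 1(1) inQ[OF 1 t(2)]])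
    next
      case 2
      note t' = complementary_weights[OF t vl]
      show ?thesis by (rule descent_candidate[OF t' v 2(1) inQ[OF 2 t'(2)]])
    qed
  next
    fix v assume "\<forall>i<4. v i \<in> ?Q \<inter> int_lattice" "unimodular_vertices v" "x \<in> convex hull (v ` {..<4})"
    then show ?thesis using \<open>convex ?Q\<close> by (intro unimodular_vertices_covered[of v]) auto
  qed
qed

section \<open>Vertex cones of smooth polytopes\<close>

lemma minimal_face:
  fixes P :: "'a::euclidean_space set"
  assumes "polytope P" "z \<in> P"
  obtains G where "G face_of P" "z \<in> rel_interior G"
proof -
  have "\<exists>G. G face_of P \<and> z \<in> G" using assms by (intro exI[of _ P]) (simp add: face_of_refl polytope_imp_convex)
  then obtain G0 where "G0 face_of P \<and> z \<in> G0" by blast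
  then obtain G where G: "G face_of P \<and> z \<in> G" 
    and least: "\<And>F. F face_of P \<and> z \<in> F \<Longrightarrow> nat (aff_dim G + 1) \<le> nat (aff_dim F + 1)"
    using ex_has_least_nat[of "\<lambda>G. G face_of P \<and> z \<in> G" G0 "\<lambda>G. nat (aff_dim G + 1)"] by auto
  have pG: "polytope G" using G assms(1) face_of_polytope_polytope by blast
  have "z \<in> rel_interior G"
  proof (rule ccontr)
    assume "z \<notin> rel_interior G"
    moreover have "z \<in> closure G" using G closure_subset by blast
    ultimately have "z \<in> rel_frontier G" by (simp add: rel_frontier_def)
    then obtain F where F: "F facet_of G" "z \<in> F"
      using rel_frontier_of_polyhedron[OF polytope_imp_polyhedron[OF pG]] by auto
    have "F face_of P" using F(1) G face_of_trans facet_of_imp_face_of by blast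
    then have "nat (aff_dim G + 1) \<le> nat (aff_dim F + 1)" using F(2) by (intro least) simp
    moreover have "aff_dim F = aff_dim G - 1" using F(1) by (simp add: facet_of_def)
    moreover have "aff_dim F \<noteq> -1" using F(2) aff_dim_empty[of F] by auto
    moreover have "-1 \<le> aff_dim F" by (rule aff_dim_geq)
    ultimately show False by linarith
  qed
  with G show ?thesis using that by blast
qed

lemma flat_direction:
  fixes a :: "'a::euclidean_space"
  assumes "z \<in> G" "2 \<le> aff_dim G"
  obtains d where "d \<noteq> 0" "a \<bullet> d = 0" "\<And>r. z + r *\<^sub>R d \<in> affine hull G"
proof -
  have "\<not> G \<subseteq> {z}" using assms(2) aff_dim_subset[of G "{z}"] by auto
  then obtain y1 where y1: "y1 \<in> G" "y1 \<noteq> z" by blast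
  have "aff_dim {z, y1} \<le> 1" using aff_dim_le_card[of "{z, y1}"] y1 by simp
  then have "\<not> G \<subseteq> affine hull {z, y1}" using assms(2) aff_dim_subset[of G "affine hull {z, y1}"] by auto
  then obtain y2 where y2: "y2 \<in> G" "y2 \<notin> affine hull {z, y1}" by blast
  define p q where "p = a \<bullet> (y1 - z)" and "q = a \<bullet> (y2 - z)"
  define d where "d = (if p = 0 then y1 - z else p *\<^sub>R (y2 - z) - q *\<^sub>R (y1 - z))"
  have "a \<bullet> d = 0" by (simp add: d_def inner_diff_right p_def q_def algebra_simps)
  moreover have "d \<noteq> 0"
  proof
    assume "d = 0"
    then have p: "p \<noteq> 0" and "p *\<^sub>R (y2 - z) = q *\<^sub>R (y1 - z)" using y1 by (auto simp: d_def split: if_splits)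
    then have "y2 - z = (q / p) *\<^sub>R (y1 - z)" by (simp add: eq_vector_fraction_iff)
    then have "y2 = (1 - q / p) *\<^sub>R z + (q / p) *\<^sub>R y1" by (simp add: algebra_simps)
    then have "y2 \<in> affine hull {z, y1}" unfolding affine_hull_2 mem_Collect_eq by (intro exI[of _ "1 - q / p"] exI[of _ "q / p"]) simp
    with y2 show False by blast
  qed
  moreover have "z + r *\<^sub>R d \<in> affine hull G" for r
  proof -
    have m: "z \<in> affine hull G" "y1 \<in> affine hull G" "y2 \<in> affine hull G" using assms y1 y2 by (auto intro: hull_inc)
    have "z + (r * p) *\<^sub>R (y2 - z) + (- (r * q)) *\<^sub>R (y1 - z) \<in> affine hull G" "z + r *\<^sub>R (y1 - z) \<in> affine hull G"
      by (intro mem_affine_3_minus affine_affine_hull m)+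
    then show ?thesis by (auto simp: d_def algebra_simps)
  qed
  ultimately show ?thesis using that by blast
qed

text \<open>A polytope lies in the cone spanned at a vertex by its edges. A hyperplane \<open>a
\<bullet> x = c\<close> separating \<open>v\<close> from all other vertices cuts \<open>P\<close> in a
slice \<open>R\<close>. An extreme point of \<open>R\<close> lies in the relative interior of a face of
dimension 1, since a face of larger dimension contains a direction parallel to the hyperplane and no
vertex of \<open>P\<close> lies on it. That edge has an end above the hyperplane, which can only be
\<open>v\<close>. So \<open>R\<close> lies in the cone by the theorem of Krein and Milman, and every
other vertex is seen from \<open>v\<close> through \<open>R\<close>.\<close>
lemma vertex_cone_of_edges:
  fixes P :: "'a::euclidean_space set"
  assumes P: "polytope P" and v: "v extreme_point_of P"
    and C: "convex C" "cone C" "0 \<in> C"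
    and edges: "\<And>e z. e edge_of P \<Longrightarrow> v \<in> e \<Longrightarrow> z \<in> e \<Longrightarrow> z - v \<in> C"
    and x: "x \<in> P"
  shows "x - v \<in> C"
proof -
  have poly: "polyhedron P" and cpt: "compact P" and cvx: "convex P"
    using P by (auto simp: polytope_imp_polyhedron polytope_imp_compact polytope_imp_convex)
  define W where "W = {w. w extreme_point_of P}"
  have hullW: "P = convex hull W" unfolding W_def by (rule Krein_Milman_Minkowski[OF cpt cvx])
  have finW: "finite W" unfolding W_def by (rule finite_polyhedron_extreme_points[OF poly])
  have "{v} exposed_face_of P" using v exposed_face_of_polyhedron[OF poly] by (simp add: face_of_singleton)
  then obtain a b where ab: "P \<subseteq> {x. a \<bullet> x \<le> b}" "{v} = P \<inter> {x. a \<bullet> x = b}"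
    unfolding exposed_face_of_def by blast
  have lt: "a \<bullet> w < b" if "w \<in> W" "w \<noteq> v" for w
  proof -
    have "w \<in> P" using that by (simp add: W_def extreme_point_of_def)
    then show ?thesis using ab that(2) by fastforce
  qed
  define m where "m = Max (insert (b - 1) ((\<lambda>w. a \<bullet> w) ` (W - {v})))"
  have fin: "finite (insert (b - 1) ((\<lambda>w. a \<bullet> w) ` (W - {v})))" using finW by simp
  have m: "m < b" unfolding m_def using lt fin by (subst Max_less_iff) auto
  have le_m: "a \<bullet> w \<le> m" if "w \<in> W" "w \<noteq> v" for w unfolding m_def using that fin by (intro Max_ge) auto
  define c where "c = (m + b) / 2"
  have c: "m < c" "c < b" using m by (auto simp: c_def)
  define R where "R = P \<inter> {x. a \<bullet> x = c}"
  have R: "compact R" "convex R" unfolding R_def using cpt cvx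
    by (auto intro: compact_Int_closed closed_hyperplane convex_Int convex_hyperplane)
  have cvxC: "convex {z. z - v \<in> C}"
  proof -
    have "z \<in> (+) v ` C" if "z - v \<in> C" for z using that by (intro image_eqI[of _ _ "z - v"]) auto
    then have "{z. z - v \<in> C} = (+) v ` C" by auto
    then show ?thesis using C(1) convex_translation by simp
  qed
  have "R \<subseteq> {z. z - v \<in> C}"
  proof -
    have "z - v \<in> C" if z: "z extreme_point_of R" for z
    proof -
      have zR: "z \<in> R" using z by (simp add: extreme_point_of_def)
      then have zP: "z \<in> P" and az: "a \<bullet> z = c" by (auto simp: R_def)
      obtain G where G: "G face_of P" "z \<in> rel_interior G" using minimal_face[OF P zP] .
      have zG: "z \<in> G" using G(2) rel_interior_subset by blast
      have "\<not> 2 \<le> aff_dim G"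
      proof
        assume "2 \<le> aff_dim G"
        then obtain d where d: "d \<noteq> 0" "a \<bullet> d = 0" "\<And>r. z + r *\<^sub>R d \<in> affine hull G"
          using flat_direction[OF zG] by blast
        obtain \<epsilon> where \<epsilon>: "\<epsilon> > 0" "cball z \<epsilon> \<inter> affine hull G \<subseteq> G"
          using G(2) by (auto simp: mem_rel_interior_cball)
        define r where "r = \<epsilon> / norm d"
        have r: "r > 0" "norm (r *\<^sub>R d) = \<epsilon>" using \<epsilon> d by (auto simp: r_def)
        have "z + s *\<^sub>R d \<in> R" if "\<bar>s\<bar> = r" for s
        proof -
          have "z + s *\<^sub>R d \<in> cball z \<epsilon>" using that r by (simp add: dist_norm)
          then have "z + s *\<^sub>R d \<in> G" using \<epsilon>(2) d(3) by blast
          then have "z + s *\<^sub>R d \<in> P" using G(1) face_of_imp_subset by blast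
          then show ?thesis using az d(2) by (simp add: R_def inner_add_right)
        qed
        from this[of r] this[of "- r"] have "z + r *\<^sub>R d \<in> R" "z - r *\<^sub>R d \<in> R" using r by auto
        moreover have "z \<in> open_segment (z + r *\<^sub>R d) (z - r *\<^sub>R d)"
        proof -
          have "z = midpoint (z + r *\<^sub>R d) (z - r *\<^sub>R d)" by (simp add: midpoint_def)
          moreover have "z + r *\<^sub>R d \<noteq> z - r *\<^sub>R d"
          proof
            assume "z + r *\<^sub>R d = z - r *\<^sub>R d"
            then have "r *\<^sub>R d + r *\<^sub>R d = 0" by (simp add: algebra_simps)
            then have "(r + r) *\<^sub>R d = 0" by (simp only: scaleR_add_left)
            then show False using r d by simp
          qed
          ultimately show ?thesis using midpoint_in_open_segment by metis
        qed
        ultimately show False using z unfolding extreme_point_of_def by blast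
      qed
      moreover have "aff_dim G \<noteq> 0"
      proof
        assume "aff_dim G = 0"
        then have "G = {z}" using zG by (auto simp: aff_dim_eq_0)
        then have "z \<in> W" using G(1) by (simp add: W_def face_of_singleton)
        then show False using le_m[of z] az c ab(2) by (cases "z = v") auto
      qed
      moreover have "aff_dim G \<noteq> -1" using zG aff_dim_empty[of G] by auto
      ultimately have "aff_dim G = 1" using aff_dim_geq[of G] by linarith
      then have edge: "G edge_of P" using G(1) by (simp add: edge_of_def)
      have "compact G" "convex G" using G(1) cpt cvx face_of_imp_compact face_of_imp_convex by blast+
      then have Gh: "G = convex hull {w. w extreme_point_of G}" by (rule Krein_Milman_Minkowski)
      have "v \<in> G"
      proof (rule ccontr)
        assume "v \<notin> G"
        then have "{w. w extreme_point_of G} \<subseteq> {x. a \<bullet> x \<le> m}"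
          using le_m extreme_point_of_face[OF G(1)] by (auto simp: W_def)
        then have "G \<subseteq> {x. a \<bullet> x \<le> m}" by (subst Gh) (intro hull_minimal convex_halfspace_le)
        then show False using zG az c by auto
      qed
      then show ?thesis using edges[OF edge _ zG] by blast
    qed
    then have "convex hull {z. z extreme_point_of R} \<subseteq> {z. z - v \<in> C}" using cvxC by (intro hull_minimal) auto
    then show ?thesis using Krein_Milman_Minkowski[OF R] by simp
  qed
  note RC = this
  have "W \<subseteq> {z. z - v \<in> C}"
  proof
    fix w assume w: "w \<in> W"
    show "w \<in> {z. z - v \<in> C}"
    proof (cases "w = v")
      case False
      have vP: "v \<in> P" "a \<bullet> v = b" using ab(2) by auto
      have wP: "w \<in> P" using w by (simp add: W_def extreme_point_of_def)
      define \<tau> where "\<tau> = (b - c) / (b - a \<bullet> w)"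
      have aw: "a \<bullet> w \<le> m" using le_m w False by blast
      have \<tau>: "0 < \<tau>" "\<tau> \<le> 1" "\<tau> * (b - a \<bullet> w) = b - c" using aw c by (auto simp: \<tau>_def field_simps)
      define z where "z = v + \<tau> *\<^sub>R (w - v)"
      have "z \<in> P" unfolding z_def using convexD_alt[OF cvx vP(1) wP, of \<tau>] \<tau> by (simp add: algebra_simps)
      moreover have "a \<bullet> z = c" using \<tau>(3) by (simp add: z_def inner_add_right inner_diff_right vP algebra_simps)
      ultimately have "z - v \<in> C" using RC by (auto simp: R_def)
      then have "(1 / \<tau>) *\<^sub>R (z - v) \<in> C" using C(2) \<tau> unfolding cone_def by auto
      then show ?thesis using \<tau> by (simp add: z_def)
    qed (use C in simp)
  qed
  then have "P \<subseteq> {z. z - v \<in> C}" by (subst hullW) (intro hull_minimal cvxC)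
  then show ?thesis using x by blast
qed

text \<open>The largest divisor of \<open>z\<close> leaves a primitive vector.\<close>
lemma primitive_multiple:
  assumes "z \<in> int_lattice" "z \<noteq> 0"
  obtains k u where "1 \<le> (k::nat)" "primitive u" "z = real k *\<^sub>R u"
proof -
  obtain i where i: "z $ i \<noteq> 0" using assms(2) by (auto simp: vec_eq_iff)
  define K where "K = {k::nat. 1 \<le> k \<and> (\<exists>u\<in>int_lattice. z = real k *\<^sub>R u)}"
  have "k \<le> nat \<lfloor>\<bar>z $ i\<bar>\<rfloor>" if "k \<in> K" for k
  proof -
    obtain u where u: "u \<in> int_lattice" "z = real k *\<^sub>R u" using \<open>k \<in> K\<close> by (auto simp: K_def)
    then have "u $ i \<in> \<int>" "u $ i \<noteq> 0" using i by (auto simp: int_lattice_def)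
    then have "1 \<le> \<bar>u $ i\<bar>" using Ints_nonzero_abs_ge1 by blast
    then have "real k * 1 \<le> real k * \<bar>u $ i\<bar>" by (intro mult_left_mono) auto
    then have "real k \<le> \<bar>z $ i\<bar>" using u(2) by (simp add: abs_mult)
    then show ?thesis by (simp add: le_nat_floor)
  qed
  then have fin: "finite K" by (metis finite_nat_set_iff_bounded_le)
  have "1 \<in> K" using assms by (auto simp: K_def)
  define k where "k = Max K"
  have "k \<in> K" unfolding k_def using fin \<open>1 \<in> K\<close> by (intro Max_in) auto
  then obtain u where u: "u \<in> int_lattice" "z = real k *\<^sub>R u" and k: "1 \<le> k" by (auto simp: K_def)
  have "primitive u" unfolding primitive_def
  proof (intro conjI allI impI u)
    fix j :: nat and w assume w: "w \<in> int_lattice \<and> u = real j *\<^sub>R w"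
    then have z: "z = real (k * j) *\<^sub>R w" using u by simp
    have "j \<noteq> 0" using z assms by (intro notI) simp
    then have "k * j \<noteq> 0" using k by simp
    then have "1 \<le> k * j" by linarith
    then have "k * j \<in> K" unfolding K_def using z w by blast
    then have "k * j \<le> k" unfolding k_def using fin by (intro Max_ge)
    then show "j = 1" using k \<open>j \<noteq> 0\<close> by (cases j) auto
  qed
  with k u show ?thesis using that by blast
qed

text \<open>What smoothness means at the vertex \<open>v\<close>: the polytope lies in the cone spanned
by a lattice basis and contains the first lattice point on each of the three rays.\<close>
definition corner ::
  "(real^3) set \<Rightarrow> real^3 \<Rightarrow> real^3 \<Rightarrow> real^3 \<Rightarrow> real^3 \<Rightarrow> (real^3 \<Rightarrow> real) \<Rightarrow> (real^3 \<Rightarrow> real) \<Rightarrow> (real^3 \<Rightarrow> real) \<Rightarrow> bool" where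
  "corner P v a b c f g h \<longleftrightarrow> lattice_frame a b c f g h \<and> v \<in> P \<and> v + a \<in> P \<and> v + b \<in> P \<and> v + c \<in> P \<and>
     (\<forall>x\<in>P. 0 \<le> f (x - v) \<and> 0 \<le> g (x - v) \<and> 0 \<le> h (x - v))"

text \<open>An edge at \<open>v\<close> runs to a second lattice vertex \<open>w\<close>, so that the
primitive vector along \<open>w - v\<close> is its direction, and the edge does not continue beyond
\<open>v\<close>.\<close>
lemma edge_direction:
  assumes V: "finite V" "V \<subseteq> int_lattice" "P = convex hull V" and v: "v extreme_point_of P"
    and e: "e edge_of P" "v \<in> e"
  obtains u k where "u \<in> primitive_edge_directions P v" "1 \<le> (k::nat)" "v + real k *\<^sub>R u \<in> e" 
    "\<And>z. z \<in> e \<Longrightarrow> \<exists>r\<ge>0. z - v = r *\<^sub>R u"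
proof -
  have P: "polytope P" using V by (auto simp: polytope_def)
  have face: "e face_of P" and dim: "aff_dim e = 1" using e by (auto simp: edge_of_def)
  have "compact e" "convex e" using face P face_of_imp_compact face_of_imp_convex polytope_imp_compact polytope_imp_convex by blast+
  then have eh: "e = convex hull {w. w extreme_point_of e}" by (rule Krein_Milman_Minkowski)
  have "\<not> {w. w extreme_point_of e} \<subseteq> {v}"
  proof
    assume "{w. w extreme_point_of e} \<subseteq> {v}"
    then have "e \<subseteq> {v}" by (subst eh) (intro hull_minimal; simp)
    then show False using dim aff_dim_subset[of e "{v}"] by simp
  qed
  then obtain w where w: "w extreme_point_of e" "w \<noteq> v" by blast
  have we: "w \<in> e" using w by (simp add: extreme_point_of_def)
  have "w extreme_point_of P" using w face extreme_point_of_face by blast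
  then have "w \<in> int_lattice" "v \<in> int_lattice" using v V extreme_point_of_convex_hull by blast+
  then have "w - v \<in> int_lattice" "w - v \<noteq> 0" using w int_lattice_closed by auto
  then obtain k u where ku: "1 \<le> (k::nat)" "primitive u" "w - v = real k *\<^sub>R u" using primitive_multiple by blast
  have vku: "v + real k *\<^sub>R u = w" using ku(3) by (metis add.commute diff_add_cancel)
  have ve: "v extreme_point_of e" using v e face extreme_point_of_face by blast
  have hull: "affine hull e = affine hull {v, w}"
  proof (rule affine_dim_equal[symmetric, OF affine_affine_hull affine_affine_hull])
    show "affine hull {v, w} \<noteq> {}" by simp
    show "affine hull {v, w} \<subseteq> affine hull e" using e we by (intro hull_mono) auto
    show "aff_dim (affine hull {v, w}) = aff_dim (affine hull e)" using w dim by simp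
  qed
  show ?thesis
  proof (rule that)
    have "0 < real k" using ku(1) by linarith
    moreover have "v + real k *\<^sub>R u \<in> e" unfolding vku by (rule we)
    ultimately have ex: "\<exists>t>0. v + t *\<^sub>R u \<in> e" by blast
    show "u \<in> primitive_edge_directions P v" unfolding primitive_edge_directions_def mem_Collect_eq
      by (rule conjI[OF ku(2)], rule exI[of _ e], intro conjI e ex)
    show "1 \<le> k" by fact
    show "v + real k *\<^sub>R u \<in> e" unfolding vku by (rule we)
    fix z assume z: "z \<in> e"
    then have "z \<in> affine hull {v, w}" unfolding hull[symmetric] by (rule hull_inc)
    then obtain r where r: "z = v + r *\<^sub>R (w - v)" unfolding affine_hull_2_alt by auto
    have "0 \<le> r"
    proof (rule ccontr)
      assume "\<not> 0 \<le> r"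
      then have r0: "r < 0" by simp
      have "v \<in> open_segment z w"
        unfolding in_segment
      proof (intro conjI exI[of _ "- r / (1 - r)"])
        show "z \<noteq> w"
        proof
          assume "z = w"
          then have "(1 - r) *\<^sub>R (w - v) = 0" using r by (auto simp: algebra_simps)
          then show False using r0 w by auto
        qed
        show "0 < - r / (1 - r)" "- r / (1 - r) < 1" using r0 by (auto simp: field_simps)
        have "(1 - r) *\<^sub>R v = (1 - r) *\<^sub>R ((1 - - r / (1 - r)) *\<^sub>R z + (- r / (1 - r)) *\<^sub>R w)"
        proof -
          have "(1 - r) * (1 - - r / (1 - r)) = 1" "(1 - r) * (- r / (1 - r)) = - r" using r0 by (auto simp: field_simps)
          then show ?thesis unfolding scaleR_add_right scaleR_scaleR by (simp add: r algebra_simps)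
        qed
        then show "v = (1 - - r / (1 - r)) *\<^sub>R z + (- r / (1 - r)) *\<^sub>R w" using r0 by simp
      qed
      then show False using ve z we unfolding extreme_point_of_def by blast
    qed
    then show "\<exists>r\<ge>0. z - v = r *\<^sub>R u" using r ku(3) by (intro exI[of _ "r * real k"]) simp
  qed
qed

lemma smooth_corner:
  assumes "smooth_polytope P" "v extreme_point_of P"
  obtains a b c f g h where "corner P v a b c f g h"
proof -
  obtain V where V: "finite V" "V \<subseteq> int_lattice" "P = convex hull V"
    using assms(1) unfolding smooth_polytope_def lattice_polytope_def by blast
  have P: "polytope P" using V by (auto simp: polytope_def)
  let ?D = "primitive_edge_directions P v"
  have basis: "lattice_basis ?D" using assms unfolding smooth_polytope_def by blast
  obtain a b c where D: "?D = {a, b, c}" using lattice_basis_card[OF basis] by (auto simp: card_3_iff)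
  obtain f g h where fr: "lattice_frame a b c f g h" using lattice_basis_frame basis unfolding D by blast
  note F = lattice_frameD[OF fr]
  have vP: "v \<in> P" using assms(2) by (simp add: extreme_point_of_def)
  have same: "u = u'" if "u \<in> ?D" "u' \<in> ?D" "t *\<^sub>R u = r *\<^sub>R u'" "t \<noteq> 0" for u u' t r
  proof (rule ccontr)
    assume "u \<noteq> u'"
    have "f (t *\<^sub>R u) = f (r *\<^sub>R u')" "g (t *\<^sub>R u) = g (r *\<^sub>R u')" "h (t *\<^sub>R u) = h (r *\<^sub>R u')" using that(3) by simp_all
    then have "t * f u = r * f u'" "t * g u = r * g u'" "t * h u = r * h u'"
      using F(1-3) by (simp_all add: linear_scale)
    then show False using that(1,2,4) \<open>u \<noteq> u'\<close> F(7-15) unfolding D by auto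
  qed
  have step: "v + u \<in> P" if u: "u \<in> ?D" for u
  proof -
    obtain e t where e: "e edge_of P" "v \<in> e" and t: "t > 0" "v + t *\<^sub>R u \<in> e"
      using u unfolding primitive_edge_directions_def by blast
    obtain u' k where u': "u' \<in> ?D" "1 \<le> (k::nat)" "v + real k *\<^sub>R u' \<in> e" "\<And>z. z \<in> e \<Longrightarrow> \<exists>r\<ge>0. z - v = r *\<^sub>R u'"
      using edge_direction[OF V assms(2) e] by metis
    obtain r where "t *\<^sub>R u = r *\<^sub>R u'" using u'(4)[OF t(2)] by auto
    then have uu: "u = u'" using same u u'(1) t(1) by blast
    have "v + real k *\<^sub>R u \<in> P" using u'(3) uu e(1) by (auto simp: edge_of_def face_of_def)
    then have "v + (1 / real k) *\<^sub>R (real k *\<^sub>R u) \<in> P"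
      by (rule convex_step[OF polytope_imp_convex[OF P] vP]) (use u'(2) in simp)
    then show ?thesis using u'(2) by simp
  qed
  let ?C = "{x. 0 \<le> f x \<and> 0 \<le> g x \<and> 0 \<le> h x}"
  have cone: "x - v \<in> ?C" if "x \<in> P" for x
  proof (rule vertex_cone_of_edges[OF P assms(2) _ _ _ _ that])
    show "convex ?C" unfolding convex_alt using F(1-3) by (auto simp: linear_add linear_scale)
    show "cone ?C" unfolding cone_def using F(1-3) by (auto simp: linear_scale)
    show "0 \<in> ?C" using F(1-3) by (simp add: linear_0)
    fix e z assume e: "e edge_of P" "v \<in> e" "z \<in> e"
    obtain u where u: "u \<in> ?D" "\<exists>r\<ge>0. z - v = r *\<^sub>R u"
      using edge_direction[OF V assms(2) e(1,2)] e(3) by metis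
    then show "z - v \<in> ?C" using F(1-3,7-15) unfolding D by (auto simp: linear_scale)
  qed
  have "corner P v a b c f g h" unfolding corner_def using fr vP step cone unfolding D by auto
  then show ?thesis by (rule that)
qed

section \<open>Leaving a polytope along a segment\<close>

lemma exposing_vertex:
  fixes S :: "'a::euclidean_space set"
  assumes S: "compact S" "convex S" "S \<noteq> {}" and z: "z \<notin> S"
  obtains l w where "w extreme_point_of S" "\<And>x. x \<in> S \<Longrightarrow> l \<bullet> w \<le> l \<bullet> x" "l \<bullet> z < l \<bullet> w"
proof -
  obtain l b where l: "l \<bullet> z < b" "\<And>x. x \<in> S \<Longrightarrow> b < l \<bullet> x"
    using separating_hyperplane_closed_point[OF S(2) compact_imp_closed[OF S(1)] z] by blast
  have "continuous_on S (\<lambda>x. l \<bullet> x)" by (intro continuous_intros)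
  then obtain w0 where w0: "w0 \<in> S" "\<And>x. x \<in> S \<Longrightarrow> l \<bullet> w0 \<le> l \<bullet> x"
    using continuous_attains_inf[OF S(1,3)] by blast
  define T where "T = S \<inter> {x. l \<bullet> x = l \<bullet> w0}"
  have T: "T face_of S" unfolding T_def using S(2) w0(2) by (intro face_of_Int_supporting_hyperplane_ge) auto
  have "compact T" "convex T" using face_of_imp_compact[OF S(2,1) T] face_of_imp_convex[OF T] .
  moreover have "T \<noteq> {}" using w0 by (auto simp: T_def)
  ultimately obtain w where w: "w extreme_point_of T" using extreme_point_exists_convex by blast
  have "w \<in> T" using w by (simp add: extreme_point_of_def)
  then have "l \<bullet> w = l \<bullet> w0" "w \<in> S" by (auto simp: T_def)
  moreover have "w extreme_point_of S" using w T extreme_point_of_face by blast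
  ultimately show ?thesis using that[of w l] w0 l by force
qed

text \<open>The exit parameter is the smallest among the zeros of those functions that are negative at
\<open>z1\<close>.\<close>
lemma exit_point:
  fixes z0 z1 :: "'a::real_vector" and G :: "('a \<Rightarrow> real) set"
  assumes fin: "finite G" 
    and aff: "\<And>g s. g \<in> G \<Longrightarrow> g (z0 + s *\<^sub>R (z1 - z0)) = g z0 + s * (g z1 - g z0)"
    and z0: "\<And>g. g \<in> G \<Longrightarrow> 0 \<le> g z0" and z1: "\<exists>g\<in>G. g z1 < (0::real)"
  obtains s g where "0 \<le> s" "s < 1" "g \<in> G" "g (z0 + s *\<^sub>R (z1 - z0)) = 0" "g z1 < 0"
    "\<And>g'. g' \<in> G \<Longrightarrow> 0 \<le> g' (z0 + s *\<^sub>R (z1 - z0))"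
proof -
  define H where "H = {g\<in>G. g z1 < 0}"
  define \<rho> where "\<rho> = (\<lambda>g::'a \<Rightarrow> real. g z0 / (g z0 - g z1))"
  have H: "finite H" "H \<noteq> {}" using fin z1 by (auto simp: H_def)
  define g where "g = arg_min_on \<rho> H"
  have g: "g \<in> H" "\<And>g'. g' \<in> H \<Longrightarrow> \<rho> g \<le> \<rho> g'"
    unfolding g_def using arg_min_if_finite(1)[OF H] arg_min_least[OF H] by auto
  have gG: "g \<in> G" "g z1 < 0" using g(1) by (auto simp: H_def)
  have s: "0 \<le> \<rho> g" "\<rho> g < 1" "g z0 + \<rho> g * (g z1 - g z0) = 0"
    using gG z0[OF gG(1)] by (auto simp: \<rho>_def field_simps)
  have nonneg: "0 \<le> g' (z0 + \<rho> g *\<^sub>R (z1 - z0))" if g': "g' \<in> G" for g'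
  proof (cases "g' z1 < 0")
    case True
    have "\<rho> g * (g' z0 - g' z1) \<le> \<rho> g' * (g' z0 - g' z1)"
      using g(2)[of g'] g' True z0[OF g'] by (intro mult_right_mono) (auto simp: H_def)
    also have "\<dots> = g' z0" using True z0[OF g'] by (simp add: \<rho>_def)
    finally show ?thesis unfolding aff[OF g'] by (simp add: algebra_simps)
  next
    case False
    have "0 \<le> (1 - \<rho> g) * g' z0 + \<rho> g * g' z1" using False z0[OF g'] s by simp
    then show ?thesis unfolding aff[OF g'] by (simp add: algebra_simps)
  qed
  show ?thesis by (rule that[of "\<rho> g" g]) (use s gG nonneg aff[OF gG(1)] in auto)
qed

lemma affine_on_line:
  fixes k :: "'a::real_vector \<Rightarrow> real"
  assumes "linear k"
  shows "k (x + s *\<^sub>R (y - x) - w) = k (x - w) + s * (k (y - w) - k (x - w))"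
proof -
  have eq: "x + s *\<^sub>R (y - x) - w = (x - w) + s *\<^sub>R ((y - w) - (x - w))" by simp
  show ?thesis unfolding eq using assms by (simp only: linear_add linear_scale linear_diff real_scaleR_def)
qed

text \<open>Let every vertex \<open>w\<close> carry finitely many functionals \<open>k\<close>,
nonnegative on \<open>S - w\<close>, with dual vectors \<open>u\<close> pointing into \<open>S\<close>.
Then \<open>S\<close> is cut out by these functionals: a functional \<open>l\<close> separating a point
from \<open>S\<close> attains its minimum over \<open>S\<close> at a vertex \<open>w\<close>, hence is
nonnegative on every \<open>u\<close> at \<open>w\<close>, so some \<open>k\<close> at \<open>w\<close>
must be negative on the point as seen from \<open>w\<close>. A segment leaving \<open>S\<close>
therefore leaves it through the zero set of one of them. This serves polytopes as well as their
facets.\<close>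
lemma exit_through_facet:
  fixes S :: "'a::euclidean_space set" and C :: "'a \<Rightarrow> (('a \<Rightarrow> real) \<times> 'a) set"
  assumes S: "compact S" "convex S" "finite {w. w extreme_point_of S}"
    and C: "\<And>w. w extreme_point_of S \<Longrightarrow> finite (C w)"
    and dir: "\<And>w k u. w extreme_point_of S \<Longrightarrow> (k, u) \<in> C w \<Longrightarrow> linear k \<and> w + u \<in> S \<and> (\<forall>x\<in>S. 0 \<le> k (x - w))"
    and span: "\<And>w s. w extreme_point_of S \<Longrightarrow>
       z0 + s *\<^sub>R (z1 - z0) - w = (\<Sum>(k, u)\<in>C w. k (z0 + s *\<^sub>R (z1 - z0) - w) *\<^sub>R u)"
    and z: "z0 \<in> S" "z1 \<notin> S"
  obtains s w k u where "0 \<le> s" "s < 1" "w extreme_point_of S" "(k, u) \<in> C w" "k (z0 + s *\<^sub>R (z1 - z0) - w) = 0"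
    "k (z1 - w) < 0" "z0 + s *\<^sub>R (z1 - z0) \<in> S"
proof -
  define G where "G = (\<Union>w\<in>{w. w extreme_point_of S}. (\<lambda>(k, u) x. k (x - w)) ` C w)"
  have G: "\<exists>w k u. w extreme_point_of S \<and> (k, u) \<in> C w \<and> g = (\<lambda>x. k (x - w))" if "g \<in> G" for g
    using that unfolding G_def by fastforce
  have GI: "(\<lambda>x. k (x - w)) \<in> G" if "w extreme_point_of S" "(k, u) \<in> C w" for w k u
    unfolding G_def using that by (intro UN_I[of w] image_eqI[of _ _ "(k, u)"]) auto
  have memb: "z0 + s *\<^sub>R (z1 - z0) \<in> S" if nonneg: "\<And>g. g \<in> G \<Longrightarrow> 0 \<le> g (z0 + s *\<^sub>R (z1 - z0))" for s
  proof (rule ccontr)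
    let ?z = "z0 + s *\<^sub>R (z1 - z0)"
    assume "?z \<notin> S"
    then obtain l w where w: "w extreme_point_of S" "\<And>x. x \<in> S \<Longrightarrow> l \<bullet> w \<le> l \<bullet> x" "l \<bullet> ?z < l \<bullet> w"
      using exposing_vertex[OF S(1,2)] z(1) by (metis empty_iff)
    have "0 \<le> k (?z - w) * (l \<bullet> u)" if "(k, u) \<in> C w" for k u
    proof -
      have "0 \<le> l \<bullet> u" using w(2)[of "w + u"] dir[OF w(1) that] by (simp add: inner_add_right)
      then show ?thesis using nonneg[OF GI[OF w(1) that]] by simp
    qed
    then have "0 \<le> (\<Sum>(k, u)\<in>C w. k (?z - w) * (l \<bullet> u))" by (intro sum_nonneg) auto
    also have "\<dots> = l \<bullet> (\<Sum>(k, u)\<in>C w. k (?z - w) *\<^sub>R u)"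
      unfolding inner_sum_right by (rule sum.cong) auto
    also have "\<dots> = l \<bullet> (?z - w)" using span[OF w(1), of s] by simp
    also have "\<dots> < 0" using w(3) by (simp add: inner_diff_right)
    finally show False by simp
  qed
  have "finite G" unfolding G_def using S(3) C by auto
  moreover have "g (z0 + s *\<^sub>R (z1 - z0)) = g z0 + s * (g z1 - g z0)" if "g \<in> G" for g s
    using G[OF that] dir affine_on_line by (metis (no_types, lifting))
  moreover have "0 \<le> g z0" if "g \<in> G" for g using G[OF that] dir z(1) by auto
  moreover have "\<exists>g\<in>G. g z1 < 0"
  proof (rule ccontr)
    assume "\<not> ?thesis"
    then have "z0 + 1 *\<^sub>R (z1 - z0) \<in> S" by (intro memb) (auto simp: not_less)
    with z(2) show False by simp
  qed
  ultimately obtain s g where sg: "0 \<le> s" "s < 1" "g \<in> G" "g (z0 + s *\<^sub>R (z1 - z0)) = 0" "g z1 < 0"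
    "\<And>g'. g' \<in> G \<Longrightarrow> 0 \<le> g' (z0 + s *\<^sub>R (z1 - z0))"
    using exit_point[of G z0 z1] by metis
  obtain w k u where w: "w extreme_point_of S" "(k, u) \<in> C w" and g: "g = (\<lambda>x. k (x - w))" using G[OF sg(3)] by blast
  show ?thesis by (rule that[OF sg(1,2) w _ _ memb]) (use sg(4,5,6) g in auto)
qed

section \<open>Smooth lattice polygons: the first two rows\<close>

text \<open>The coordinates \<open>g\<close>, \<open>h\<close> are functions on all of space and
determine points only in a plane parallel to the kernel of \<open>f\<close>. In this way polygons in
different planes of space can be treated without introducing a second dimension.\<close>
definition planar_frame :: "(real^3 \<Rightarrow> real) \<Rightarrow> real^3 \<Rightarrow> real^3 \<Rightarrow> (real^3 \<Rightarrow> real) \<Rightarrow> (real^3 \<Rightarrow> real) \<Rightarrow> bool" where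
  "planar_frame f a b g h \<longleftrightarrow> linear g \<and> linear h \<and> a \<in> int_lattice \<and> b \<in> int_lattice \<and> f a = 0 \<and> f b = 0 \<and>
    g a = 1 \<and> g b = 0 \<and> h a = 0 \<and> h b = 1 \<and> (\<forall>x\<in>int_lattice. g x \<in> \<int> \<and> h x \<in> \<int>) \<and>
    (\<forall>x. f x = 0 \<longrightarrow> g x *\<^sub>R a + h x *\<^sub>R b = x)"

lemma planar_frameD:
  assumes "planar_frame f a b g h"
  shows "linear g" "linear h" "a \<in> int_lattice" "b \<in> int_lattice" "f a = 0" "f b = 0" "g a = 1" "g b = 0" "h a = 0" "h b = 1"
   "\<And>x. x \<in> int_lattice \<Longrightarrow> g x \<in> \<int>" "\<And>x. x \<in> int_lattice \<Longrightarrow> h x \<in> \<int>" "\<And>x. f x = 0 \<Longrightarrow> g x *\<^sub>R a + h x *\<^sub>R b = x"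
  using assms unfolding planar_frame_def by blast+

lemma planar_frame_swap: assumes "planar_frame f a b g h" shows "planar_frame f b a h g"
proof -
  have "h x *\<^sub>R b + g x *\<^sub>R a = x" if "f x = 0" for x
    using planar_frameD(13)[OF assms that] by (simp only: add.commute)
  then show ?thesis using planar_frameD[OF assms] unfolding planar_frame_def by blast
qed

definition planar_corner where
  "planar_corner f F v a b g h \<longleftrightarrow> planar_frame f a b g h \<and> v \<in> F \<and> v + a \<in> F \<and> v + b \<in> F \<and>
     (\<forall>x\<in>F. 0 \<le> g (x - v) \<and> 0 \<le> h (x - v))"

lemma planar_corner_swap: "planar_corner f F v a b g h \<Longrightarrow> planar_corner f F v b a h g"
  using planar_frame_swap unfolding planar_corner_def by blast

lemma Ints_mult_eq_1: 
  assumes "x \<in> \<int>" "y \<in> \<int>" "x * y = (1::real)" shows "x = 1 \<and> y = 1 \<or> x = -1 \<and> y = -1"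
proof -
  obtain i j :: int where ij: "x = of_int i" "y = of_int j" using assms by (auto elim!: Ints_cases)
  then have "i * j = 1" using assms(3) by (metis of_int_1 of_int_eq_iff of_int_mult)
  then show ?thesis using zmult_eq_1_iff[of i j] ij by auto
qed

locale smooth_polygon =
  fixes f :: "real^3 \<Rightarrow> real" and F :: "(real^3) set"
  assumes lin: "linear f" and cpt: "compact F" and cvx: "convex F"
    and flat: "x \<in> F \<Longrightarrow> y \<in> F \<Longrightarrow> f (x - y) = 0"
    and fin: "finite {w. w extreme_point_of F}"
    and lattice: "w extreme_point_of F \<Longrightarrow> w \<in> int_lattice"
    and corner: "w extreme_point_of F \<Longrightarrow> \<exists>a b g h. planar_corner f F w a b g h"
begin

lemma coordinates:
  assumes "planar_frame f a b g h" "x \<in> F" "y \<in> F"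
  shows "x = y + g (x - y) *\<^sub>R a + h (x - y) *\<^sub>R b"
proof -
  have "g (x - y) *\<^sub>R a + h (x - y) *\<^sub>R b = x - y" using planar_frameD(13)[OF assms(1) flat[OF assms(2,3)]] .
  then show ?thesis by (metis add.assoc add.commute diff_add_cancel)
qed

lemma extreme_if_unique:
  assumes "e \<in> F" "\<And>p q s. p \<in> F \<Longrightarrow> q \<in> F \<Longrightarrow> 0 < s \<Longrightarrow> s < 1 \<Longrightarrow> e = (1 - s) *\<^sub>R p + s *\<^sub>R q \<Longrightarrow> p = q"
  shows "e extreme_point_of F"
  unfolding extreme_point_of_def in_segment using assms by blast

text \<open>The polygon meets the line through the edge at \<open>v\<close> in direction
\<open>a\<close> in a segment, whose other end is extreme in the polygon and therefore a lattice
point.\<close>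
lemma row_end:
  assumes v: "v extreme_point_of F" and c: "planar_corner f F v a b g h"
  obtains e l where "e extreme_point_of F" "e = v + l *\<^sub>R a" "1 \<le> l" "l \<in> \<int>" 
    "\<And>x. x \<in> F \<Longrightarrow> h (x - v) = 0 \<Longrightarrow> g (x - v) \<le> l"
proof -
  have fr: "planar_frame f a b g h" and vF: "v \<in> F" "v + a \<in> F" 
    and pos: "\<And>x. x \<in> F \<Longrightarrow> 0 \<le> g (x - v)" "\<And>x. x \<in> F \<Longrightarrow> 0 \<le> h (x - v)"
    using c unfolding planar_corner_def by auto
  note D = planar_frameD[OF fr]
  define E where "E = F \<inter> {x. h (x - v) = 0}"
  have cont: "continuous_on UNIV (\<lambda>x. k (x - v))" if "linear k" for k :: "real^3 \<Rightarrow> real"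
    using linear_continuous_on_compose[OF _ that, of UNIV "\<lambda>x. x - v"] by (simp add: continuous_intros)
  have "closed {x. h (x - v) = 0}"
    using continuous_closed_preimage[OF cont[OF D(2)] closed_UNIV closed_singleton[of 0]] by (simp add: vimage_def)
  then have "compact E" unfolding E_def using cpt by (rule compact_Int_closed[rotated])
  moreover have "v + a \<in> E" using vF D by (simp add: E_def)
  moreover have "continuous_on E (\<lambda>x. g (x - v))" using cont[OF D(1)] continuous_on_subset by blast
  ultimately obtain e where e: "e \<in> E" "\<And>x. x \<in> E \<Longrightarrow> g (x - v) \<le> g (e - v)"
    using continuous_attains_sup[of E "\<lambda>x. g (x - v)"] by blast
  have eF: "e \<in> F" and he: "h (e - v) = 0" using e(1) by (auto simp: E_def)
  define l where "l = g (e - v)"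
  have "g (v + a - v) \<le> g (e - v)" using e(2)[OF \<open>v + a \<in> E\<close>] .
  then have l1: "1 \<le> l" by (simp add: l_def D)
  have ee: "e = v + l *\<^sub>R a" using coordinates[OF fr eF vF(1)] by (simp add: l_def he)
  have ext: "e extreme_point_of F"
  proof (rule extreme_if_unique[OF eF])
    fix p q and s :: real assume pq: "p \<in> F" "q \<in> F" and s: "0 < s" "s < 1" and eq: "e = (1 - s) *\<^sub>R p + s *\<^sub>R q"
    have "e - v = (1 - s) *\<^sub>R (p - v) + s *\<^sub>R (q - v)" unfolding eq by (simp add: algebra_simps)
    then have k: "k (e - v) = (1 - s) * k (p - v) + s * k (q - v)" if "linear k" for k :: "real^3 \<Rightarrow> real"
      using that by (simp add: linear_add linear_scale)
    have "0 \<le> (1 - s) * h (p - v)" "0 \<le> s * h (q - v)" using s pos(2) pq by auto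
    then have "(1 - s) * h (p - v) = 0" "s * h (q - v) = 0" using k[OF D(2)] he by linarith+
    then have hp: "h (p - v) = 0" "h (q - v) = 0" using s by auto
    then have le: "g (p - v) \<le> l" "g (q - v) \<le> l" using e(2) pq by (auto simp: E_def l_def)
    then have "(1 - s) * g (p - v) \<le> (1 - s) * l" "s * g (q - v) \<le> s * l" using s by auto
    moreover have "l = (1 - s) * g (p - v) + s * g (q - v)" using k[OF D(1)] by (simp add: l_def)
    moreover have "(1 - s) * l + s * l = l" by (simp add: algebra_simps)
    ultimately have "(1 - s) * g (p - v) = (1 - s) * l" "s * g (q - v) = s * l" by linarith+
    then have "g (p - v) = l" "g (q - v) = l" using s by auto
    then show "p = q" using coordinates[OF fr pq(1) vF(1)] coordinates[OF fr pq(2) vF(1)] hp by simp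
  qed
  have "e - v \<in> int_lattice" using lattice[OF ext] lattice[OF v] int_lattice_closed by blast
  then have lI: "l \<in> \<int>" unfolding l_def by (rule D(11))
  show ?thesis
  proof (rule that[OF ext ee l1 lI])
    fix x assume "x \<in> F" "h (x - v) = 0"
    then show "g (x - v) \<le> l" using e(2) by (auto simp: E_def l_def)
  qed
qed

text \<open>At the far end \<open>e\<close> of the first row one of the two basis vectors of the corner
must be \<open>-a\<close>, since the polygon lies on one side of the row. The other one then has height
1 over the row, and the functional dual to \<open>-a\<close> bounds the polygon at its far side.\<close>
lemma second_row:
  assumes v: "v extreme_point_of F" and c: "planar_corner f F v a b g h"
    and e: "e extreme_point_of F" "e = v + l *\<^sub>R a" "1 \<le> l"
  obtains k where "k \<in> \<int>" "e + (b + k *\<^sub>R a) \<in> F" "\<And>x. x \<in> F \<Longrightarrow> g (x - v) \<le> l + h (x - v) * k"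
proof -
  have fr: "planar_frame f a b g h" and vF: "v \<in> F" "v + a \<in> F" "v + b \<in> F"
    and pos: "\<And>x. x \<in> F \<Longrightarrow> 0 \<le> g (x - v)" "\<And>x. x \<in> F \<Longrightarrow> 0 \<le> h (x - v)"
    using c unfolding planar_corner_def by auto
  note D = planar_frameD[OF fr]
  note result = that
  have main: thesis if c': "planar_corner f F e a' b' g' h'" and hb: "h b' \<noteq> 0" for a' b' g' h'
  proof -
    have fr': "planar_frame f a' b' g' h'" and eF: "e \<in> F" "e + a' \<in> F" "e + b' \<in> F"
      and pos': "\<And>x. x \<in> F \<Longrightarrow> 0 \<le> g' (x - e)" "\<And>x. x \<in> F \<Longrightarrow> 0 \<le> h' (x - e)"
      using c' unfolding planar_corner_def by auto
    note D' = planar_frameD[OF fr']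
    have ev: "e - v = l *\<^sub>R a" "v - e = (- l) *\<^sub>R a" using e(2) by simp_all
    have hge: "0 \<le> h a'" "0 \<le> h b'"
    proof -
      have eq: "e + a' - v = l *\<^sub>R a + a'" "e + b' - v = l *\<^sub>R a + b'" using e(2) by simp_all
      have "0 \<le> h (l *\<^sub>R a + a')" "0 \<le> h (l *\<^sub>R a + b')"
        using pos(2)[OF eF(2)] pos(2)[OF eF(3)] by (simp_all only: eq)
      then show "0 \<le> h a'" "0 \<le> h b'" using D(2) D(9) by (simp_all add: linear_add linear_scale)
    qed
    \<comment> \<open>The corner \<open>v\<close> as seen from \<open>e\<close>: the combination with
    nonnegative coefficients stays in the row, so its part of positive height vanishes.\<close>
    define \<kappa> \<mu> where "\<kappa> = g' (v - e)" and "\<mu> = h' (v - e)"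
    have km: "0 \<le> \<kappa>" "0 \<le> \<mu>" using pos' vF by (auto simp: \<kappa>_def \<mu>_def)
    have rel: "\<kappa> *\<^sub>R a' + \<mu> *\<^sub>R b' = (- l) *\<^sub>R a"
      using D'(13)[OF flat[OF vF(1) eF(1)]] unfolding \<kappa>_def \<mu>_def ev(2) .
    have "h (\<kappa> *\<^sub>R a' + \<mu> *\<^sub>R b') = 0" unfolding rel using D(2,9) by (simp add: linear_scale linear_neg)
    then have "\<kappa> * h a' + \<mu> * h b' = 0" using D(2) by (simp add: linear_add linear_scale)
    moreover have "0 \<le> \<kappa> * h a'" "0 \<le> \<mu> * h b'" using km hge by auto
    ultimately have "\<kappa> * h a' = 0" "\<mu> * h b' = 0" by linarith+
    then have mu0: "\<mu> = 0" using hb by simp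
    then have rel': "\<kappa> *\<^sub>R a' = (- l) *\<^sub>R a" using rel by simp
    have ga: "\<kappa> * g a' = - l" using arg_cong[OF rel', of g] D(1,7) by (simp add: linear_scale linear_neg)
    then have "\<kappa> * g a' < 0" using e(3) by simp
    then have kp: "0 < \<kappa>" "g a' < 0" using km by (auto simp: mult_less_0_iff)
    then have ha': "h a' = 0" using \<open>\<kappa> * h a' = 0\<close> by simp
    have h'a: "h' a = 0"
    proof -
      have "h' (\<kappa> *\<^sub>R a') = h' ((- l) *\<^sub>R a)" using rel' by simp
      then have "0 = - l * h' a" using D'(2,9) by (simp add: linear_scale linear_neg)
      then show ?thesis using e(3) by simp
    qed
    have "g' a *\<^sub>R a' + h' a *\<^sub>R b' = a" using D'(13)[OF D(5)] .
    then have "g (g' a *\<^sub>R a') = 1" using h'a D(7) by simp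
    then have "g' a * g a' = 1" using D(1) by (simp add: linear_scale)
    moreover have "g' a \<in> \<int>" "g a' \<in> \<int>" using D'(11)[OF D(3)] D(11)[OF D'(3)] .
    ultimately have ga1: "g a' = - 1" using Ints_mult_eq_1 kp(2) by fastforce
    have "g' b *\<^sub>R a' + h' b *\<^sub>R b' = b" using D'(13)[OF D(6)] .
    then have "h (g' b *\<^sub>R a' + h' b *\<^sub>R b') = 1" using D(10) by simp
    then have "h' b * h b' = 1" using D(2) ha' by (simp add: linear_add linear_scale)
    moreover have "h' b \<in> \<int>" "h b' \<in> \<int>" using D'(12)[OF D(4)] D(12)[OF D'(4)] .
    ultimately have hb1: "h b' = 1" using Ints_mult_eq_1 hge(2) by fastforce
    have b': "b' = b + g b' *\<^sub>R a" using D(13)[OF D'(6)] hb1 by (simp add: add.commute)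
    show thesis
    proof (rule result[of "g b'"])
      show "g b' \<in> \<int>" using D(11)[OF D'(4)] .
      show "e + (b + g b' *\<^sub>R a) \<in> F" using eF(3) b' by simp
      fix x assume x: "x \<in> F"
      have xe: "g' (x - e) *\<^sub>R a' + h' (x - e) *\<^sub>R b' = x - e" using D'(13)[OF flat[OF x eF(1)]] .
      have xv: "x - v = (x - e) + l *\<^sub>R a" using e(2) by simp
      have "h (x - e) = h' (x - e)" "g (x - e) = - g' (x - e) + h' (x - e) * g b'"
        by (subst xe[symmetric], use D(1,2) ha' hb1 ga1 in \<open>simp add: linear_add linear_scale\<close>)+
      moreover have "h (x - v) = h (x - e)" "g (x - v) = g (x - e) + l"
        unfolding xv using D by (simp_all add: linear_add linear_scale)
      ultimately show "g (x - v) \<le> l + h (x - v) * g b'" using pos'(1)[OF x] by simp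
    qed
  qed
  obtain a' b' g' h' where c': "planar_corner f F e a' b' g' h'" using corner[OF e(1)] by blast
  have fr': "planar_frame f a' b' g' h'" using c' unfolding planar_corner_def by blast
  have "h a' \<noteq> 0 \<or> h b' \<noteq> 0"
  proof (rule ccontr)
    assume "\<not> ?thesis"
    moreover have "g' b *\<^sub>R a' + h' b *\<^sub>R b' = b" using planar_frameD(13)[OF fr' D(6)] .
    then have "h (g' b *\<^sub>R a' + h' b *\<^sub>R b') = 1" using D(10) by simp
    ultimately show False using D(2) by (simp add: linear_add linear_scale)
  qed
  then show thesis using main[OF c'] main[OF planar_corner_swap[OF c']] by blast
qed

text \<open>The far side runs through \<open>v + l a\<close> and \<open>v + b\<close>, so that the
second row consists of the vertex \<open>v + b\<close> alone and the polygon ends there. The two basis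
vectors at \<open>v + b\<close> lead to points of the first row and differ by \<open>a\<close> up to
sign, as they form a lattice basis. Since \<open>v\<close> lies in their cone, they lead to
\<open>v\<close> and \<open>v + a\<close>; since \<open>v + l a\<close> lies in it as well, \<open>l =
1\<close>.\<close>
lemma triangle_row:
  assumes v: "v extreme_point_of F" and c: "planar_corner f F v a b g h"
    and e: "v + l *\<^sub>R a \<in> F" "1 \<le> l" and le: "\<And>x. x \<in> F \<Longrightarrow> g (x - v) + h (x - v) * l \<le> l"
  shows "F = convex hull {v, v + a, v + b}"
proof -
  have fr: "planar_frame f a b g h" and vF: "v \<in> F" "v + a \<in> F" "v + b \<in> F"
    and pos: "\<And>x. x \<in> F \<Longrightarrow> 0 \<le> g (x - v)" "\<And>x. x \<in> F \<Longrightarrow> 0 \<le> h (x - v)"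
    using c unfolding planar_corner_def by auto
  note D = planar_frameD[OF fr]
  have h1: "h (x - v) \<le> 1" if "x \<in> F" for x
  proof -
    have "h (x - v) * l \<le> 1 * l" using le[OF that] pos(1)[OF that] by simp
    then show ?thesis using e(2) by (subst (asm) mult_le_cancel_right_pos) auto
  qed
  have top: "x = v + b" if "x \<in> F" "h (x - v) = 1" for x
  proof -
    have "g (x - v) = 0" using le[OF that(1)] pos(1)[OF that(1)] that(2) by simp
    then show ?thesis using coordinates[OF fr that(1) vF(1)] that(2) by simp
  qed
  let ?q = "v + b"
  have ext: "?q extreme_point_of F"
  proof (rule extreme_if_unique[OF vF(3)])
    fix x y and s :: real assume xy: "x \<in> F" "y \<in> F" and s: "0 < s" "s < 1" and eq: "?q = (1 - s) *\<^sub>R x + s *\<^sub>R y"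
    have "b = ?q - v" by simp
    also have "\<dots> = (1 - s) *\<^sub>R (x - v) + s *\<^sub>R (y - v)" unfolding eq by (simp add: algebra_simps)
    finally have "h b = (1 - s) * h (x - v) + s * h (y - v)" using D(2) by (simp add: linear_add linear_scale)
    then have 1: "(1 - s) * h (x - v) + s * h (y - v) = 1" using D by simp
    have "0 \<le> (1 - s) * (1 - h (x - v))" "0 \<le> s * (1 - h (y - v))" using s h1 xy by auto
    moreover have "(1 - s) * (1 - h (x - v)) + s * (1 - h (y - v)) = 0" using 1 by (simp add: algebra_simps)
    ultimately have "(1 - s) * (1 - h (x - v)) = 0" "s * (1 - h (y - v)) = 0" by linarith+
    then have "h (x - v) = 1" "h (y - v) = 1" using s by auto
    then show "x = y" using top xy by metis
  qed
  obtain a2 b2 g2 h2 where c2: "planar_corner f F ?q a2 b2 g2 h2" using corner[OF ext] by blast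
  have fr2: "planar_frame f a2 b2 g2 h2" and qF: "?q + a2 \<in> F" "?q + b2 \<in> F"
    and pos2: "\<And>x. x \<in> F \<Longrightarrow> 0 \<le> g2 (x - ?q)" "\<And>x. x \<in> F \<Longrightarrow> 0 \<le> h2 (x - ?q)"
    using c2 unfolding planar_corner_def by auto
  note D2 = planar_frameD[OF fr2]
  have below: "h u = -1 \<and> 0 \<le> g u \<and> g u \<le> l" if "?q + u \<in> F" "u \<in> int_lattice" "u \<noteq> 0" for u
  proof -
    have qu: "?q + u - v = b + u" by simp
    have hu: "h (?q + u - v) = 1 + h u" "g (?q + u - v) = g u" unfolding qu using D by (simp_all add: linear_add)
    have "h u \<noteq> 0" using top[OF that(1)] that(3) hu by auto
    moreover have "-1 \<le> h u" "h u \<le> 0" using h1[OF that(1)] pos(2)[OF that(1)] hu by simp_all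
    moreover have "h u \<in> \<int>" using D(12) that(2) .
    ultimately have "h u = -1" by (auto elim!: Ints_cases)
    then show ?thesis using le[OF that(1)] pos(1)[OF that(1)] hu by simp
  qed
  have "a2 \<noteq> 0" "b2 \<noteq> 0" using D2 linear_0 by (metis zero_neq_one)+
  then have A: "h a2 = -1" "0 \<le> g a2" "g a2 \<le> l" and B: "h b2 = -1" "0 \<le> g b2" "g b2 \<le> l"
    using below[OF qF(1) D2(3)] below[OF qF(2) D2(4)] by auto
  have comb: "h x = - (g2 x + h2 x)" "g x = g2 x * g a2 + h2 x * g b2" if "f x = 0" for x
    by (subst D2(13)[OF that, symmetric], use D(1,2) A B in \<open>simp add: linear_add linear_scale\<close>)+
  have "g2 a + h2 a = 0" "g2 a * g a2 + h2 a * g b2 = 1" using comb[OF D(5)] D by simp_all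
  then have "g2 a * (g a2 - g b2) = 1" by (simp add: algebra_simps add_eq_0_iff)
  moreover have "g2 a \<in> \<int>" "g a2 - g b2 \<in> \<int>" using D2(11)[OF D(3)] D(11)[OF D2(3)] D(11)[OF D2(4)] by auto
  ultimately have diff: "\<bar>g a2 - g b2\<bar> = 1" using Ints_mult_eq_1 by fastforce
  have zero: "g a2 = 0 \<or> g b2 = 0"
  proof -
    have vq: "v - ?q = - b" by simp
    have "0 \<le> g2 (- b)" "0 \<le> h2 (- b)" using pos2[OF vF(1)] unfolding vq by auto
    moreover have "f (- b) = 0" using D lin by (simp add: linear_neg)
    note cb = comb[OF this]
    have "g2 (- b) + h2 (- b) = 1" "g2 (- b) * g a2 + h2 (- b) * g b2 = 0" using cb D by (simp_all add: linear_neg)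
    moreover have "0 \<le> g2 (- b) * g a2" "0 \<le> h2 (- b) * g b2" using calculation A B by auto
    ultimately have "g2 (- b) * g a2 = 0" "h2 (- b) * g b2 = 0" "g2 (- b) \<noteq> 0 \<or> h2 (- b) \<noteq> 0" by linarith+
    then show ?thesis by auto
  qed
  have "l \<le> 1"
  proof -
    have eq: "v + l *\<^sub>R a - ?q = l *\<^sub>R a - b" by simp
    have nn: "0 \<le> g2 (l *\<^sub>R a - b)" "0 \<le> h2 (l *\<^sub>R a - b)" using pos2[OF e(1)] unfolding eq by auto
    have "f (l *\<^sub>R a - b) = 0" using D lin by (simp add: linear_diff linear_scale)
    note cb = comb[OF this]
    have s1: "g2 (l *\<^sub>R a - b) + h2 (l *\<^sub>R a - b) = 1" and sl: "g2 (l *\<^sub>R a - b) * g a2 + h2 (l *\<^sub>R a - b) * g b2 = l"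
      using cb D by (simp_all add: linear_diff linear_scale)
    have "g a2 \<le> 1" "g b2 \<le> 1" using diff zero A B by auto
    then have "g2 (l *\<^sub>R a - b) * g a2 \<le> g2 (l *\<^sub>R a - b) * 1" "h2 (l *\<^sub>R a - b) * g b2 \<le> h2 (l *\<^sub>R a - b) * 1"
      using nn by (auto intro!: mult_left_le)
    then show ?thesis using s1 sl by linarith
  qed
  then have l: "l = 1" using e(2) by simp
  show ?thesis
  proof
    show "convex hull {v, v + a, v + b} \<subseteq> F" using cvx vF by (intro hull_minimal) auto
    show "F \<subseteq> convex hull {v, v + a, v + b}"
    proof
      fix x assume x: "x \<in> F"
      have "x = v + g (x - v) *\<^sub>R a + h (x - v) *\<^sub>R b" by (rule coordinates[OF fr x vF(1)])
      then have "x = (1 - g (x - v) - h (x - v)) *\<^sub>R v + g (x - v) *\<^sub>R (v + a) + h (x - v) *\<^sub>R (v + b)"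
        by (simp add: algebra_simps)
      moreover have "0 \<le> 1 - g (x - v) - h (x - v)" using le[OF x] l by simp
      ultimately show "x \<in> convex hull {v, v + a, v + b}"
        unfolding convex_hull_3 mem_Collect_eq using pos[OF x]
        by (intro exI[of _ "1 - g (x - v) - h (x - v)"] exI[of _ "g (x - v)"] exI[of _ "h (x - v)"]) simp
    qed
  qed
qed

text \<open>The rows of height 0 and 1 are lattice segments, and unless the polygon is a unimodular
triangle neither of them is a single point. So every point of these rows lies between two neighbouring
lattice points of its row.\<close>
lemma rows:
  assumes v: "v extreme_point_of F" and c: "planar_corner f F v a b g h"
    and no: "F \<noteq> convex hull {v, v + a, v + b}"
    and z: "z \<in> F" "h (z - v) = 0 \<or> h (z - v) = 1"
  obtains y where "y \<in> F \<inter> int_lattice" "y + a \<in> F" "h (y - v) = h (z - v)" "g (y - v) \<le> g (z - v)" "g (z - v) \<le> g (y - v) + 1"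
proof -
  have fr: "planar_frame f a b g h" and vF: "v \<in> F" "v + a \<in> F" "v + b \<in> F"
    and pos: "\<And>x. x \<in> F \<Longrightarrow> 0 \<le> g (x - v)" "\<And>x. x \<in> F \<Longrightarrow> 0 \<le> h (x - v)"
    using c unfolding planar_corner_def by auto
  note D = planar_frameD[OF fr]
  obtain e l where e: "e extreme_point_of F" "e = v + l *\<^sub>R a" "1 \<le> l" "l \<in> \<int>" 
    "\<And>x. x \<in> F \<Longrightarrow> h (x - v) = 0 \<Longrightarrow> g (x - v) \<le> l"
    using row_end[OF v c] by blast
  have eF: "e \<in> F" using e(1) by (simp add: extreme_point_of_def)
  obtain k where k: "k \<in> \<int>" "e + (b + k *\<^sub>R a) \<in> F" "\<And>x. x \<in> F \<Longrightarrow> g (x - v) \<le> l + h (x - v) * k"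
    using second_row[OF v c e(1-3)] by blast
  define m where "m = l + k"
  have mF: "v + b + m *\<^sub>R a \<in> F" using k(2) e(2) by (simp add: m_def algebra_simps)
  have "v + b + m *\<^sub>R a - v = b + m *\<^sub>R a" by simp
  then have "g (v + b + m *\<^sub>R a - v) = m" using D by (simp add: linear_add linear_scale)
  then have m0: "0 \<le> m" using pos(1)[OF mF] by simp
  have mI: "m \<in> \<int>" using e(4) k(1) by (simp add: m_def)
  have "m \<noteq> 0"
  proof
    assume "m = 0"
    then have "k = - l" by (simp add: m_def)
    then have "g (x - v) + h (x - v) * l \<le> l" if "x \<in> F" for x using k(3)[OF that] by simp
    then have "F = convex hull {v, v + a, v + b}" using triangle_row[OF v c, of l] eF e by blast
    then show False using no by blast
  qed
  then have m1: "1 \<le> m" using m0 mI by (auto elim!: Ints_cases)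
  note result = that
  have row: thesis if w: "w \<in> F" "w + n *\<^sub>R a \<in> F" "w \<in> int_lattice" and n: "1 \<le> n" "n \<in> \<int>" and gw: "g (w - v) = 0" 
    and zw: "h (w - v) = h (z - v)" "g (z - v) \<le> n" for w n
  proof -
    \<comment> \<open>The minimum matters only when \<open>z\<close> is the right end of the row: there the
    interval to its left is taken.\<close>
    define j where "j = min \<lfloor>g (z - v)\<rfloor> (\<lfloor>n\<rfloor> - 1)"
    have nf: "of_int \<lfloor>n\<rfloor> = n" using n(2) by (auto elim: Ints_cases)
    have "0 \<le> g (z - v)" using pos(1)[OF z(1)] .
    then have "0 \<le> \<lfloor>g (z - v)\<rfloor>" by simp
    moreover have "1 \<le> \<lfloor>n\<rfloor>" using n(1) by simp
    ultimately have j: "0 \<le> j" "real_of_int j \<le> n - 1" using nf by (auto simp: j_def min_def of_int_diff)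
    have jz: "of_int j \<le> g (z - v)" unfolding j_def by linarith
    have zj: "g (z - v) \<le> of_int j + 1"
    proof (cases "\<lfloor>g (z - v)\<rfloor> \<le> \<lfloor>n\<rfloor> - 1")
      case True then show ?thesis unfolding j_def by linarith
    next
      case False
      then have "real_of_int j = n - 1" using nf by (simp add: j_def)
      then show ?thesis using zw(2) by simp
    qed
    have onrow: "w + r *\<^sub>R a \<in> F" if "0 \<le> r" "r \<le> n" for r
    proof -
      have "w + (r / n) *\<^sub>R (n *\<^sub>R a) \<in> F" by (rule convex_step[OF cvx w(1,2)]) (use that n(1) in simp)
      then show ?thesis using n(1) by simp
    qed
    let ?y = "w + real_of_int j *\<^sub>R a"
    have yv: "?y - v = (w - v) + real_of_int j *\<^sub>R a" by simp
    have gy: "g (?y - v) = of_int j" "h (?y - v) = h (w - v)"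
      unfolding yv using D gw by (simp_all add: linear_add linear_scale)
    show thesis
    proof (rule result[of ?y])
      show "?y \<in> F \<inter> int_lattice" using onrow[of "of_int j"] j w(3) D(3) by (auto intro!: int_lattice_closed)
      have "w + (real_of_int j + 1) *\<^sub>R a \<in> F" using j by (intro onrow) auto
      then show "?y + a \<in> F" by (simp add: scaleR_add_left add.assoc)
    qed (use gy jz zj zw in auto)
  qed
  have vL: "v \<in> int_lattice" using lattice[OF v] .
  from z(2) show thesis
  proof
    assume h0: "h (z - v) = 0"
    show thesis by (rule row[of v l]) (use vF eF e vL h0 z D in \<open>auto simp: linear_0\<close>)
  next
    assume h1: "h (z - v) = 1"
    have "g (z - v) \<le> m" using k(3)[OF z(1)] h1 by (simp add: m_def)
    then show thesis by (intro row[of "v + b" m]) (use vF mF m1 mI vL h1 z D in \<open>auto intro: int_lattice_closed\<close>)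
  qed
qed

end

section \<open>Unimodular triangles in a smooth polygon\<close>

text \<open>For a triangle with vertices \<open>v0\<close>, \<open>v1\<close>, \<open>v2\<close> the
functionals \<open>X\<close> and \<open>Y\<close> are the linear parts of the barycentric coordinates at
\<open>v1\<close> and \<open>v2\<close>, and \<open>-X - Y\<close> is the one at
\<open>v0\<close>.\<close>
lemma planar_frame_rebase:
  assumes "planar_frame f (v1 - v0) (v2 - v0) X Y" "linear f"
  shows "planar_frame f (v0 - v1) (v2 - v1) (\<lambda>d. - X d - Y d) Y"
proof -
  note D = planar_frameD[OF assms(1)]
  have lin: "linear (\<lambda>d. - X d - Y d)"
    using D(1,2) by (intro linearI) (simp_all add: linear_add linear_scale algebra_simps)
  have eq: "v2 - v1 = (v2 - v0) - (v1 - v0)" "v0 - v1 = - (v1 - v0)" by simp_all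
  have XY: "X (v0 - v1) = -1" "Y (v0 - v1) = 0" "X (v2 - v1) = -1" "Y (v2 - v1) = 1"
    unfolding eq using D by (simp_all only: linear_diff linear_neg)
  have L: "v0 - v1 \<in> int_lattice" "v2 - v1 \<in> int_lattice"
    unfolding eq by (rule int_lattice_closed(4)[OF D(3)], rule int_lattice_closed(3)[OF D(4,3)])
  have "(- X x - Y x) *\<^sub>R (v0 - v1) + Y x *\<^sub>R (v2 - v1) = X x *\<^sub>R (v1 - v0) + Y x *\<^sub>R (v2 - v0)" for x
    by (simp add: algebra_simps)
  then have co: "(- X x - Y x) *\<^sub>R (v0 - v1) + Y x *\<^sub>R (v2 - v1) = x" if "f x = 0" for x using D(13)[OF that] by simp
  have "f (v0 - v1) = 0 \<and> f (v2 - v1) = 0"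
    unfolding eq using D(5,6) assms(2) by (simp only: linear_diff linear_neg) simp
  then show ?thesis unfolding planar_frame_def using D(2,11,12) lin XY L co by auto
qed

context smooth_polygon
begin

text \<open>Stated with a corner of the polygon, which is the form in which this case is excluded for
the rows.\<close>
definition is_unimodular_triangle :: bool where
  "is_unimodular_triangle \<longleftrightarrow> (\<exists>v a b g h. v extreme_point_of F \<and> planar_corner f F v a b g h \<and> F = convex hull {v, v + a, v + b})"

lemma exit_through_edge:
  assumes z: "z0 \<in> F" "z1 \<notin> F" "f (z1 - z0) = 0"
  obtains s w a b g h where "0 \<le> s" "s < 1" "w extreme_point_of F" "planar_corner f F w a b g h" 
    "z0 + s *\<^sub>R (z1 - z0) \<in> F" "h (z0 + s *\<^sub>R (z1 - z0) - w) = 0" "h (z1 - w) < 0"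
proof -
  obtain ca cb cg ch where c: "\<And>w. w extreme_point_of F \<Longrightarrow> planar_corner f F w (ca w) (cb w) (cg w) (ch w)"
    using corner by metis
  define C where "C = (\<lambda>w. {(cg w, ca w), (ch w, cb w)})"
  obtain s w k u where sw: "0 \<le> s" "s < 1" "w extreme_point_of F" "(k, u) \<in> C w" "k (z0 + s *\<^sub>R (z1 - z0) - w) = 0"
    "k (z1 - w) < 0" "z0 + s *\<^sub>R (z1 - z0) \<in> F"
  proof (rule exit_through_facet[OF cpt cvx fin, of C z0 z1])
    show "finite (C w)" for w by (simp add: C_def)
    show "linear k \<and> w + u \<in> F \<and> (\<forall>x\<in>F. 0 \<le> k (x - w))" if "w extreme_point_of F" "(k, u) \<in> C w" for w k u
      using c[OF that(1)] that(2) by (auto simp: C_def planar_corner_def planar_frame_def)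
    show "z0 + s *\<^sub>R (z1 - z0) - w = (\<Sum>(k, u)\<in>C w. k (z0 + s *\<^sub>R (z1 - z0) - w) *\<^sub>R u)"
      if w: "w extreme_point_of F" for w s
    proof -
      let ?z = "z0 + s *\<^sub>R (z1 - z0)"
      have fr: "planar_frame f (ca w) (cb w) (cg w) (ch w)" and "w \<in> F" using c[OF w] by (auto simp: planar_corner_def)
      have "?z - w = (z0 - w) + s *\<^sub>R (z1 - z0)" by simp
      then have "f (?z - w) = 0" using lin flat[OF z(1) \<open>w \<in> F\<close>] z(3) by (simp only: linear_add linear_scale; simp)
      then have "cg w (?z - w) *\<^sub>R ca w + ch w (?z - w) *\<^sub>R cb w = ?z - w" by (rule planar_frameD(13)[OF fr])
      moreover have "ca w \<noteq> cb w" using planar_frameD(7,8)[OF fr] by auto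
      ultimately show ?thesis by (simp add: C_def)
    qed
  qed (use z in auto)
  note cw = c[OF sw(3)]
  from sw(4) consider "k = cg w" | "k = ch w" by (auto simp: C_def)
  then show ?thesis
  proof cases
    case 1 show ?thesis by (rule that[OF sw(1,2,3) planar_corner_swap[OF cw] sw(7)]) (use sw 1 in auto)
  next
    case 2 show ?thesis by (rule that[OF sw(1,2,3) cw sw(7)]) (use sw 2 in auto)
  qed
qed

end

text \<open>The barycentric coordinates of a point \<open>x\<close> are \<open>X (x - v0)\<close> and
\<open>Y (x - v0)\<close> at \<open>v1\<close> and \<open>v2\<close>, and one minus their sum at
\<open>v0\<close>. The exchanges of vertices below generate all permutations.\<close>
locale triangle_in_polygon = smooth_polygon f F for f F +
  fixes v0 v1 v2 :: "real^3" and X Y :: "real^3 \<Rightarrow> real"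
  assumes vF: "v0 \<in> F" "v1 \<in> F" "v2 \<in> F" and vL: "v0 \<in> int_lattice"
    and frame: "planar_frame f (v1 - v0) (v2 - v0) X Y"
begin

lemmas D = planar_frameD[OF frame]

lemma vL12: "v1 \<in> int_lattice" "v2 \<in> int_lattice"
proof -
  have "v1 - v0 + v0 \<in> int_lattice" "v2 - v0 + v0 \<in> int_lattice"
    using int_lattice_closed(2)[OF D(3) vL] int_lattice_closed(2)[OF D(4) vL] .
  then show "v1 \<in> int_lattice" "v2 \<in> int_lattice" by simp_all
qed

lemma swap: "triangle_in_polygon f F v0 v2 v1 Y X"
  using vF vL planar_frame_swap[OF frame] by unfold_locales

lemma rebase: "triangle_in_polygon f F v1 v0 v2 (\<lambda>d. - X d - Y d) Y"
  using vF vL12 planar_frame_rebase[OF frame lin] by unfold_locales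

lemma coord_v: "X (v0 - v0) = 0" "Y (v0 - v0) = 0" "X (v1 - v0) = 1" "Y (v1 - v0) = 0" "X (v2 - v0) = 0" "Y (v2 - v0) = 1"
  using D by (simp_all add: linear_0)

lemma segment_in_F: "p \<in> F \<Longrightarrow> q \<in> F \<Longrightarrow> 0 \<le> r \<Longrightarrow> r \<le> 1 \<Longrightarrow> p + r *\<^sub>R (q - p) \<in> F"
  by (rule convex_step[OF cvx]) auto

lemma point_eqI:
  assumes "p \<in> F" "f (q - v0) = 0" "X (p - v0) = X (q - v0)" "Y (p - v0) = Y (q - v0)"
  shows "p = q"
proof -
  have "X (q - v0) *\<^sub>R (v1 - v0) + Y (q - v0) *\<^sub>R (v2 - v0) = p - v0"
    using D(13)[OF flat[OF assms(1) vF(1)]] unfolding assms(3,4) .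
  with D(13)[OF assms(2)] have "p - v0 = q - v0" by (rule trans[OF sym, rotated])
  then show ?thesis by simp
qed

lemma f_corner: "f (v1 - v0) = 0" "f (v2 - v0) = 0" using D by blast+

text \<open>The reflection \<open>v0 + v1 - v2\<close> of \<open>v2\<close> has the coordinates \<open>X
= 1\<close>, \<open>Y = -1\<close>, so it lies on the segment from \<open>B\<close> to
\<open>A\<close>.\<close>
lemma fourth_vertex_between:
  assumes A: "A \<in> F" "Y (A - v0) = -1" "1 \<le> X (A - v0)" and B: "B \<in> F" "Y (B - v0) = -1" "X (B - v0) \<le> 1"
  shows "v0 + v1 - v2 \<in> F"
proof -
  have r: "v0 + v1 - v2 - v0 = (v1 - v0) - (v2 - v0)" by simp
  have rc: "X (v0 + v1 - v2 - v0) = 1" "Y (v0 + v1 - v2 - v0) = -1" "f (v0 + v1 - v2 - v0) = 0"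
    unfolding r using D lin by (simp_all add: linear_diff)
  show ?thesis
  proof (cases "X (A - v0) = 1")
    case True
    then have "A = v0 + v1 - v2" using A rc by (intro point_eqI) auto
    then show ?thesis using A by simp
  next
    case False
    define s where "s = (1 - X (B - v0)) / (X (A - v0) - X (B - v0))"
    have s: "0 \<le> s" "s \<le> 1" "s * (X (A - v0) - X (B - v0)) = 1 - X (B - v0)" using A B False by (auto simp: s_def field_simps)
    have m: "B + s *\<^sub>R (A - B) \<in> F" using A B s by (intro segment_in_F) auto
    have "B + s *\<^sub>R (A - B) = v0 + v1 - v2"
      by (rule point_eqI[OF m rc(3)]) (use affine_on_line[OF D(1), of B s A v0] affine_on_line[OF D(2), of B s A v0] A B s rc in auto)
    then show ?thesis using m by simp
  qed
qed

lemma to_row: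
  assumes w: "w \<in> F" "Y (w - v0) = 0" and Q: "Q \<in> F" "Y (Q - v0) \<le> -1"
  obtains A where "A \<in> F" "Y (A - v0) = -1" "X (A - v0) = X (w - v0) + (X (Q - v0) - X (w - v0)) / (- Y (Q - v0))"
proof (rule that)
  let ?s = "1 / (- Y (Q - v0))"
  have s: "0 \<le> ?s" "?s \<le> 1" using Q by (auto simp: field_simps)
  show "w + ?s *\<^sub>R (Q - w) \<in> F" using s w Q by (intro segment_in_F) auto
  show "Y (w + ?s *\<^sub>R (Q - w) - v0) = -1" using affine_on_line[OF D(2), of w ?s Q v0] w Q by (simp add: field_simps)
  show "X (w + ?s *\<^sub>R (Q - w) - v0) = X (w - v0) + (X (Q - v0) - X (w - v0)) / (- Y (Q - v0))"
    using affine_on_line[OF D(1), of w ?s Q v0] by simp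
qed

text \<open>The segment from \<open>v1\<close> to \<open>Q0\<close> meets the line \<open>Y = -1\<close>
to the right of the reflection, and the segment from \<open>v0\<close> to \<open>Q1\<close> meets it to
the left.\<close>
lemma fourth_vertex_from_two:
  assumes Q0: "Q0 \<in> F" "Y (Q0 - v0) \<le> -1" "1 \<le> X (Q0 - v0)"
    and Q1: "Q1 \<in> F" "Y (Q1 - v0) \<le> -1" "X (Q1 - v0) \<le> - Y (Q1 - v0)"
  shows "v0 + v1 - v2 \<in> F"
proof -
  obtain A where A: "A \<in> F" "Y (A - v0) = -1" "X (A - v0) = X (v1 - v0) + (X (Q0 - v0) - X (v1 - v0)) / (- Y (Q0 - v0))"
    using to_row[OF vF(2) coord_v(4) Q0(1,2)] .
  obtain B where B: "B \<in> F" "Y (B - v0) = -1" "X (B - v0) = X (v0 - v0) + (X (Q1 - v0) - X (v0 - v0)) / (- Y (Q1 - v0))"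
    using to_row[OF vF(1) coord_v(2) Q1(1,2)] .
  have "0 \<le> (X (Q0 - v0) - 1) / (- Y (Q0 - v0))" using Q0 by (intro divide_nonneg_pos) auto
  then have 1: "1 \<le> X (A - v0)" using A(3) coord_v(3) by simp
  have "X (Q1 - v0) / (- Y (Q1 - v0)) \<le> 1" using Q1 by (subst divide_le_eq_1_pos) auto
  then have "X (B - v0) \<le> 1" using B(3) coord_v(1) by simp
  then show ?thesis by (rule fourth_vertex_between[OF A(1,2) 1 B(1,2)])
qed

text \<open>A point whose coordinates at \<open>v0\<close> and \<open>v1\<close> are both at least 1 can
serve as \<open>Q0\<close> and as \<open>Q1\<close>.\<close>
lemma two_positive:
  assumes "Q \<in> F" "1 \<le> X (Q - v0)" "X (Q - v0) + Y (Q - v0) \<le> 0"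
  shows "v0 + v1 - v2 \<in> F"
  by (rule fourth_vertex_from_two[of Q Q]) (use assms in auto)

lemma int_coords:
  assumes "Q \<in> int_lattice" obtains x y :: int where "X (Q - v0) = of_int x" "Y (Q - v0) = of_int y"
proof -
  have "Q - v0 \<in> int_lattice" using assms vL by (rule int_lattice_closed(3))
  then have "X (Q - v0) \<in> \<int>" "Y (Q - v0) \<in> \<int>" using D(11,12) by blast+
  then show ?thesis using that by (auto elim!: Ints_cases)
qed

end

text \<open>The situation to be refuted: all three reflections of the triangle in its edges fall outside
the polygon.\<close>
locale triangle_no_reflection = triangle_in_polygon +
  assumes no_reflection: "v1 + v2 - v0 \<notin> F" "v0 + v2 - v1 \<notin> F" "v0 + v1 - v2 \<notin> F"
    and no_triangle: "\<not> is_unimodular_triangle"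
begin

lemma swap': "triangle_no_reflection f F v0 v2 v1 Y X"
proof -
  interpret s: triangle_in_polygon f F v0 v2 v1 Y X by (rule swap)
  show ?thesis using no_reflection no_triangle by unfold_locales (simp_all add: add.commute)
qed

lemma rebase': "triangle_no_reflection f F v1 v0 v2 (\<lambda>d. - X d - Y d) Y"
proof -
  interpret s: triangle_in_polygon f F v1 v0 v2 "\<lambda>d. - X d - Y d" Y by (rule rebase)
  show ?thesis using no_reflection no_triangle by unfold_locales (simp_all add: add.commute)
qed

lemma rebase_coords:
  "Y (Q - v1) = Y (Q - v0)" "X (Q - v1) = X (Q - v0) - 1" 
proof -
  have eq: "Q - v1 = (Q - v0) - (v1 - v0)" by simp
  show "Y (Q - v1) = Y (Q - v0)" "X (Q - v1) = X (Q - v0) - 1" unfolding eq using D by (simp_all only: linear_diff)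
qed

text \<open>The coordinates are integers of sum 1, so one of them is positive, and two positive ones
would produce the reflection in the edge of the two vertices.\<close>
lemma one_positive:
  assumes Q: "Q \<in> F" "Q \<in> int_lattice" 
  shows "X (Q - v0) \<le> 0 \<and> Y (Q - v0) \<le> 0 \<or> 1 \<le> X (Q - v0) \<and> Y (Q - v0) \<le> 0 \<and> 1 \<le> X (Q - v0) + Y (Q - v0)
     \<or> X (Q - v0) \<le> 0 \<and> 1 \<le> Y (Q - v0) \<and> 1 \<le> X (Q - v0) + Y (Q - v0)"
proof -
  obtain x y :: int where xy: "X (Q - v0) = of_int x" "Y (Q - v0) = of_int y" using int_coords[OF Q(2)] .
  interpret s: triangle_no_reflection f F v0 v2 v1 Y X by (rule swap')
  interpret r: triangle_no_reflection f F v1 v0 v2 "\<lambda>d. - X d - Y d" Y by (rule rebase')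
  interpret rs: triangle_no_reflection f F v1 v2 v0 Y "\<lambda>d. - X d - Y d" by (rule r.swap')
  have "\<not> (1 \<le> x \<and> x + y \<le> 0)" using two_positive[OF Q(1)] no_reflection(3) xy by auto
  moreover have "\<not> (1 \<le> y \<and> x + y \<le> 0)" using s.two_positive[OF Q(1)] s.no_reflection(3) xy by auto
  moreover have "\<not> (1 \<le> x \<and> 1 \<le> y)"
    using rs.two_positive[OF Q(1)] rs.no_reflection(3) xy by (auto simp: rebase_coords)
  ultimately show ?thesis unfolding xy by auto
qed

lemma height_expansion:
  assumes "linear l" "x \<in> F"
  shows "l (x - w) = l (v0 - w) + (l (v1 - w) - l (v0 - w)) * X (x - v0) + (l (v2 - w) - l (v0 - w)) * Y (x - v0)"
proof -
  have "x - w = (v0 - w) + (x - v0)" by simp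
  also have "\<dots> = (v0 - w) + (X (x - v0) *\<^sub>R ((v1 - w) - (v0 - w)) + Y (x - v0) *\<^sub>R ((v2 - w) - (v0 - w)))"
    using D(13)[OF flat[OF assms(2) vF(1)]] by simp
  finally have "l (x - w) = l \<dots>" by (rule arg_cong)
  then show ?thesis using assms(1) by (simp only: linear_add linear_scale linear_diff real_scaleR_def) (simp add: algebra_simps)
qed

text \<open>Here \<open>h\<close> is the height over an edge of the polygon. A point whose coordinates
at \<open>v1\<close> and \<open>v2\<close> are not positive is at least as high as \<open>v0\<close>,
because \<open>v0\<close> is the highest vertex of the triangle. So a lattice point of height 0 or 1 has
its positive coordinate at \<open>v1\<close> or \<open>v2\<close>, and lies on the corresponding side of
the median \<open>X = Y\<close>. The median passes between two neighbouring lattice points of the row,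
which must lie on different sides of it.\<close>
lemma edge_rows:
  assumes w: "w extreme_point_of F" and c: "planar_corner f F w a b g h"
    and top: "h (v1 - w) + h (v2 - w) < h (v0 - w)" "2 \<le> h (v0 - w)"
    and z: "z \<in> F" "h (z - w) = 0 \<or> h (z - w) = 1" "X (z - v0) = Y (z - v0)"
  obtains p q where "p \<in> F" "p \<in> int_lattice" "h (p - w) = h (z - w)" "1 \<le> X (p - v0)" "Y (p - v0) \<le> 0" "1 \<le> X (p - v0) + Y (p - v0)"
    "q \<in> F" "q \<in> int_lattice" "h (q - w) = h (z - w)" "X (q - v0) \<le> 0" "1 \<le> Y (q - v0)" "1 \<le> X (q - v0) + Y (q - v0)"
proof -
  have no: "F \<noteq> convex hull {w, w + a, w + b}" using no_triangle w c unfolding is_unimodular_triangle_def by blast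
  have fr: "planar_frame f a b g h" and pos: "\<And>x. x \<in> F \<Longrightarrow> 0 \<le> h (x - w)"
    using c unfolding planar_corner_def by auto
  note C = planar_frameD[OF fr]
  obtain y where y: "y \<in> F" "y \<in> int_lattice" "y + a \<in> F" "h (y - w) = h (z - w)" "g (y - w) \<le> g (z - w)" "g (z - w) \<le> g (y - w) + 1"
    using rows[OF w c no z(1,2)] by blast
  have yaL: "y + a \<in> int_lattice" using y(2) C(3) by (rule int_lattice_closed(2))
  define \<rho> where "\<rho> = g (z - y)"
  have zy: "z - y = (z - w) - (y - w)" by simp
  have "h (z - y) = 0" "\<rho> = g (z - w) - g (y - w)"
    unfolding \<rho>_def zy using C(1,2) y(4) by (simp_all only: linear_diff)
  then have \<rho>: "0 \<le> \<rho>" "\<rho> \<le> 1" and zeq: "z = y + \<rho> *\<^sub>R a"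
    using y coordinates[OF fr z(1) y(1)] by (auto simp: \<rho>_def)
  have hya: "h (y + a - w) = h (z - w)"
  proof -
    have "y + a - w = (y - w) + a" by simp
    then show ?thesis using C(2,9) y(4) by (simp only: linear_add; simp)
  qed
  have l_ya: "l (y + a - v0) = l (y - v0) + l a" "l (z - v0) = l (y - v0) + \<rho> * l a" if "linear l" for l :: "real^3 \<Rightarrow> real"
  proof -
    have "y + a - v0 = (y - v0) + a" "z - v0 = (y - v0) + \<rho> *\<^sub>R a" unfolding zeq by simp_all
    then show "l (y + a - v0) = l (y - v0) + l a" "l (z - v0) = l (y - v0) + \<rho> * l a"
      using that by (simp_all only: linear_add linear_scale real_scaleR_def)
  qed
  define Zy Za where "Zy = X (y - v0) - Y (y - v0)" and "Za = X (y + a - v0) - Y (y + a - v0)"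
  \<comment> \<open>\<open>Zy\<close> and \<open>Za\<close> measure on which side of the median the two
  neighbours \<open>y\<close> and \<open>y + a\<close> of \<open>z\<close> lie.\<close>
  have mix: "(1 - \<rho>) * Zy + \<rho> * Za = 0"
    using l_ya[OF D(1)] l_ya[OF D(2)] z(3) by (simp add: Zy_def Za_def algebra_simps)
  have not_first: "\<not> (X (x - v0) \<le> 0 \<and> Y (x - v0) \<le> 0)" if x: "x \<in> F" "h (x - w) = h (z - w)" for x
  proof
    assume neg: "X (x - v0) \<le> 0 \<and> Y (x - v0) \<le> 0"
    have "h (v1 - w) \<le> h (v0 - w)" "h (v2 - w) \<le> h (v0 - w)" using top(1) pos[OF vF(2)] pos[OF vF(3)] by linarith+
    then have "0 \<le> (h (v1 - w) - h (v0 - w)) * X (x - v0)" "0 \<le> (h (v2 - w) - h (v0 - w)) * Y (x - v0)"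
      using neg by (auto intro!: mult_nonpos_nonpos)
    then have "h (v0 - w) \<le> h (x - w)" using height_expansion[OF C(2) x(1), of w] by linarith
    then show False using top(2) z(2) x(2) by linarith
  qed
  have hyz: "h (y - w) = h (z - w)" by (rule y(4))
  note cases_y = one_positive[OF y(1,2)] and cases_a = one_positive[OF y(3) yaL]
  show thesis
  proof (cases "1 \<le> X (y - v0)")
    case True
    then have Zy: "1 \<le> Zy" and y': "Y (y - v0) \<le> 0" "1 \<le> X (y - v0) + Y (y - v0)" using cases_y by (auto simp: Zy_def)
    have "\<not> 1 \<le> Za"
    proof
      assume "1 \<le> Za"
      then have "(1 - \<rho>) * 1 \<le> (1 - \<rho>) * Zy" "\<rho> * 1 \<le> \<rho> * Za" using Zy \<rho> by (intro mult_left_mono; simp)+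
      then show False using mix by simp
    qed
    then have "X (y + a - v0) \<le> 0" "1 \<le> Y (y + a - v0)" "1 \<le> X (y + a - v0) + Y (y + a - v0)"
      using cases_a not_first[OF y(3) hya] by (auto simp: Za_def)
    then show thesis using that[of y "y + a"] y(1,2,3) yaL hyz hya True y' by blast
  next
    case False
    then have y': "X (y - v0) \<le> 0" "1 \<le> Y (y - v0)" "1 \<le> X (y - v0) + Y (y - v0)" and Zy: "Zy \<le> -1"
      using cases_y not_first[OF y(1) hyz] by (auto simp: Zy_def)
    have "\<not> Za \<le> -1"
    proof
      assume "Za \<le> -1"
      then have "(1 - \<rho>) * Zy \<le> (1 - \<rho>) * (-1)" "\<rho> * Za \<le> \<rho> * (-1)" using Zy \<rho> by (intro mult_left_mono; simp)+
      then show False using mix by simp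
    qed
    then have "1 \<le> X (y + a - v0)" "Y (y + a - v0) \<le> 0" "1 \<le> X (y + a - v0) + Y (y + a - v0)"
      using cases_a not_first[OF y(3) hya] by (auto simp: Za_def)
    then show thesis using that[of "y + a" y] y(1,2,3) yaL hyz hya y' by blast
  qed
qed

text \<open>The prolongation of the median from \<open>v0\<close> beyond the midpoint of
\<open>v1\<close> and \<open>v2\<close> leaves the polygon before it reaches the reflection
\<open>r\<close> of \<open>v0\<close>. Over the edge through which it leaves, the heights
\<open>m\<close>, \<open>i\<close>, \<open>j\<close> of the three vertices satisfy \<open>i + j <
m\<close>, since \<open>r\<close> has the height \<open>i + j - m\<close>.

If \<open>m = 1\<close>, then \<open>v1\<close> and \<open>v2\<close> lie on the edge, and the row of
\<open>v0\<close> contains a neighbour of \<open>v0\<close>, which is one of the reflections. If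
\<open>m \<ge> 2\<close>, the median crosses the rows of height 0 and 1, and both contain lattice points
\<open>p1\<close>, \<open>p2\<close> with positive coordinate at \<open>v1\<close>. One of these has a
negative coordinate at \<open>v2\<close>. Otherwise both lie on the line \<open>Y = 0\<close>, along
which heights change in steps of \<open>m - i\<close>; so \<open>m - i = 1\<close>, hence \<open>j =
0\<close>, and then the lattice point \<open>q2\<close> of height 1 with positive coordinate at
\<open>v2\<close> has height at most 0.\<close>
lemma deep_point:
  obtains Q where "Q \<in> F" "Y (Q - v0) \<le> -1" "1 \<le> X (Q - v0) + Y (Q - v0)"
proof -
  define M where "M = v1 + (1 / 2) *\<^sub>R (v2 - v1)"
  define r where "r = v1 + v2 - v0"
  have MF: "M \<in> F" unfolding M_def using vF by (intro segment_in_F) auto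
  have rM: "r - M = (1 / 2) *\<^sub>R ((v1 - v0) + (v2 - v0))"
  proof -
    have "2 *\<^sub>R (r - M) = 2 *\<^sub>R ((1 / 2) *\<^sub>R ((v1 - v0) + (v2 - v0)))"
      unfolding r_def M_def by (simp add: scaleR_diff_right scaleR_add_right) (simp add: scaleR_2)
    then show ?thesis unfolding scaleR_cancel_left by simp
  qed
  have "f (r - M) = 0" unfolding rM using lin f_corner by (simp only: linear_add linear_scale; simp)
  then obtain s w a b g h where s: "0 \<le> s" "s < 1" and w: "w extreme_point_of F" and c: "planar_corner f F w a b g h"
    and z: "M + s *\<^sub>R (r - M) \<in> F" "h (M + s *\<^sub>R (r - M) - w) = 0" and hr: "h (r - w) < 0"
    using exit_through_edge[OF MF _ ] no_reflection(1) unfolding r_def by metis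
  define z where "z = M + s *\<^sub>R (r - M)"
  have zF: "z \<in> F" "h (z - w) = 0" using z by (auto simp: z_def)
  have fr: "planar_frame f a b g h" and pos: "\<And>x. x \<in> F \<Longrightarrow> 0 \<le> h (x - w)"
    using c unfolding planar_corner_def by auto
  note C = planar_frameD[OF fr]
  have wL: "w \<in> int_lattice" by (rule lattice[OF w])
  have no: "F \<noteq> convex hull {w, w + a, w + b}" using no_triangle w c unfolding is_unimodular_triangle_def by blast
  have zXY: "X (z - v0) = Y (z - v0)"
  proof -
    have "z - v0 = (v1 - v0) + (1 / 2) *\<^sub>R ((v2 - v0) - (v1 - v0)) + s *\<^sub>R ((1 / 2) *\<^sub>R ((v1 - v0) + (v2 - v0)))"
      unfolding z_def rM by (simp add: M_def)
    then show ?thesis using D by (simp only: linear_add linear_diff linear_scale; simp)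
  qed
  have "r - w = (v1 - w) + (v2 - w) - (v0 - w)" by (simp add: r_def)
  then have hr': "h (v1 - w) + h (v2 - w) < h (v0 - w)" using hr C(2) by (simp only: linear_add linear_diff; simp)
  have ints: "\<exists>n::int. h (x - w) = of_int n" if "x \<in> int_lattice" for x
    using C(12)[OF int_lattice_closed(3)[OF that wL]] by (auto elim: Ints_cases)
  obtain m i j :: int where mij: "h (v0 - w) = of_int m" "h (v1 - w) = of_int i" "h (v2 - w) = of_int j"
    using ints[OF vL] ints[OF vL12(1)] ints[OF vL12(2)] by blast
  have ij: "0 \<le> i" "0 \<le> j" "i + j < m" using pos[OF vF(2)] pos[OF vF(3)] hr' mij by simp_all
  show thesis
  proof (cases "m = 1")
    case True
    then have ij0: "i = 0" "j = 0" using ij by auto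
    obtain y where y: "y \<in> F" "y \<in> int_lattice" "y + a \<in> F" "h (y - w) = h (v0 - w)" "g (y - w) \<le> g (v0 - w)" "g (v0 - w) \<le> g (y - w) + 1"
      using rows[OF w c no vF(1)] mij True by auto
    have vy: "v0 - y = (v0 - w) - (y - w)" by simp
    have gy: "h (v0 - y) = 0" "g (v0 - y) = g (v0 - w) - g (y - w)"
      unfolding vy linear_diff[OF C(1), of "v0 - w" "y - w"] linear_diff[OF C(2), of "v0 - w" "y - w"] using y(4) by simp_all
    have "g (v0 - y) \<in> \<int>" using C(11) int_lattice_closed(3)[OF vL y(2)] .
    then have "g (v0 - y) = 0 \<or> g (v0 - y) = 1" using y(5,6) gy(2) by (auto elim!: Ints_cases)
    moreover have "v0 = y + g (v0 - y) *\<^sub>R a" using coordinates[OF fr vF(1) y(1)] gy(1) by simp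
    ultimately have near: "v0 + a \<in> F \<or> v0 - a \<in> F" using y(1,3) by (metis add.right_neutral add_diff_cancel_right' scaleR_one scaleR_zero_left)
    have hd: "h (p - q) = h (p - w) - h (q - w)" for p q
      using linear_diff[OF C(2), of "p - w" "q - w"] by simp
    have h12: "h (v2 - v1) = 0" "h (v1 - v0) = -1" "h (v2 - v0) = -1"
      using mij ij0 True by (simp_all add: hd[of v2 v1] hd[of v1 v0] hd[of v2 v0])
    have d: "v2 - v1 = g (v2 - v1) *\<^sub>R a" using C(13)[OF flat[OF vF(3,2)]] h12(1) by simp
    have aXY: "X a *\<^sub>R (v1 - v0) + Y a *\<^sub>R (v2 - v0) = a" using D(13)[OF C(5)] .
    then have "h (X a *\<^sub>R (v1 - v0) + Y a *\<^sub>R (v2 - v0)) = 0" using C(9) by simp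
    then have "X a = - Y a" using C(2) h12 by (simp add: linear_add linear_scale)
    then have "Y a *\<^sub>R (v2 - v1) = a" using aXY by (simp add: algebra_simps)
    then have "g (Y a *\<^sub>R (v2 - v1)) = 1" using C(7) by simp
    then have "Y a * g (v2 - v1) = 1" using C(1) by (simp add: linear_scale)
    moreover have "Y a \<in> \<int>" "g (v2 - v1) \<in> \<int>" using D(12)[OF C(3)] C(11)[OF int_lattice_closed(3)[OF vL12(2,1)]] .
    ultimately have "g (v2 - v1) = 1 \<or> g (v2 - v1) = -1" using Ints_mult_eq_1 by blast
    then have "v2 - v1 = a \<or> v2 - v1 = - a" using d by auto
    then have "v0 + v2 - v1 \<in> F \<or> v0 + v1 - v2 \<in> F"
    proof
      assume "v2 - v1 = a"
      then have "v0 + v2 - v1 = v0 + a" "v0 + v1 - v2 = v0 - a" by (auto simp: algebra_simps)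
      then show ?thesis using near by argo
    next
      assume "v2 - v1 = - a"
      then have "v0 + v2 - v1 = v0 - a" "v0 + v1 - v2 = v0 + a" by (auto simp: algebra_simps)
      then show ?thesis using near by argo
    qed
    then show thesis using no_reflection by blast
  next
    case False
    then have m2: "2 \<le> m" using ij by linarith
    then have top: "2 \<le> h (v0 - w)" using mij by simp
    obtain p1 where p1: "p1 \<in> F" "p1 \<in> int_lattice" "h (p1 - w) = 0" "1 \<le> X (p1 - v0)" "Y (p1 - v0) \<le> 0" "1 \<le> X (p1 - v0) + Y (p1 - v0)"
      using edge_rows[OF w c hr' top zF(1) _ zXY] zF(2) by metis
    define z' where "z' = z + (1 / of_int m) *\<^sub>R (v0 - z)"
    have z'F: "z' \<in> F" unfolding z'_def using zF vF m2 by (intro segment_in_F) auto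
    have hz': "h (z' - w) = 1"
    proof -
      have "z' - w = (z - w) + (1 / of_int m) *\<^sub>R ((v0 - w) - (z - w))" by (simp add: z'_def)
      then have "h (z' - w) = h (z - w) + (1 / of_int m) * (h (v0 - w) - h (z - w))"
        using C(2) by (simp only: linear_add linear_scale linear_diff real_scaleR_def)
      then show ?thesis using zF(2) mij m2 by simp
    qed
    have z'XY: "X (z' - v0) = Y (z' - v0)"
      unfolding z'_def affine_on_line[OF D(1)] affine_on_line[OF D(2)] using zXY coord_v by simp
    obtain p2 q2 where p2: "p2 \<in> F" "p2 \<in> int_lattice" "h (p2 - w) = 1" "1 \<le> X (p2 - v0)" "Y (p2 - v0) \<le> 0" "1 \<le> X (p2 - v0) + Y (p2 - v0)"
     and q2: "q2 \<in> F" "h (q2 - w) = 1" "X (q2 - v0) \<le> 0" "1 \<le> X (q2 - v0) + Y (q2 - v0)"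
      using edge_rows[OF w c hr' top z'F _ z'XY] hz' by metis
    have exp: "h (x - w) = of_int m + of_int (i - m) * X (x - v0) + of_int (j - m) * Y (x - v0)" if "x \<in> F" for x
      using height_expansion[OF C(2) that, of w] mij by simp
    show thesis
    proof (cases "Y (p1 - v0) \<le> -1 \<or> Y (p2 - v0) \<le> -1")
      case True
      then show thesis using that p1 p2 by blast
    next
      case False
      obtain x1 y1 :: int where xy1: "X (p1 - v0) = of_int x1" "Y (p1 - v0) = of_int y1" using int_coords[OF p1(2)] .
      obtain x2 y2 :: int where xy2: "X (p2 - v0) = of_int x2" "Y (p2 - v0) = of_int y2" using int_coords[OF p2(2)] .
      have y0: "y1 = 0" "y2 = 0" using False p1(5) p2(5) xy1 xy2 by auto
      have "real_of_int (m + (i - m) * x1) = 0" "real_of_int (m + (i - m) * x2) = 1"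
        using exp[OF p1(1)] exp[OF p2(1)] p1(3) p2(3) xy1 xy2 y0 by simp_all
      then have "m + (i - m) * x1 = 0" "m + (i - m) * x2 = 1" by linarith+
      then have "(m - i) * (x1 - x2) = 1" by (simp add: algebra_simps)
      then have "m - i = 1" using ij zmult_eq_1_iff[of "m - i" "x1 - x2"] by linarith
      then have ij': "j = 0" "m = i + 1" using ij by auto
      have "h (q2 - w) = of_int m * (1 - X (q2 - v0) - Y (q2 - v0)) + of_int i * X (q2 - v0)"
        using exp[OF q2(1)] ij' by (simp add: algebra_simps)
      moreover have "of_int m * (1 - X (q2 - v0) - Y (q2 - v0)) \<le> 0" using q2 m2 by (intro mult_nonneg_nonpos) auto
      moreover have "of_int i * X (q2 - v0) \<le> 0" using q2 ij by (intro mult_nonneg_nonpos) auto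
      ultimately show thesis using q2(2) by linarith
    qed
  qed
qed

text \<open>The points obtained for \<open>v0\<close> and, after exchanging \<open>v0\<close> and
\<open>v1\<close>, for \<open>v1\<close> both lie beyond the line through these two vertices, one past
\<open>v1\<close> and the other one past \<open>v0\<close>.\<close>
lemma contradiction: False
proof -
  interpret r: triangle_no_reflection f F v1 v0 v2 "\<lambda>d. - X d - Y d" Y by (rule rebase')
  obtain Q0 where Q0: "Q0 \<in> F" "Y (Q0 - v0) \<le> -1" "1 \<le> X (Q0 - v0) + Y (Q0 - v0)" by (rule deep_point)
  obtain Q1 where Q1: "Q1 \<in> F" "Y (Q1 - v1) \<le> -1" "1 \<le> - X (Q1 - v1) - Y (Q1 - v1) + Y (Q1 - v1)" by (rule r.deep_point)
  have "v0 + v1 - v2 \<in> F"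
    by (rule fourth_vertex_from_two[of Q0 Q1]) (use Q0 Q1 in \<open>simp_all add: rebase_coords\<close>)
  then show False using no_reflection by simp
qed

end

theorem (in triangle_in_polygon) reflected_triangle:
  assumes "\<not> is_unimodular_triangle"
  shows "v1 + v2 - v0 \<in> F \<or> v0 + v2 - v1 \<in> F \<or> v0 + v1 - v2 \<in> F"
proof (rule ccontr)
  assume "\<not> ?thesis"
  then interpret triangle_no_reflection f F v0 v1 v2 X Y using assms by unfold_locales auto
  show False by (rule contradiction)
qed

section \<open>Rays from the centre of symmetry\<close>

lemma frame_det3: "lattice_frame a b c f g h \<Longrightarrow> det3 a b c \<noteq> 0"
  using frame_independent by (intro det3_nonzero_if_independent)

lemma tet_inj:
  assumes "tet v \<noteq> 0" "i < 4" "j < 4" "v i = v j" shows "i = j"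
proof (rule ccontr)
  assume "i \<noteq> j"
  define c where "c = (\<lambda>k. if k = j then 1 else 0 :: real)"
  have "bary c v = (\<Sum>k<4. if k = j then v k else 0)" unfolding bary_def c_def by (rule sum.cong) auto
  also have "\<dots> = v i" using assms by simp
  finally have b: "bary c v = v i" .
  have "sum c {..<4} = 1" using assms(3) by (simp add: c_def)
  from tet_fun_upd[OF this assms(2), of v] have "tet v = c i * tet v" unfolding b by simp
  then show False using assms(1) \<open>i \<noteq> j\<close> by (simp add: c_def)
qed

lemma tet_not_flat:
  fixes h :: "real^3 \<Rightarrow> real"
  assumes "tet v \<noteq> 0" "linear h" "\<And>i. i < 4 \<Longrightarrow> h (v i - p) = r" shows "h x = 0"
proof -
  have const: "h (y - p) = r" for y
  proof -
    obtain c where c: "sum c {..<4} = 1" "bary c v = y" using barycentric_coordinates[OF assms(1)] .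
    have "h (y - p) = (\<Sum>i<4. c i * h (v i - p))" using linear_bary[OF assms(2) c(1), of v p] unfolding c(2) .
    also have "\<dots> = (\<Sum>i<4. c i * r)" by (rule sum.cong) (use assms(3) in auto)
    also have "\<dots> = r" using c(1) by (simp add: sum_distrib_right[symmetric])
    finally show ?thesis .
  qed
  have "h (p - p) = r" "h (p + x - p) = r" by (rule const)+
  then show ?thesis using assms(2) by (simp add: linear_0)
qed

lemma planar_frame_of_frame:
  assumes "lattice_frame a b c f g k" "linear h" "h a = 0" "h b = 0" "h c \<noteq> 0"
  shows "planar_frame h a b f g"
proof -
  note D = lattice_frameD[OF assms(1)]
  have "f x *\<^sub>R a + g x *\<^sub>R b = x" if "h x = 0" for x
  proof -
    have "h (f x *\<^sub>R a + g x *\<^sub>R b + k x *\<^sub>R c) = 0" unfolding D(16) by (rule that)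
    then have "k x = 0" using assms(2-5) by (simp add: linear_add linear_scale)
    then show ?thesis using D(16)[of x] by simp
  qed
  then show ?thesis unfolding planar_frame_def using D assms(3,4) by blast
qed

text \<open>Of a unimodular tetrahedron with apex \<open>q\<close>, the face opposite to
\<open>q\<close> is a unimodular triangle in its plane. On vectors of that plane the coordinates at the
three other vertices have sum 0.\<close>
lemma planar_frame_of_apex:
  assumes fr: "lattice_frame (v1 - q) (v2 - q) (v3 - q) f g k" and h: "linear h" 
    and 0: "h (v2 - v1) = 0" "h (v3 - v1) = 0" and q: "h (v1 - q) \<noteq> 0"
  shows "planar_frame h (v2 - v1) (v3 - v1) g k"
proof -
  note D = lattice_frameD[OF fr]
  have e: "v2 - v1 = (v2 - q) - (v1 - q)" "v3 - v1 = (v3 - q) - (v1 - q)" by simp_all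
  have h23: "h (v2 - q) = h (v1 - q)" "h (v3 - q) = h (v1 - q)"
    using 0 linear_diff[OF h, of "v2 - q" "v1 - q"] linear_diff[OF h, of "v3 - q" "v1 - q"] by simp_all
  have L: "v2 - v1 \<in> int_lattice" "v3 - v1 \<in> int_lattice" unfolding e 
    using int_lattice_closed(3)[OF D(5,4)] int_lattice_closed(3)[OF D(6,4)] .
  have val: "g (v2 - v1) = 1" "g (v3 - v1) = 0" "k (v2 - v1) = 0" "k (v3 - v1) = 1"
    using linear_diff[OF D(2), of "v2 - q" "v1 - q"] linear_diff[OF D(2), of "v3 - q" "v1 - q"]
     linear_diff[OF D(3), of "v2 - q" "v1 - q"] linear_diff[OF D(3), of "v3 - q" "v1 - q"] D by simp_all
  have "g x *\<^sub>R (v2 - v1) + k x *\<^sub>R (v3 - v1) = x" if "h x = 0" for x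
  proof -
    have "h (f x *\<^sub>R (v1 - q) + g x *\<^sub>R (v2 - q) + k x *\<^sub>R (v3 - q)) = 0" unfolding D(16) by (rule that)
    then have "f x * h (v1 - q) + g x * h (v1 - q) + k x * h (v1 - q) = 0" using h by (simp only: linear_add linear_scale h23 real_scaleR_def)
    then have "(f x + g x + k x) * h (v1 - q) = 0" by (simp only: distrib_right)
    then have fx: "f x = - g x - k x" using q by simp
    have "x = f x *\<^sub>R (v1 - q) + g x *\<^sub>R (v2 - q) + k x *\<^sub>R (v3 - q)" using D(16)[of x] by simp
    also have "\<dots> = g x *\<^sub>R (v2 - v1) + k x *\<^sub>R (v3 - v1)" unfolding fx by (simp add: algebra_simps)
    finally show ?thesis ..
  qed
  then show ?thesis unfolding planar_frame_def using D L val 0 by blast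
qed

lemma corner_rotate: "corner P v a b c f g h \<Longrightarrow> corner P v b c a g h f"
  unfolding corner_def using lattice_frame_rotate by blast

lemma det3_planar:
  assumes fr: "planar_frame h a b X Y" and h: "linear h" "h e \<noteq> 0" shows "det3 a b e \<noteq> 0"
proof
  note D = planar_frameD[OF fr]
  assume "det3 a b e = 0"
  then obtain x y z :: real where rel: "x *\<^sub>R a + y *\<^sub>R b + z *\<^sub>R e = 0" and nz: "x \<noteq> 0 \<or> y \<noteq> 0 \<or> z \<noteq> 0"
    by (rule det3_eq_0D)
  have "h (x *\<^sub>R a + y *\<^sub>R b + z *\<^sub>R e) = 0" unfolding rel using h by (simp add: linear_0)
  then have z: "z = 0" using h D(5,6) by (simp add: linear_add linear_scale)
  then have rel': "x *\<^sub>R a + y *\<^sub>R b = 0" using rel by simp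
  have "X (x *\<^sub>R a + y *\<^sub>R b) = 0" "Y (x *\<^sub>R a + y *\<^sub>R b) = 0" unfolding rel' using D(1,2) by (auto simp: linear_0)
  then show False using D nz z by (simp add: linear_add linear_scale)
qed

locale centred_smooth_polytope =
  fixes P :: "(real^3) set" and c :: "real^3"
  assumes smooth: "smooth_polytope P" and reflect: "x \<in> P \<Longrightarrow> 2 *\<^sub>R c - x \<in> P" and nonempty: "P \<noteq> {}"
begin

lemma polytope: "polytope P" using smooth by (simp add: smooth_polytope_def simple_polytope_def)
lemma cpt: "compact P" and cvx: "convex P" using polytope polytope_imp_compact polytope_imp_convex by blast+
lemma fin: "finite {w. w extreme_point_of P}" using polytope finite_polyhedron_extreme_points polytope_imp_polyhedron by blast

lemma lattice: "w extreme_point_of P \<Longrightarrow> w \<in> int_lattice"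
  using smooth extreme_point_of_convex_hull unfolding smooth_polytope_def lattice_polytope_def by blast

lemma midpoint_centre: "x \<in> P \<Longrightarrow> c \<in> P"
proof -
  assume x: "x \<in> P"
  have "x + (1 / 2) *\<^sub>R ((2 *\<^sub>R c - x) - x) \<in> P" by (rule convex_step[OF cvx x]) (use reflect[OF x] in auto)
  moreover have "x + (1 / 2) *\<^sub>R ((2 *\<^sub>R c - x) - x) = c" by (simp add: scaleR_diff_right flip: scaleR_2)
  ultimately show ?thesis by simp
qed

lemma centre: "c \<in> P" using nonempty midpoint_centre by blast

text \<open>The reflection maps vertices to vertices, so \<open>2c\<close> is a sum of two lattice
points.\<close>
lemma centre_lattice: "2 *\<^sub>R c \<in> int_lattice"
proof -
  obtain v where v: "v extreme_point_of P" using extreme_point_exists_convex[OF cpt cvx nonempty] .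
  have "2 *\<^sub>R c - v extreme_point_of P"
  proof -
    have "2 *\<^sub>R c - v \<in> P" using v reflect by (simp add: extreme_point_of_def)
    moreover have False if ab: "a \<in> P" "b \<in> P" "2 *\<^sub>R c - v \<in> open_segment a b" for a b
    proof -
      obtain u where u: "a \<noteq> b" "0 < u" "u < 1" "2 *\<^sub>R c - v = (1 - u) *\<^sub>R a + u *\<^sub>R b" using ab(3) unfolding in_segment by blast
      have "v = (1 - u) *\<^sub>R (2 *\<^sub>R c - a) + u *\<^sub>R (2 *\<^sub>R c - b)"
      proof -
        have "(1 - u) *\<^sub>R (2 *\<^sub>R c - a) + u *\<^sub>R (2 *\<^sub>R c - b) = 2 *\<^sub>R c - ((1 - u) *\<^sub>R a + u *\<^sub>R b)"
          by (simp add: algebra_simps)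
        then show ?thesis unfolding u(4)[symmetric] by simp
      qed
      then have "v \<in> open_segment (2 *\<^sub>R c - a) (2 *\<^sub>R c - b)" unfolding in_segment using u by auto
      then show False using v reflect ab unfolding extreme_point_of_def by blast
    qed
    ultimately show ?thesis unfolding extreme_point_of_def by blast
  qed
  then have "2 *\<^sub>R c - v \<in> int_lattice" by (rule lattice)
  then have "(2 *\<^sub>R c - v) + v \<in> int_lattice" using lattice[OF v] by (rule int_lattice_closed(2))
  then show ?thesis by simp
qed

lemma corner_exists: "v extreme_point_of P \<Longrightarrow> \<exists>a b e f g h. corner P v a b e f g h"
  using smooth_corner[OF smooth] by metis

lemma exit_through_face:
  assumes z1: "z1 \<notin> P"
  obtains s v a b e f g h where "0 \<le> s" "s < 1" "v extreme_point_of P" "corner P v a b e f g h"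
    "c + s *\<^sub>R (z1 - c) \<in> P" "h (c + s *\<^sub>R (z1 - c) - v) = 0" "h (z1 - v) < 0"
proof -
  obtain ca cb ce cf cg ch where co: "\<And>w. w extreme_point_of P \<Longrightarrow> corner P w (ca w) (cb w) (ce w) (cf w) (cg w) (ch w)"
    using corner_exists by metis
  define C where "C = (\<lambda>w. {(cf w, ca w), (cg w, cb w), (ch w, ce w)})"
  obtain s w k u where sw: "0 \<le> s" "s < 1" "w extreme_point_of P" "(k, u) \<in> C w" "k (c + s *\<^sub>R (z1 - c) - w) = 0"
    "k (z1 - w) < 0" "c + s *\<^sub>R (z1 - c) \<in> P"
  proof (rule exit_through_facet[OF cpt cvx fin, of C c z1])
    show "finite (C w)" for w by (simp add: C_def)
    show "linear k \<and> w + u \<in> P \<and> (\<forall>x\<in>P. 0 \<le> k (x - w))" if "w extreme_point_of P" "(k, u) \<in> C w" for w k u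
      using co[OF that(1)] that(2) by (auto simp: C_def corner_def lattice_frame_def)
    show "c + s *\<^sub>R (z1 - c) - w = (\<Sum>(k, u)\<in>C w. k (c + s *\<^sub>R (z1 - c) - w) *\<^sub>R u)" if w: "w extreme_point_of P" for w s
    proof -
      have fr: "lattice_frame (ca w) (cb w) (ce w) (cf w) (cg w) (ch w)" using co[OF w] by (simp add: corner_def)
      show ?thesis using lattice_frameD(16)[OF fr, of "c + s *\<^sub>R (z1 - c) - w"] frame_independent(2-4)[OF fr]
        by (simp add: C_def add.assoc)
    qed
  qed (use z1 centre in auto)
  note co' = co[OF sw(3)]
  from sw(4) consider "k = cf w" | "k = cg w" | "k = ch w" by (auto simp: C_def)
  then show ?thesis
  proof cases
    case 1 show ?thesis by (rule that[OF sw(1,2,3) corner_rotate[OF co'] sw(7)]) (use sw 1 in auto)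
  next
    case 2 show ?thesis by (rule that[OF sw(1,2,3) corner_rotate[OF corner_rotate[OF co']] sw(7)]) (use sw 2 in auto)
  next
    case 3 show ?thesis by (rule that[OF sw(1,2,3) co' sw(7)]) (use sw 3 in auto)
  qed
qed

text \<open>The ray from \<open>c\<close> through \<open>x\<close> is followed to a point outside
\<open>P\<close>. It cannot leave \<open>P\<close> before \<open>x\<close>, since the functional
vanishing at the exit is negative from there on.\<close>
lemma ray_to_face:
  assumes x: "x \<in> P"
  obtains r y v a b e f g h where "0 \<le> r" "r \<le> 1" "x = c + r *\<^sub>R (y - c)" "y \<in> P" "v extreme_point_of P" "corner P v a b e f g h"
    "h (y - v) = 0"
proof -
  obtain v0 where v0: "v0 extreme_point_of P" using extreme_point_exists_convex[OF cpt cvx nonempty] .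
  obtain a0 b0 e0 f0 g0 h0 where c0: "corner P v0 a0 b0 e0 f0 g0 h0" using corner_exists[OF v0] by blast
  have "v0 \<in> P" "v0 + a0 \<in> P" "a0 \<noteq> 0" 
  proof -
    have fr: "lattice_frame a0 b0 e0 f0 g0 h0" using c0 by (simp add: corner_def)
    show "v0 \<in> P" "v0 + a0 \<in> P" using c0 by (simp_all add: corner_def)
    show "a0 \<noteq> 0" using lattice_frameD(7)[OF fr] linear_0[OF lattice_frameD(1)[OF fr]] by auto
  qed
  moreover from this(3) have "v0 \<noteq> c \<or> v0 + a0 \<noteq> c" by auto
  ultimately obtain x0 where x0: "x0 \<in> P" "x0 \<noteq> c" by blast
  \<comment> \<open>For \<open>x = c\<close> any direction will do.\<close>
  define x' where "x' = (if x = c then x0 else x)"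
  have x': "x' \<in> P" "x' \<noteq> c" using x x0 by (auto simp: x'_def)
  obtain B where B: "\<And>z. z \<in> P \<Longrightarrow> norm (z - c) \<le> B"
  proof -
    obtain B where "\<forall>z\<in>P. dist c z \<le> B" using compact_imp_bounded[OF cpt] bounded_any_center[of P c] by auto
    then show thesis using that[of B] by (simp add: dist_norm norm_minus_commute)
  qed
  define R where "R = (B + 1) / norm (x' - c)"
  have np: "0 < norm (x' - c)" using x' by simp
  have "1 \<le> R" unfolding R_def using B[OF x'(1)] np by (subst le_divide_eq_1_pos) auto
  then have R1: "1 \<le> R" "0 < R" by simp_all
  define z1 where "z1 = c + R *\<^sub>R (x' - c)"
  have "z1 \<notin> P"
  proof
    assume "z1 \<in> P"
    then have "norm (R *\<^sub>R (x' - c)) \<le> B" using B[of z1] by (simp add: z1_def)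
    moreover have "norm (R *\<^sub>R (x' - c)) = R * norm (x' - c)" using R1 by simp
    moreover have "\<dots> = B + 1" using np by (simp add: R_def)
    ultimately show False by simp
  qed
  then obtain s v a b e f g h where s: "0 \<le> s" "s < 1" and v: "v extreme_point_of P" and co: "corner P v a b e f g h"
    and y: "c + s *\<^sub>R (z1 - c) \<in> P" "h (c + s *\<^sub>R (z1 - c) - v) = 0" and neg: "h (z1 - v) < 0"
    using exit_through_face by blast
  have lin: "linear h" and pos: "\<And>x. x \<in> P \<Longrightarrow> 0 \<le> h (x - v)"
    using co unfolding corner_def lattice_frame_def by auto
  note aff = affine_on_line[OF lin, of c _ z1 v]
  have "x' = c + (1 / R) *\<^sub>R (z1 - c)" using R1 by (simp add: z1_def)
  then have "0 \<le> h (c - v) + (1 / R) * (h (z1 - v) - h (c - v))" using pos[OF x'(1)] aff[of "1 / R"] by simp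
  moreover have "h (c - v) + s * (h (z1 - v) - h (c - v)) = 0" using aff[of s] y(2) by simp
  moreover have hc: "0 \<le> h (c - v)" using pos[OF centre] .
  ultimately have "s * (h (z1 - v) - h (c - v)) \<le> (1 / R) * (h (z1 - v) - h (c - v))" by linarith
  then have "1 / R \<le> s"
    using mult_strict_right_mono_neg[of s "1 / R" "h (z1 - v) - h (c - v)"] neg hc by linarith
  then have sR: "1 \<le> s * R" using R1 by (simp add: field_simps)
  let ?y = "c + s *\<^sub>R (z1 - c)"
  have yc: "?y - c = (s * R) *\<^sub>R (x' - c)" by (simp add: z1_def)
  show ?thesis
  proof (cases "x = c")
    case True
    show ?thesis by (rule that[of 0 ?y, OF _ _ _ y(1) v co y(2)]) (use True in auto)
  next
    case False
    then have xx: "x' = x" by (simp add: x'_def)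
    have "s * R \<noteq> 0" using sR by linarith
    then have "x = c + (1 / (s * R)) *\<^sub>R (?y - c)" unfolding yc xx by simp
    then show ?thesis by (intro that[of "1 / (s * R)" ?y, OF _ _ _ y(1) v co y(2)]) (use sR in auto)
  qed
qed

end

section \<open>Facets are smooth polygons covered by unimodular triangles\<close>

lemma planar_corner_if_two:
  assumes co: "corner P w a1 a2 a3 k1 k2 k3" and h: "linear h" and F: "F = {x \<in> P. h (x - v) = 0}"
    and w: "w \<in> F" and h12: "h a1 = 0" "h a2 = 0" and h3: "h a3 \<noteq> 0"
  shows "planar_corner h F w a1 a2 k1 k2"
proof -
  have fr: "lattice_frame a1 a2 a3 k1 k2 k3" using co by (simp add: corner_def)
  have e: "w + a - v = (w - v) + a" for a by simp
  have "w + a1 \<in> F" "w + a2 \<in> F" using co w h h12 unfolding F mem_Collect_eq e corner_def by (auto simp: linear_add)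
  then show ?thesis unfolding planar_corner_def
    using planar_frame_of_frame[OF fr h h12 h3] co w by (auto simp: corner_def F)
qed

text \<open>If \<open>h\<close> is positive on two of the three basis vectors at \<open>w\<close>, then
the face \<open>h = 0\<close> is contained in the line through \<open>w\<close> in the third direction,
whereas \<open>v\<close>, \<open>v + a\<close>, \<open>v + b\<close> span a plane.\<close>
lemma at_most_one_direction_off_face:
  fixes f g h :: "real^3 \<Rightarrow> real"
  assumes co: "corner P w a1 a2 a3 k1 k2 k3" and h: "linear h" and F: "F = {x \<in> P. h (x - v) = 0}"
    and w: "w \<in> F" and pos: "0 < h a1" "0 < h a2" "0 \<le> h a3"
    and v: "v \<in> F" "v + a \<in> F" "v + b \<in> F" and f: "linear f" "linear g" "f a = 1" "f b = 0" "g b = (1::real)"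
  shows False
proof -
  have fr: "lattice_frame a1 a2 a3 k1 k2 k3" and nn: "\<And>x. x \<in> P \<Longrightarrow> 0 \<le> k1 (x - w) \<and> 0 \<le> k2 (x - w) \<and> 0 \<le> k3 (x - w)"
    using co by (auto simp: corner_def)
  have line: "x - w = k3 (x - w) *\<^sub>R a3" if "x \<in> F" for x
  proof -
    have "h (x - w) = h (x - v) - h (w - v)" using linear_diff[OF h, of "x - v" "w - v"] by simp
    then have "h (x - w) = 0" using that w unfolding F by simp
    then have "h (k1 (x - w) *\<^sub>R a1 + k2 (x - w) *\<^sub>R a2 + k3 (x - w) *\<^sub>R a3) = 0" unfolding lattice_frameD(16)[OF fr] .
    then have s: "k1 (x - w) * h a1 + k2 (x - w) * h a2 + k3 (x - w) * h a3 = 0" using h by (simp add: linear_add linear_scale)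
    have "0 \<le> k1 (x - w)" "0 \<le> k2 (x - w)" "0 \<le> k3 (x - w)" using nn that F by auto
    then have "0 \<le> k1 (x - w) * h a1" "0 \<le> k2 (x - w) * h a2" "0 \<le> k3 (x - w) * h a3" using pos by auto
    with s have "k1 (x - w) * h a1 = 0" "k2 (x - w) * h a2 = 0" by linarith+
    then have "k1 (x - w) = 0" "k2 (x - w) = 0" using pos by auto
    then show ?thesis using lattice_frameD(16)[OF fr, of "x - w"] by simp
  qed
  have "a = (v + a - w) - (v - w)" "b = (v + b - w) - (v - w)" by simp_all
  then have "a = (k3 (v + a - w) - k3 (v - w)) *\<^sub>R a3" "b = (k3 (v + b - w) - k3 (v - w)) *\<^sub>R a3"
    using line[OF v(1)] line[OF v(2)] line[OF v(3)] by (metis scaleR_left_diff_distrib)+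
  then obtain s t where a: "a = s *\<^sub>R a3" and b: "b = t *\<^sub>R a3" by blast
  have "f a = s * f a3" "f b = t * f a3" "g b = t * g a3" unfolding a b using f by (simp_all add: linear_scale)
  then show False using f by auto
qed

context centred_smooth_polytope
begin

text \<open>The functional has the value 1 at \<open>v + e\<close> and is nonnegative at its reflection,
so its value at the midpoint is at least \<open>1 / 2\<close>.\<close>
lemma corner_functional_pos:
  assumes co: "corner P v a b e f g h" shows "0 < h (c - v)"
proof -
  have fr: "lattice_frame a b e f g h" and q: "v + e \<in> P" and nn: "\<And>x. x \<in> P \<Longrightarrow> 0 \<le> h (x - v)" using co by (auto simp: corner_def)
  note D = lattice_frameD[OF fr]
  have "2 *\<^sub>R (c - v) = (2 *\<^sub>R c - (v + e) - v) + e" by (simp add: scaleR_diff_right flip: scaleR_2) (simp add: scaleR_2)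
  then have "h (2 *\<^sub>R (c - v)) = h (2 *\<^sub>R c - (v + e) - v) + h e" using D(3) by (simp only: linear_add)
  then have "2 * h (c - v) = h (2 *\<^sub>R c - (v + e) - v) + 1" using D(3,15) by (simp add: linear_scale)
  moreover have "0 \<le> h (2 *\<^sub>R c - (v + e) - v)" using nn[OF reflect[OF q]] .
  ultimately show ?thesis by simp
qed

end

text \<open>The facet is described by one of its vertices and the last functional of the corner there.
The third basis vector \<open>e\<close> thus leads to the lattice plane next to the facet.\<close>
locale facet = centred_smooth_polytope P c for P c +
  fixes v a b e :: "real^3" and f g h :: "real^3 \<Rightarrow> real" and F :: "(real^3) set"
  assumes v: "v extreme_point_of P" and co: "corner P v a b e f g h" and F_def: "F = {x \<in> P. h (x - v) = 0}"
begin

lemma frame_v: "lattice_frame a b e f g h" using co by (simp add: corner_def)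
lemmas Dv = lattice_frameD[OF frame_v]

lemma nonneg_h: "x \<in> P \<Longrightarrow> 0 \<le> h (x - v)" using co by (simp add: corner_def)

lemma corner_points: "v \<in> F" "v + a \<in> F" "v + b \<in> F"
  using co Dv linear_0 by (auto simp: corner_def F_def)

lemma face: "F face_of P"
proof -
  obtain l where l: "\<And>x. h x = l \<bullet> x"
  proof -
    have "x \<bullet> adjoint h 1 = h x \<bullet> 1" for x by (rule adjoint_works[OF Dv(3)])
    then show thesis by (intro that[of "adjoint h 1"]) (simp add: inner_commute)
  qed
  have "F = P \<inter> {x. l \<bullet> x = l \<bullet> v}" unfolding F_def l inner_diff_right by auto
  moreover have "l \<bullet> v \<le> l \<bullet> x" if "x \<in> P" for x using nonneg_h[OF that] unfolding l inner_diff_right by simp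
  ultimately show ?thesis using face_of_Int_supporting_hyperplane_ge[OF cvx] by simp
qed

text \<open>At every vertex of the facet two basis vectors lie in the facet. The third one has height 1,
since the lattice vector \<open>e\<close> of height 1 is an integral combination.\<close>
lemma face_corner:
  assumes we: "w extreme_point_of P" "w \<in> F"
  obtains a1 a2 a3 k1 k2 k3 where "corner P w a1 a2 a3 k1 k2 k3" "h a1 = 0" "h a2 = 0" "h a3 = 1"
proof -
  obtain a1 a2 a3 k1 k2 k3 where cw: "corner P w a1 a2 a3 k1 k2 k3" using corner_exists[OF we(1)] by blast
  note cw2 = corner_rotate[OF cw] note cw3 = corner_rotate[OF cw2]
  have e: "w + d - v = (w - v) + d" for d by simp
  have nn: "0 \<le> h d" if "w + d \<in> P" for d
    using nonneg_h[OF that] we(2) Dv(3) unfolding e F_def by (simp add: linear_add)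
  have n: "0 \<le> h a1" "0 \<le> h a2" "0 \<le> h a3" using nn cw by (auto simp: corner_def)
  note one = at_most_one_direction_off_face[OF _ Dv(3) F_def we(2) _ _ _ corner_points Dv(1) Dv(2) Dv(7) Dv(8) Dv(11)]
  have not2: "\<not> (0 < h a1 \<and> 0 < h a2)" "\<not> (0 < h a2 \<and> 0 < h a3)" "\<not> (0 < h a3 \<and> 0 < h a1)"
    using one[OF cw] one[OF cw2] one[OF cw3] n by blast+
  have unit: "h a3 = 1" if c: "corner P w a1 a2 a3 k1 k2 k3" "h a1 = 0" "h a2 = 0" "0 \<le> h a3" for a1 a2 a3 k1 k2 k3
  proof -
    have fr: "lattice_frame a1 a2 a3 k1 k2 k3" using c(1) by (simp add: corner_def)
    have "h (k1 e *\<^sub>R a1 + k2 e *\<^sub>R a2 + k3 e *\<^sub>R a3) = 1" unfolding lattice_frameD(16)[OF fr] by (rule Dv)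
    then have "k3 e * h a3 = 1" using c(2,3) Dv(3) by (simp add: linear_add linear_scale)
    moreover have "k3 e \<in> \<int>" "h a3 \<in> \<int>" using lattice_frameD(19)[OF fr Dv(6)] Dv(19)[OF lattice_frameD(6)[OF fr]] .
    ultimately show ?thesis using Ints_mult_eq_1[of "k3 e" "h a3"] c(4) by auto
  qed
  have "h a1 = 0 \<or> 0 < h a1" "h a2 = 0 \<or> 0 < h a2" "h a3 = 0 \<or> 0 < h a3" using n by linarith+
  with not2 consider "h a1 = 0" "h a2 = 0" | "h a2 = 0" "h a3 = 0" | "h a3 = 0" "h a1 = 0" by blast
  then show thesis
  proof cases
    case 1 show thesis by (rule that[OF cw 1 unit[OF cw 1 n(3)]])
  next
    case 2 show thesis by (rule that[OF cw2 2 unit[OF cw2 2 n(1)]])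
  next
    case 3 show thesis by (rule that[OF cw3 3 unit[OF cw3 3 n(2)]])
  qed
qed

lemma extreme_of_face: assumes "w extreme_point_of F" shows "w extreme_point_of P" "w \<in> F"
  using assms extreme_point_of_face[OF face] by blast+

lemma face_polygon: "smooth_polygon h F"
proof (rule smooth_polygon.intro)
  show "linear h" by (rule Dv)
  show "compact F" by (rule face_of_imp_compact[OF cvx cpt face])
  show "convex F" by (rule face_of_imp_convex[OF face])
  show "h (x - y) = 0" if "x \<in> F" "y \<in> F" for x y
  proof -
    have "h (x - y) = h (x - v) - h (y - v)" using linear_diff[OF Dv(3), of "x - v" "y - v"] by simp
    then show ?thesis using that unfolding F_def by simp
  qed
  show "finite {w. w extreme_point_of F}" by (rule finite_subset[OF _ fin]) (use extreme_of_face in blast)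
  show "w \<in> int_lattice" if "w extreme_point_of F" for w using lattice[OF extreme_of_face(1)[OF that]] .
  show "\<exists>a b g k. planar_corner h F w a b g k" if we: "w extreme_point_of F" for w
  proof -
    note ex = extreme_of_face[OF we]
    obtain a1 a2 a3 k1 k2 k3 where cw: "corner P w a1 a2 a3 k1 k2 k3" and h: "h a1 = 0" "h a2 = 0" "h a3 = 1"
      using face_corner[OF ex] .
    have "h a3 \<noteq> 0" using h by simp
    then show ?thesis using planar_corner_if_two[OF cw Dv(3) F_def ex(2) h(1,2)] by blast
  qed
qed

sublocale poly: smooth_polygon h F by (rule face_polygon)

text \<open>The descent is applied to the pyramid over the facet with apex \<open>v + e\<close>. The
apex is its only lattice point outside the facet, so a nondegenerate tetrahedron has exactly one vertex
at height 1. Weights with a lattice point as weighted sum are therefore integral at this vertex, and the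
case of positive weights of sum 2 does not occur. The face opposite to the apex of the resulting
unimodular tetrahedron is the triangle.\<close>
lemma unimodular_triangle_in_face:
  assumes y: "y \<in> F"
  obtains v0 v1 v2 X Y where "triangle_in_polygon h F v0 v1 v2 X Y" "y \<in> convex hull {v0, v1, v2}"
proof -
  let ?q = "v + e"
  let ?Q = "convex hull (insert ?q F)"
  define W where "W = {w. w extreme_point_of F} \<union> {v, v + a, v + b, ?q}"
  have vL: "v \<in> int_lattice" by (rule lattice[OF v])
  have Wl: "W \<subseteq> int_lattice" unfolding W_def using poly.lattice vL Dv(4-6) by (auto intro: int_lattice_closed)
  have "{w. w extreme_point_of F} \<subseteq> F" by (auto simp: extreme_point_of_def)
  then have "W \<subseteq> insert ?q F" unfolding W_def using corner_points by blast
  then have WQ: "W \<subseteq> ?Q" using hull_subset[of "insert ?q F" convex] by (rule order_trans)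
  have Qh: "\<exists>u z. 0 \<le> u \<and> u \<le> 1 \<and> z \<in> F \<and> x = u *\<^sub>R ?q + (1 - u) *\<^sub>R z" if "x \<in> ?Q" for x
  proof -
    have "F \<noteq> {}" using y by blast
    have "\<exists>u\<ge>0. \<exists>w\<ge>0. \<exists>z. u + w = 1 \<and> z \<in> convex hull F \<and> x = u *\<^sub>R ?q + w *\<^sub>R z"
      using that unfolding convex_hull_insert[OF \<open>F \<noteq> {}\<close>] mem_Collect_eq .
    then obtain u where u: "0 \<le> u" "\<exists>w\<ge>0. \<exists>z. u + w = 1 \<and> z \<in> convex hull F \<and> x = u *\<^sub>R ?q + w *\<^sub>R z" by blast
    from u(2) obtain w where w: "0 \<le> w" "\<exists>z. u + w = 1 \<and> z \<in> convex hull F \<and> x = u *\<^sub>R ?q + w *\<^sub>R z" by blast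
    from w(2) obtain z where "u + w = 1" "z \<in> convex hull F" "x = u *\<^sub>R ?q + w *\<^sub>R z" by blast
    moreover have "convex hull F = F" using poly.cvx by (simp add: hull_same)
    moreover have "w = 1 - u" using \<open>u + w = 1\<close> by simp
    ultimately show ?thesis using u(1) w(1) by (intro exI[of _ u] exI[of _ z]) simp
  qed
  have Qrow: "(h (x - v) = 0 \<longrightarrow> x \<in> F) \<and> (h (x - v) = 1 \<longrightarrow> x = ?q) \<and> 0 \<le> h (x - v) \<and> h (x - v) \<le> 1" if x: "x \<in> ?Q" for x
  proof -
    obtain u z where u: "0 \<le> u" "u \<le> 1" "z \<in> F" "x = u *\<^sub>R ?q + (1 - u) *\<^sub>R z" using Qh[OF x] by blast
    have "x - v = u *\<^sub>R e + (1 - u) *\<^sub>R (z - v)" unfolding u(4) by (simp add: algebra_simps)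
    then have "h (x - v) = u * h e + (1 - u) * h (z - v)" using Dv(3) by (simp only: linear_add linear_scale real_scaleR_def)
    then have "h (x - v) = u" using Dv(15) u(3) by (simp add: F_def)
    then show ?thesis using u by auto
  qed
  have level: "h (x - v) = 0 \<and> x \<in> F \<or> h (x - v) = 1 \<and> x = ?q" if "x \<in> ?Q \<inter> int_lattice" for x
  proof -
    have x: "x \<in> ?Q" "x \<in> int_lattice" using that by auto
    have "h (x - v) \<in> \<int>" using Dv(19)[OF int_lattice_closed(3)[OF x(2) vL]] .
    then have "h (x - v) = 0 \<or> h (x - v) = 1" using Qrow[OF x(1)] by (auto elim!: Ints_cases)
    then show ?thesis using Qrow[OF x(1)] by blast
  qed
  have "F = convex hull {w. w extreme_point_of F}" by (rule Krein_Milman_Minkowski[OF poly.cpt poly.cvx])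
  then have yW: "y \<in> convex hull W" using y hull_mono[of "{w. w extreme_point_of F}" W] by (auto simp: W_def)
  obtain t where t: "\<forall>i<4. t i \<in> ?Q \<inter> int_lattice" "unimodular_vertices t" "y \<in> convex hull (t ` {..<4})" and tet: "tet t \<noteq> 0"
  proof (rule unimodular_descent[OF yW, of ?Q "(\<lambda>_. v)(1 := v + a, 2 := v + b, 3 := ?q)"])
    show "W \<subseteq> ?Q \<inter> int_lattice" using WQ Wl by blast
    show "\<forall>i<4. ((\<lambda>_. v)(1 := v + a, 2 := v + b, 3 := ?q)) i \<in> W" by (auto simp: W_def)
    show "tet ((\<lambda>_. v)(1 := v + a, 2 := v + b, 3 := ?q)) \<noteq> 0" using frame_det3[OF frame_v] by (simp add: tet_def)
    show "convex ?Q" by (rule convex_convex_hull)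
  next
    fix p s assume p: "\<forall>i<4. p i \<in> ?Q \<inter> int_lattice" "tet p \<noteq> 0" and s: "\<forall>i<4. 0 < s i \<and> s i < 1" "sum s {..<4} = 2" "bary s p \<in> int_lattice"
    obtain i where i: "i < 4" "h (p i - v) \<noteq> 0" using tet_not_flat[OF p(2) Dv(3), of v 0 e] Dv(15) by auto
    have only: "h (p j - v) = 0" if "j < 4" "j \<noteq> i" for j
    proof (rule ccontr)
      assume "h (p j - v) \<noteq> 0"
      then have "p j = ?q" "p i = ?q" using level p(1) that(1) i by blast+
      then show False using tet_inj[OF p(2) that(1) i(1)] that(2) by simp
    qed
    have "bary s p - 2 *\<^sub>R v \<in> int_lattice" using s(3) vL by (intro int_lattice_closed(3,5)) auto
    then have "h (bary s p - 2 *\<^sub>R v) \<in> \<int>" by (rule Dv(19))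
    moreover have "bary s p - 2 *\<^sub>R v = (\<Sum>j<4. s j *\<^sub>R (p j - v))"
      by (simp add: bary_def scaleR_diff_right sum_subtractf scaleR_sum_left[symmetric] s(2))
    then have "h (bary s p - 2 *\<^sub>R v) = (\<Sum>j<4. s j * h (p j - v))" using Dv(3) by (simp add: linear_sum linear_scale)
    also have "\<dots> = (\<Sum>j<4. if j = i then s j else 0)" using only level[of "p i"] p(1) i by (intro sum.cong) auto
    also have "\<dots> = s i" using i(1) by simp
    ultimately have "s i \<in> \<int>" by simp
    then have False using s(1) i(1) by (auto elim!: Ints_cases)
    then show "\<exists>c. (\<forall>i<4. c i < 1) \<and> sum c {..<4} = 1 \<and> bary c p \<in> ?Q \<inter> int_lattice" ..
  next
    fix p assume p: "\<forall>i<4. p i \<in> ?Q \<inter> int_lattice" "unimodular_vertices p" "y \<in> convex hull (p ` {..<4})"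
    have "tet p \<noteq> 0"
    proof -
      obtain f' g' h' where "lattice_frame (p 1 - p 0) (p 2 - p 0) (p 3 - p 0) f' g' h'"
        using lattice_basis_frame p(2) unfolding unimodular_vertices_def by blast
      then show ?thesis unfolding tet_def by (rule frame_det3)
    qed
    with p show thesis by (rule that)
  qed
  have ht: "h (t i - v) = 0 \<and> t i \<in> F \<or> h (t i - v) = 1 \<and> t i = ?q" if "i < 4" for i
    using level t(1) that by blast
  obtain i where i: "i < 4" "h (t i - v) = 1" using tet_not_flat[OF tet Dv(3), of v 0 e] Dv(15) ht by fastforce
  have tF: "t j \<in> F" "h (t j - v) = 0" if "j < 4" "j \<noteq> i" for j
    using ht[OF that(1)] ht[OF i(1)] i(2) tet_inj[OF tet that(1) i(1)] that(2) by auto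
  have hull: "y \<in> convex hull (t ` ({..<4} - {i}))"
  proof -
    obtain k where k: "\<forall>j<4. 0 \<le> k j" "sum k {..<4} = 1" "bary k t = y" using t(3) unfolding convex_hull_tet by blast
    have "h (y - v) = (\<Sum>j<4. k j * h (t j - v))" using linear_bary[OF Dv(3) k(2), of t v] unfolding k(3) .
    also have "\<dots> = (\<Sum>j<4. if j = i then k j else 0)" using tF i(2) by (intro sum.cong) auto
    also have "\<dots> = k i" using i(1) by simp
    finally have ki: "k i = 0" using y by (simp add: F_def)
    have "y = (\<Sum>j\<in>{..<4} - {i}. k j *\<^sub>R t j)" using k(3) sum_remove_index[OF i(1), of "\<lambda>j. k j *\<^sub>R t j"] ki by (simp add: bary_def)
    moreover have "sum k ({..<4} - {i}) = 1" using k(2) sum_remove_index[OF i(1), of k] ki by simp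
    moreover have "(\<Sum>j\<in>{..<4} - {i}. k j *\<^sub>R t j) \<in> convex hull (t ` ({..<4} - {i}))" if "sum k ({..<4} - {i}) = 1"
      using k(1) that by (intro convex_sum[OF _ convex_convex_hull]) (auto intro: hull_inc)
    ultimately show ?thesis by simp
  qed
  obtain f' g' h' where tfr: "lattice_frame (t 1 - t 0) (t 2 - t 0) (t 3 - t 0) f' g' h'"
    using lattice_basis_frame t(2) unfolding unimodular_vertices_def by blast
  have hd: "h (t j - t k) = h (t j - v) - h (t k - v)" for j k
    using linear_diff[OF Dv(3), of "t j - v" "t k - v"] by simp
  have tL: "\<And>j. j < 4 \<Longrightarrow> t j \<in> int_lattice" using t(1) by blast
  have result: thesis if "planar_frame h (t k - t j) (t l - t j) X Y" "{..<4} - {i} = {j, k, l}" for j k l X Y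
  proof -
    have "j \<in> {..<4} - {i}" "k \<in> {..<4} - {i}" "l \<in> {..<4} - {i}" unfolding that(2) by auto
    then have m: "t j \<in> F" "t k \<in> F" "t l \<in> F" "t j \<in> int_lattice" using tF tL by auto
    have "triangle_in_polygon h F (t j) (t k) (t l) X Y" using m that(1) by unfold_locales
    moreover have "y \<in> convex hull {t j, t k, t l}" using hull unfolding that(2) by simp
    ultimately show thesis by (rule \<open>\<And>v0 v1 v2 X Y. triangle_in_polygon h F v0 v1 v2 X Y \<Longrightarrow> y \<in> convex hull {v0, v1, v2} \<Longrightarrow> thesis\<close>)
  qed
  consider "i = 0" | "i = 1" | "i = 2" | "i = 3" using i(1) by linarith
  then show thesis
  proof cases
    case 1
    have "planar_frame h (t 2 - t 1) (t 3 - t 1) g' h'"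
      by (rule planar_frame_of_apex[OF tfr Dv(3)]) (use tF i 1 in \<open>simp_all add: hd\<close>)
    then show thesis by (rule result) (auto simp: 1)
  next
    case 2
    have "planar_frame h (t 2 - t 0) (t 3 - t 0) g' h'"
      by (rule planar_frame_of_frame[OF lattice_frame_rotate[OF tfr] Dv(3)]) (use tF i 2 in \<open>simp_all add: hd\<close>)
    then show thesis by (rule result) (auto simp: 2)
  next
    case 3
    have "planar_frame h (t 3 - t 0) (t 1 - t 0) h' f'"
      by (rule planar_frame_of_frame[OF lattice_frame_rotate[OF lattice_frame_rotate[OF tfr]] Dv(3)]) (use tF i 3 in \<open>simp_all add: hd\<close>)
    then show thesis by (rule result) (auto simp: 3)
  next
    case 4
    have "planar_frame h (t 1 - t 0) (t 2 - t 0) f' g'"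
      by (rule planar_frame_of_frame[OF tfr Dv(3)]) (use tF i 4 in \<open>simp_all add: hd\<close>)
    then show thesis by (rule result) (auto simp: 4)
  qed
qed

end

section \<open>Lattice frustums over a unimodular triangle\<close>

lemma convex_combination_3:
  assumes "convex C" "x \<in> C" "y \<in> C" "z \<in> C" "0 \<le> p" "0 \<le> q" "0 \<le> r" "p + q + r = 1"
  shows "p *\<^sub>R x + q *\<^sub>R y + r *\<^sub>R z \<in> C"
proof -
  have "convex hull {x, y, z} \<subseteq> C" using assms(1-4) by (intro hull_minimal) auto
  moreover have "p *\<^sub>R x + q *\<^sub>R y + r *\<^sub>R z \<in> convex hull {x, y, z}"
    unfolding convex_hull_3 using assms(5-8) by blast
  ultimately show ?thesis by blast
qed

lemma index_split3:
  assumes "m < 3" "n < 3" "m \<noteq> (n::nat)"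
  obtains p where "p < 3" "p \<noteq> m" "p \<noteq> n" "\<And>k. k < 3 \<Longrightarrow> k = m \<or> k = n \<or> k = p"
    "\<And>w :: nat \<Rightarrow> real. w 0 + w 1 + w 2 = w m + w n + w p"
proof -
  have mn: "m = 0 \<or> m = 1 \<or> m = 2" "n = 0 \<or> n = 1 \<or> n = 2" using assms by linarith+
  have "\<exists>p<3. p \<noteq> m \<and> p \<noteq> n \<and> (\<forall>k<3. k = m \<or> k = n \<or> k = p) \<and> (\<forall>w :: nat \<Rightarrow> real. w 0 + w 1 + w 2 = w m + w n + w p)"
  proof -
    have less3: "k < 3 \<longleftrightarrow> k = 0 \<or> k = 1 \<or> k = 2" for k :: nat by linarith
    have "m = 0 \<and> n = 1 \<or> m = 1 \<and> n = 0 \<or> m = 0 \<and> n = 2 \<or> m = 2 \<and> n = 0 \<or> m = 1 \<and> n = 2 \<or> m = 2 \<and> n = 1"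
      using mn assms(3) by auto
    then show ?thesis
      by (elim disjE) (rule exI[of _ 2], simp add: less3, rule exI[of _ 2], simp add: less3, 
        rule exI[of _ 1], simp add: less3, rule exI[of _ 1], simp add: less3,
        rule exI[of _ 0], simp add: less3, rule exI[of _ 0], simp add: less3)
  qed
  then show ?thesis using that by blast
qed

text \<open>The bottom of the frustum is the unimodular triangle \<open>v\<close>, \<open>v + a\<close>,
\<open>v + b\<close> at height 0, and the top is a triangle with \<open>1 + K\<close> times its size at
height 1.\<close>
locale frustum =
  fixes v a b e :: "real^3" and f g h :: "real^3 \<Rightarrow> real" and K :: real
  assumes fr: "lattice_frame a b e f g h" and vL: "v \<in> int_lattice" and K: "0 \<le> K" "K \<in> \<int>"
begin

lemmas D = lattice_frameD[OF fr]

text \<open>The side functions of the frustum, of sum \<open>1 + K * height\<close>.\<close>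
definition \<phi> :: "nat \<Rightarrow> real^3 \<Rightarrow> real" where
  "\<phi> k x = (if k = 0 then f (x - v) else if k = 1 then g (x - v) else 1 + K * h (x - v) - f (x - v) - g (x - v))"

definition Q :: "(real^3) set" where
  "Q = {x. 0 \<le> h (x - v) \<and> h (x - v) \<le> 1 \<and> (\<forall>k<3. 0 \<le> \<phi> k x)}"

definition vertices :: "(real^3) set" where
  "vertices = {v, v + a, v + b, v + e, v + e + (1 + K) *\<^sub>R a, v + e + (1 + K) *\<^sub>R b}"

lemma \<phi>_simps: "\<phi> 0 x = f (x - v)" "\<phi> 1 x = g (x - v)" "\<phi> 2 x = 1 + K * h (x - v) - f (x - v) - g (x - v)"
  by (simp_all add: \<phi>_def)

lemma all_less_3: "(\<forall>k<3. R k) \<longleftrightarrow> R 0 \<and> R 1 \<and> R (2::nat)"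
proof -
  have "k < 3 \<longleftrightarrow> k = 0 \<or> k = 1 \<or> k = 2" for k :: nat by linarith
  then show ?thesis by auto
qed

lemma \<phi>_sum: "\<phi> 0 x + \<phi> 1 x + \<phi> 2 x = 1 + K * h (x - v)" by (simp add: \<phi>_simps)

lemma h_bary: "sum c {..<4} = 1 \<Longrightarrow> h (bary c w - v) = (\<Sum>i<4. c i * h (w i - v))"
  by (rule linear_bary[OF D(3)])

lemma \<phi>_bary:
  assumes c: "sum c {..<4} = 1" shows "\<phi> k (bary c w) = (\<Sum>i<4. c i * \<phi> k (w i))"
proof -
  note lb = linear_bary[OF D(1) c, of w v] linear_bary[OF D(2) c, of w v] linear_bary[OF D(3) c, of w v]
  have "(\<Sum>i<4. c i * (1 + K * h (w i - v) - f (w i - v) - g (w i - v))) =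
    sum c {..<4} + K * (\<Sum>i<4. c i * h (w i - v)) - (\<Sum>i<4. c i * f (w i - v)) - (\<Sum>i<4. c i * g (w i - v))"
    by (simp add: sum_lessThan_4 algebra_simps)
  then show ?thesis using c lb by (simp add: \<phi>_def)
qed

lemma \<phi>_Ints: "x \<in> int_lattice \<Longrightarrow> \<phi> k x \<in> \<int>"
  using D(17-19)[OF int_lattice_closed(3)[OF _ vL]] K by (auto simp: \<phi>_def)

lemma convex_Q: "convex Q"
proof (rule convexI)
  fix x y :: "real^3" and p q :: real
  assume xy: "x \<in> Q" "y \<in> Q" and pq: "0 \<le> p" "0 \<le> q" "p + q = 1"
  have e: "p *\<^sub>R x + q *\<^sub>R y - v = p *\<^sub>R (x - v) + q *\<^sub>R (y - v)"
    using arg_cong[OF pq(3), of "\<lambda>r. r *\<^sub>R v"] by (simp add: algebra_simps)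
  have l: "l (p *\<^sub>R x + q *\<^sub>R y - v) = p * l (x - v) + q * l (y - v)" if "linear l" for l :: "real^3 \<Rightarrow> real"
    unfolding e using that by (simp add: linear_add linear_scale)
  have "\<phi> k (p *\<^sub>R x + q *\<^sub>R y) = p * \<phi> k x + q * \<phi> k y" for k
  proof -
    have "p = 1 - q" using pq by simp
    then show ?thesis unfolding \<phi>_def l[OF D(1)] l[OF D(2)] l[OF D(3)] by (simp add: algebra_simps)
  qed
  moreover have "p * h (x - v) + q * h (y - v) \<le> 1"
    using convex_bound_le[of "h (x - v)" 1 "h (y - v)" p q] xy pq by (simp add: Q_def)
  ultimately show "p *\<^sub>R x + q *\<^sub>R y \<in> Q" using xy pq unfolding Q_def mem_Collect_eq l[OF D(3)] by simp
qed

lemma vertices_Q: "vertices \<subseteq> Q"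
proof -
  have "1 + K - (1 + K) = 0" by simp
  then show ?thesis using D(1-3) K unfolding vertices_def insert_subset Q_def all_less_3 \<phi>_simps mem_Collect_eq
    by (simp add: linear_0 linear_add linear_scale D(7-15) add.assoc)
qed

lemma vertices_lattice: "vertices \<subseteq> int_lattice"
  unfolding vertices_def insert_subset using vL D(4-6) K
  by (auto intro!: int_lattice_closed(2) int_lattice_closed(5))

text \<open>A point at height \<open>\<gamma>\<close> is a convex combination of three points on the
slanted edges, with weights \<open>\<phi> k x / (1 + K * \<gamma>)\<close>.\<close>
lemma Q_hull: "Q \<subseteq> convex hull vertices"
proof
  fix x assume x: "x \<in> Q"
  define \<alpha> \<beta> \<gamma> where abc: "\<alpha> = f (x - v)" "\<beta> = g (x - v)" "\<gamma> = h (x - v)"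
  have xe: "x = v + \<alpha> *\<^sub>R a + \<beta> *\<^sub>R b + \<gamma> *\<^sub>R e" using D(16)[of "x - v"] unfolding abc by (simp add: add.assoc)
  have r: "0 \<le> \<alpha>" "0 \<le> \<beta>" "0 \<le> \<gamma>" "\<gamma> \<le> 1" "0 \<le> 1 + K * \<gamma> - \<alpha> - \<beta>"
    using x unfolding Q_def all_less_3 \<phi>_simps by (simp_all add: abc)
  define M where "M = 1 + K * \<gamma>"
  have M: "0 < M" using K r by (simp add: M_def add_pos_nonneg)
  let ?C = "convex hull vertices"
  have vert: "p \<in> ?C" if "p \<in> vertices" for p using that by (rule hull_inc)
  have R: "v + \<gamma> *\<^sub>R e \<in> ?C" "v + a + \<gamma> *\<^sub>R (e + K *\<^sub>R a) \<in> ?C" "v + b + \<gamma> *\<^sub>R (e + K *\<^sub>R b) \<in> ?C"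
    by (rule convex_step[OF convex_convex_hull]; (rule vert)?; use r in \<open>simp add: vertices_def algebra_simps\<close>)+
  have "((1 + K * \<gamma> - \<alpha> - \<beta>) / M) *\<^sub>R (v + \<gamma> *\<^sub>R e) + (\<alpha> / M) *\<^sub>R (v + a + \<gamma> *\<^sub>R (e + K *\<^sub>R a))
     + (\<beta> / M) *\<^sub>R (v + b + \<gamma> *\<^sub>R (e + K *\<^sub>R b)) \<in> ?C" (is "?s \<in> _")
  proof (rule convex_combination_3)
    show "convex ?C" by (rule convex_convex_hull)
    show "(1 + K * \<gamma> - \<alpha> - \<beta>) / M + \<alpha> / M + \<beta> / M = 1" using M unfolding M_def by (simp add: add_divide_distrib[symmetric])
  qed (use R r M in auto)
  moreover have "?s = x"
  proof -
    have "M *\<^sub>R ?s = M *\<^sub>R x"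
    proof -
      have "M *\<^sub>R ?s = (M - \<alpha> - \<beta>) *\<^sub>R (v + \<gamma> *\<^sub>R e) + \<alpha> *\<^sub>R (v + a + \<gamma> *\<^sub>R (e + K *\<^sub>R a)) + \<beta> *\<^sub>R (v + b + \<gamma> *\<^sub>R (e + K *\<^sub>R b))"
        using M by (simp add: scaleR_add_right M_def)
      also have "\<dots> = M *\<^sub>R x" unfolding xe M_def by (simp add: algebra_simps)
      finally show ?thesis .
    qed
    then show ?thesis using M by simp
  qed
  ultimately show "x \<in> ?C" by simp
qed

lemma eq_if_\<phi>_eq:
  assumes "\<And>k. k < 3 \<Longrightarrow> \<phi> k x = \<phi> k y" "h (x - v) = h (y - v)" shows "x = y"
proof -
  have fg: "f (x - v) = f (y - v)" "g (x - v) = g (y - v)" using assms(1)[of 0] assms(1)[of 1] by (simp_all add: \<phi>_simps)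
  have "x - v = f (x - v) *\<^sub>R a + g (x - v) *\<^sub>R b + h (x - v) *\<^sub>R e" by (rule D(16)[symmetric])
  also have "\<dots> = y - v" unfolding fg assms(2) by (rule D(16))
  finally show ?thesis by simp
qed

lemma bottom_index:
  assumes "x \<in> Q" "x \<in> int_lattice" "h (x - v) = 0"
  obtains m where "m < 3" "\<phi> m x = 1" "\<And>k. k < 3 \<Longrightarrow> k \<noteq> m \<Longrightarrow> \<phi> k x = 0"
proof -
  have I: "\<phi> 0 x \<in> \<int>" "\<phi> 1 x \<in> \<int>" "\<phi> 2 x \<in> \<int>" by (rule \<phi>_Ints[OF assms(2)])+
  have n: "0 \<le> \<phi> 0 x" "0 \<le> \<phi> 1 x" "0 \<le> \<phi> 2 x" and s: "\<phi> 0 x + \<phi> 1 x + \<phi> 2 x = 1"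
    using assms(1,3) \<phi>_sum[of x] unfolding Q_def all_less_3 by auto
  obtain i j k :: int where ijk: "\<phi> 0 x = i" "\<phi> 1 x = j" "\<phi> 2 x = k" using I by (auto elim!: Ints_cases)
  have "0 \<le> i" "0 \<le> j" "0 \<le> k" "i + j + k = 1" using n s unfolding ijk by linarith+
  then consider "i = 1" "j = 0" "k = 0" | "i = 0" "j = 1" "k = 0" | "i = 0" "j = 0" "k = 1" by linarith
  then show thesis
  proof cases
    case 1 show thesis by (rule that[of 0]) (use ijk 1 in \<open>auto simp: less_Suc_eq numeral_3_eq_3 One_nat_def numeral_2_eq_2\<close>)
  next
    case 2 show thesis by (rule that[of 1]) (use ijk 2 in \<open>auto simp: less_Suc_eq numeral_3_eq_3 One_nat_def numeral_2_eq_2\<close>)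
  next
    case 3 show thesis by (rule that[of 2]) (use ijk 3 in \<open>auto simp: less_Suc_eq numeral_3_eq_3 One_nat_def numeral_2_eq_2\<close>)
  qed
qed

text \<open>The heights of the vertices are 0 or 1 and their weighted sum is an integer. As the weights
lie in \<open>(0, 1)\<close>, two vertices \<open>w\<^sub>i\<close>, \<open>w\<^sub>k\<close> are at the
bottom and two, \<open>w\<^sub>j\<close> and \<open>w\<^sub>l\<close>, at the top, and each pair has the
weights \<open>t\<close> and \<open>1 - t\<close> for some \<open>t\<close>. The candidates \<open>s -
w\<^sub>i\<close> and \<open>s - w\<^sub>k\<close> have height 1.

The bottom vertices are unit vectors in the side functions, say in positions \<open>m\<close> and
\<open>n\<close>. With \<open>B\<close> denoting the weighted contribution of the two top vertices, the
only side function of \<open>s - w\<^sub>i\<close> that can be negative is number \<open>m\<close>, with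
the value \<open>B\<^sub>m - t\<^sub>k\<close>, and the only one of \<open>s - w\<^sub>k\<close> is
number \<open>n\<close>, with the value \<open>B\<^sub>n - t\<^sub>i\<close>. If both are negative, then
\<open>B\<^sub>m + B\<^sub>n < 1\<close>, so the integer \<open>B\<^sub>p\<close> is the whole sum
\<open>1 + K\<close>. Then both top vertices are the top corner in position \<open>p\<close>, which is
impossible.\<close>
lemma frustum_step:
  assumes w: "\<forall>i<4. w i \<in> Q \<inter> int_lattice" "tet w \<noteq> 0" and t: "\<forall>i<4. 0 < t i \<and> t i < 1" "sum t {..<4} = 2" "bary t w \<in> int_lattice"
  shows "\<exists>j<4. bary (drop_vertex t j) w \<in> Q"
proof -
  define H where "H = (\<lambda>i. h (w i - v))"
  have wQ: "w i \<in> Q" "w i \<in> int_lattice" if "i < 4" for i using w(1) that by auto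
  have H01: "H i = 0 \<or> H i = 1" if "i < 4" for i
  proof -
    have "H i \<in> \<int>" unfolding H_def using D(19)[OF int_lattice_closed(3)[OF wQ(2)[OF that] vL]] .
    moreover have "0 \<le> H i" "H i \<le> 1" using wQ(1)[OF that] by (auto simp: Q_def H_def)
    ultimately show ?thesis by (auto elim!: Ints_cases)
  qed
  have sumH: "(\<Sum>i<4. t i * H i) \<in> \<int>"
  proof -
    have "bary t w - 2 *\<^sub>R v \<in> int_lattice" using t(3) vL by (intro int_lattice_closed(3,5)) auto
    then have "h (bary t w - 2 *\<^sub>R v) \<in> \<int>" by (rule D(19))
    moreover have "bary t w - 2 *\<^sub>R v = (\<Sum>j<4. t j *\<^sub>R (w j - v))"
      by (simp add: bary_def scaleR_diff_right sum_subtractf scaleR_sum_left[symmetric] t(2))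
    then have "h (bary t w - 2 *\<^sub>R v) = (\<Sum>j<4. t j * H j)" using D(3) by (simp add: linear_sum linear_scale H_def)
    ultimately show ?thesis by simp
  qed
  have "\<exists>i<4. H i = 0" "\<exists>j<4. H j = 1"
    using tet_not_flat[OF w(2) D(3), of v 1 0] tet_not_flat[OF w(2) D(3), of v 0 e] tet_not_flat[OF w(2) D(3), of v 1 e] H01 D(15) unfolding H_def by (metis zero_neq_one)+
  then obtain i j where ij: "i < 4" "H i = 0" "j < 4" "H j = 1" by blast
  then have "i \<noteq> j" by auto
  obtain k l where kl: "k < 4" "l < 4" "k \<noteq> i" "k \<noteq> j" "l \<noteq> i" "l \<noteq> j" "k \<noteq> l"
    and sum4: "\<And>u :: nat \<Rightarrow> real. sum u {..<4} = u i + u j + u k + u l"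
    using index_split2[OF ij(1,3) \<open>i \<noteq> j\<close>] by metis
  have ti: "0 < t i" "t i < 1" "0 < t j" "t j < 1" "0 < t k" "t k < 1" "0 < t l" "t l < 1" using t(1) ij kl by auto
  have t2: "t i + t j + t k + t l = 2" using t(2) sum4 by simp
  have main: ?thesis if kl: "k < 4" "l < 4" "k \<noteq> i" "l \<noteq> j" "k \<noteq> l" and H: "H k = 0" "H l = 1"
    and sum4: "\<And>u :: nat \<Rightarrow> real. sum u {..<4} = u i + u j + u k + u l" for k l
  proof -
    have ti: "0 < t i" "t i < 1" "0 < t j" "t j < 1" "0 < t k" "t k < 1" "0 < t l" "t l < 1" using t(1) ij kl by auto
    have t2: "t i + t j + t k + t l = 2" using t(2) sum4 by simp
    have "t j + t l \<in> \<int>" using sumH ij H by (simp add: sum4)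
    then have tjl: "t j + t l = 1" using ti by (auto elim!: Ints_cases)
    then have tik: "t i + t k = 1" using t2 by simp
    obtain m where m: "m < 3" "\<phi> m (w i) = 1" "\<And>k. k < 3 \<Longrightarrow> k \<noteq> m \<Longrightarrow> \<phi> k (w i) = 0"
      using bottom_index[OF wQ[OF ij(1)]] ij(2) unfolding H_def by blast
    obtain n where n: "n < 3" "\<phi> n (w k) = 1" "\<And>q. q < 3 \<Longrightarrow> q \<noteq> n \<Longrightarrow> \<phi> q (w k) = 0"
      using bottom_index[OF wQ[OF kl(1)]] H(1) unfolding H_def by blast
    have mn: "m \<noteq> n"
    proof
      assume "m = n"
      then have "\<phi> q (w i) = \<phi> q (w k)" if "q < 3" for q using m n that by (cases "q = m") auto
      then have "w i = w k" using ij(2) H(1) by (intro eq_if_\<phi>_eq) (auto simp: H_def)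
      then show False using tet_inj[OF w(2) ij(1) kl(1)] kl(3) by simp
    qed
    obtain p where p: "p < 3" "p \<noteq> m" "p \<noteq> n" "\<And>q. q < 3 \<Longrightarrow> q = m \<or> q = n \<or> q = p"
      "\<And>u :: nat \<Rightarrow> real. u 0 + u 1 + u 2 = u m + u n + u p" using index_split3[OF m(1) n(1) mn] by metis
    define B where "B = (\<lambda>q. t j * \<phi> q (w j) + t l * \<phi> q (w l))"
    have nn: "0 \<le> \<phi> q (w j)" "0 \<le> \<phi> q (w l)" if "q < 3" for q using wQ(1)[OF ij(3)] wQ(1)[OF kl(2)] that by (auto simp: Q_def)
    have B0: "0 \<le> B q" if "q < 3" for q using nn[OF that] ti by (simp add: B_def)
    have Bsum: "B m + B n + B p = 1 + K"
    proof -
      have "B 0 + B 1 + B 2 = t j * (\<phi> 0 (w j) + \<phi> 1 (w j) + \<phi> 2 (w j)) + t l * (\<phi> 0 (w l) + \<phi> 1 (w l) + \<phi> 2 (w l))"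
        by (simp add: B_def algebra_simps)
      also have "\<dots> = (t j + t l) * (1 + K)" using ij(4) H(2) unfolding \<phi>_sum H_def by (simp add: algebra_simps)
      finally show ?thesis using p(5)[of B] tjl by simp
    qed
    have s1: "sum (drop_vertex t q) {..<4} = 1" if "q < 4" for q using sum_drop_vertex[OF that, of t "\<lambda>_. 1"] t(2) by simp
    have \<phi>s: "\<phi> q (bary (drop_vertex t r) w) = t i * \<phi> q (w i) + t k * \<phi> q (w k) + B q - \<phi> q (w r)" if "r < 4" for q r
      unfolding \<phi>_bary[OF s1[OF that]] sum_drop_vertex[OF that] sum4 B_def by simp
    have hs: "h (bary (drop_vertex t r) w - v) = 1" if "r < 4" "H r = 0" for r
      unfolding h_bary[OF s1[OF that(1)]] sum_drop_vertex[OF that(1)] sum4 using ij H that(2) tjl unfolding H_def by simp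
    have vals: "\<phi> m (w k) = 0" "\<phi> n (w i) = 0" "\<phi> p (w i) = 0" "\<phi> p (w k) = 0" using m n p mn by auto
    show ?thesis
    proof (cases "t k \<le> B m \<or> t i \<le> B n")
      case True
      then show ?thesis
      proof
        assume le: "t k \<le> B m"
        have "0 \<le> \<phi> q (bary (drop_vertex t i) w)" if "q < 3" for q
          using p(4)[OF that] le m(2) n(2) vals B0[OF n(1)] B0[OF p(1)] ti tik unfolding \<phi>s[OF ij(1)] by auto
        then have "bary (drop_vertex t i) w \<in> Q" unfolding Q_def using hs[OF ij(1,2)] by simp
        then show ?thesis using ij(1) by blast
      next
        assume le: "t i \<le> B n"
        have "0 \<le> \<phi> q (bary (drop_vertex t k) w)" if "q < 3" for q
          using p(4)[OF that] le m(2) n(2) vals B0[OF m(1)] B0[OF p(1)] ti tik unfolding \<phi>s[OF kl(1)] by auto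
        then have "bary (drop_vertex t k) w \<in> Q" unfolding Q_def using hs[OF kl(1) H(1)] by simp
        then show ?thesis using kl(1) by blast
      qed
    next
      case False
      then have "K < B p" using Bsum tik by linarith
      have "bary (drop_vertex t i) w = bary t w - w i" unfolding drop_vertex_def by (rule bary_diff[OF ij(1)])
      then have "bary (drop_vertex t i) w \<in> int_lattice" using t(3) wQ(2)[OF ij(1)] int_lattice_closed(3) by simp
      then have "\<phi> p (bary (drop_vertex t i) w) \<in> \<int>" by (rule \<phi>_Ints)
      then have "B p \<in> \<int>" unfolding \<phi>s[OF ij(1)] using vals by simp
      then have "K + 1 \<le> B p" using \<open>K < B p\<close> K(2) by (auto elim!: Ints_cases)
      then have z: "B m = 0" "B n = 0" using Bsum B0[OF m(1)] B0[OF n(1)] by linarith+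
      have zero: "\<phi> q (w j) = 0" "\<phi> q (w l) = 0" if "q < 3" "B q = 0" for q
      proof -
        have "0 \<le> t j * \<phi> q (w j)" "0 \<le> t l * \<phi> q (w l)" using nn[OF that(1)] ti by auto
        then have "t j * \<phi> q (w j) = 0" "t l * \<phi> q (w l) = 0" using that(2) unfolding B_def by linarith+
        then show "\<phi> q (w j) = 0" "\<phi> q (w l) = 0" using ti by auto
      qed
      note zm = zero[OF m(1) z(1)] and zn = zero[OF n(1) z(2)]
      have "\<phi> p (w j) = 1 + K" "\<phi> p (w l) = 1 + K"
        using \<phi>_sum[of "w j"] \<phi>_sum[of "w l"] p(5)[of "\<lambda>q. \<phi> q (w j)"] p(5)[of "\<lambda>q. \<phi> q (w l)"] zm zn ij(4) H(2)
        unfolding H_def by simp_all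
      then have "\<phi> q (w j) = \<phi> q (w l)" if "q < 3" for q using p(4)[OF that] zm zn by auto
      then have "w j = w l" using ij(4) H(2) by (intro eq_if_\<phi>_eq) (auto simp: H_def)
      then show ?thesis using tet_inj[OF w(2) ij(3) kl(2)] kl(4) by simp
    qed
  qed
  have sH: "t j + t k * H k + t l * H l \<in> \<int>" using sumH ij by (simp add: sum4)
  consider "H k = 0" "H l = 1" | "H k = 1" "H l = 0" | "H k = 0" "H l = 0" | "H k = 1" "H l = 1"
    using H01[OF kl(1)] H01[OF kl(2)] by blast
  then show ?thesis
  proof cases
    case 1
    show ?thesis by (rule main[of k l]) (use kl 1 sum4 in auto)
  next
    case 2
    show ?thesis by (rule main[of l k]) (use kl 2 sum4 in auto)
  next
    case 3
    then show ?thesis using sH ti by (auto elim!: Ints_cases)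
  next
    case 4
    then have "2 - t i \<in> \<int>" using sH t2 by (metis add_diff_cancel_left' add.assoc mult.right_neutral)
    then have "2 - (2 - t i) \<in> \<int>" by (intro Ints_diff) auto
    then show ?thesis using ti by (auto elim!: Ints_cases)
  qed
qed

theorem frustum_covered:
  assumes x: "x \<in> Q" shows "unimodularly_covered Q x"
proof (rule unimodular_descent[of x vertices Q "(\<lambda>_. v)(1 := v + a, 2 := v + b, 3 := v + e)"])
  show "x \<in> convex hull vertices" using x Q_hull by blast
  show "vertices \<subseteq> Q \<inter> int_lattice" using vertices_Q vertices_lattice by blast
  show "\<forall>i<4. ((\<lambda>_. v)(1 := v + a, 2 := v + b, 3 := v + e)) i \<in> vertices" by (auto simp: vertices_def)
  show "tet ((\<lambda>_. v)(1 := v + a, 2 := v + b, 3 := v + e)) \<noteq> 0" using frame_det3[OF fr] by (simp add: tet_def)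
  show "convex Q" by (rule convex_Q)
next
  fix w t assume w: "\<forall>i<4. w i \<in> Q \<inter> int_lattice" "tet w \<noteq> 0" and t: "\<forall>i<4. 0 < t i \<and> t i < 1" "sum t {..<4} = 2" "bary t w \<in> int_lattice"
  then obtain j where "j < 4" "bary (drop_vertex t j) w \<in> Q" using frustum_step by blast
  then show "\<exists>c. (\<forall>i<4. c i < 1) \<and> sum c {..<4} = 1 \<and> bary c w \<in> Q \<inter> int_lattice"
    using descent_candidate[OF t w(1)] by blast
next
  fix w assume "\<forall>i<4. w i \<in> Q \<inter> int_lattice" "unimodular_vertices w" "x \<in> convex hull (w ` {..<4})"
  then show ?thesis using convex_Q by (intro unimodular_vertices_covered[of w]) auto
qed

end

section \<open>Parallelograms in a facet and neighbours of a triangular facet\<close>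

lemma corner_swap: "corner P v a b c f g h \<Longrightarrow> corner P v b a c g f h"
  unfolding corner_def using lattice_frame_swap by blast

text \<open>\<open>X\<close> is rounded up, but at least to 1.\<close>
lemma split_two_coordinates:
  fixes X Y Z N :: real
  assumes "0 \<le> X" "0 \<le> Y" "1 \<le> Z" "X + Y + Z = N" "N \<in> \<int>" "2 \<le> N"
  shows "\<exists>s\<in>\<int>. 1 \<le> s \<and> s \<le> N - 1 \<and> X \<le> s \<and> Y \<le> N - s"
proof -
  obtain n :: int where n: "N = of_int n" using assms(5) by (auto elim: Ints_cases)
  define i where "i = max 1 \<lceil>X\<rceil>"
  have i: "1 \<le> i" "X \<le> of_int i" by (auto simp: i_def max_def)
  have "Y \<le> of_int (n - i) \<and> i \<le> n - 1"
  proof (cases "\<lceil>X\<rceil> \<le> 1")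
    case True
    then have "i = 1" by (simp add: i_def)
    then show ?thesis using assms n by simp
  next
    case False
    then have iX: "i = \<lceil>X\<rceil>" by (simp add: i_def)
    have "of_int i < X + 1" unfolding iX by linarith
    then have "Y \<le> of_int (n - i)" "real_of_int i < of_int n" using assms n by auto
    then show ?thesis by simp
  qed
  then show ?thesis using i n by (intro bexI[of _ "of_int i"]) auto
qed

text \<open>A point of a triangle of integral size \<open>N \<ge> 2\<close>, given by its three
coordinates, lies in a parallelogram at one of the corners whose sides \<open>s\<close> and \<open>N -
s\<close> are positive integers.\<close>
lemma split_three_coordinates:
  fixes \<alpha> \<beta> \<gamma> N :: real
  assumes "0 \<le> \<alpha>" "0 \<le> \<beta>" "0 \<le> \<gamma>" "\<alpha> + \<beta> + \<gamma> = N" "N \<in> \<int>" "2 \<le> N"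
  obtains s where "s \<in> \<int>" "1 \<le> s" "s \<le> N - 1" "\<alpha> \<le> s \<and> \<beta> \<le> N - s \<or> \<gamma> \<le> s \<and> \<beta> \<le> N - s \<or> \<gamma> \<le> s \<and> \<alpha> \<le> N - s"
proof -
  consider "1 \<le> \<gamma>" | "1 \<le> \<alpha>" | "1 \<le> \<beta>" | "\<alpha> < 1" "\<beta> < 1" "\<gamma> < 1" by linarith
  then show thesis
  proof cases
    case 1 then show thesis using split_two_coordinates[of \<alpha> \<beta> \<gamma> N] assms that by auto
  next
    case 2 then show thesis using split_two_coordinates[of \<gamma> \<beta> \<alpha> N] assms that by auto
  next
    case 3 then show thesis using split_two_coordinates[of \<gamma> \<alpha> \<beta> N] assms that by auto
  next
    case 4 then show thesis using assms by (intro that[of 1]) auto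
  qed
qed

context centred_smooth_polytope
begin

text \<open>A lattice parallelogram in \<open>P\<close> and its reflection span a lattice parallelepiped
in \<open>P\<close> centred at \<open>c\<close>. It contains the cone from \<open>c\<close> over the
parallelogram.\<close>
lemma covered_by_parallelepiped:
  assumes L: "p \<in> int_lattice" "a \<in> int_lattice" "b \<in> int_lattice"
    and P: "p \<in> P" "p + a \<in> P" "p + b \<in> P" "p + a + b \<in> P"
    and det: "det3 a b (2 *\<^sub>R c - 2 *\<^sub>R p - a - b) \<noteq> 0"
    and y: "y = p + \<alpha> *\<^sub>R a + \<beta> *\<^sub>R b" "0 \<le> \<alpha>" "\<alpha> \<le> 1" "0 \<le> \<beta>" "\<beta> \<le> 1"
    and x: "x = c + r *\<^sub>R (y - c)" "0 \<le> r" "r \<le> 1"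
  shows "unimodularly_covered P x"
proof -
  define e where "e = 2 *\<^sub>R c - 2 *\<^sub>R p - a - b"
  have eL: "e \<in> int_lattice" unfolding e_def
    by (rule int_lattice_closed(3)[OF int_lattice_closed(3)[OF int_lattice_closed(3)[OF centre_lattice
          int_lattice_closed(5)[OF L(1)]] L(2)] L(3)]) simp
  have eqs: "2 *\<^sub>R c - (p + a + b) = p + e" "2 *\<^sub>R c - (p + b) = p + a + e" "2 *\<^sub>R c - (p + a) = p + b + e"
      "2 *\<^sub>R c - p = p + a + b + e"
    by (simp_all add: e_def scaleR_2)
  have "p + e \<in> P" "p + a + e \<in> P" "p + b + e \<in> P" "p + a + b + e \<in> P"
    using reflect[OF P(4)] reflect[OF P(3)] reflect[OF P(2)] reflect[OF P(1)] unfolding eqs by blast+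
  then have "corners p a b e \<subseteq> P" unfolding corners_def insert_subset using P by blast
  then have sub: "parallelepiped p a b e \<subseteq> P" by (rule parallelepiped_subset_convex[OF cvx])
  define q where "q = (1 - r) / 2"
  have c: "c = p + (1 / 2) *\<^sub>R (a + b + e)" 
  proof -
    have "a + b + e = 2 *\<^sub>R (c - p)" by (simp add: e_def scaleR_diff_right)
    then show ?thesis by simp
  qed
  have "x = (1 - r) *\<^sub>R c + r *\<^sub>R y" using x(1) by (simp add: algebra_simps)
  also have "\<dots> = p + (q + r * \<alpha>) *\<^sub>R a + (q + r * \<beta>) *\<^sub>R b + q *\<^sub>R e"
    unfolding y(1) q_def by (subst c) (simp add: algebra_simps diff_divide_distrib)
  finally have x': "x = p + (q + r * \<alpha>) *\<^sub>R a + (q + r * \<beta>) *\<^sub>R b + q *\<^sub>R e" .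
  have b: "0 \<le> q + r * \<rho> \<and> q + r * \<rho> \<le> 1" if "0 \<le> \<rho>" "\<rho> \<le> 1" for \<rho>
  proof -
    have "0 \<le> r * \<rho>" "r * \<rho> \<le> r" using that x by (auto intro: mult_left_le)
    then show ?thesis using x unfolding q_def by (simp add: field_simps)
  qed
  have "x \<in> parallelepiped p a b e" unfolding parallelepiped_def mem_Collect_eq
    using x' b[OF y(2,3)] b[OF y(4,5)] x(2,3)
    by (intro exI[of _ "q + r * \<alpha>"] exI[of _ "q + r * \<beta>"] exI[of _ q]) (auto simp: q_def)
  then have "unimodularly_covered (parallelepiped p a b e) x"
    using parallelepiped_covered[OF L eL] det unfolding e_def by blast
  then show ?thesis using sub by (rule unimodularly_covered_mono)
qed

lemma covered_by_triangle_corner: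
  assumes L: "p \<in> int_lattice" "u \<in> int_lattice" "w \<in> int_lattice" 
    and N: "N \<in> \<int>" "s \<in> \<int>" "1 \<le> s" "s \<le> N - 1"
    and P: "p \<in> P" "p + N *\<^sub>R u \<in> P" "p + N *\<^sub>R w \<in> P"
    and det: "det3 u w (2 *\<^sub>R c - 2 *\<^sub>R p - s *\<^sub>R u - (N - s) *\<^sub>R w) \<noteq> 0"
    and z: "z = p + X *\<^sub>R u + Y *\<^sub>R w" "0 \<le> X" "X \<le> s" "0 \<le> Y" "Y \<le> N - s"
    and x: "x = c + r *\<^sub>R (z - c)" "0 \<le> r" "r \<le> 1"
  shows "unimodularly_covered P x"
proof -
  have tri: "p + X *\<^sub>R u + Y *\<^sub>R w \<in> P" if "0 \<le> X" "0 \<le> Y" "X + Y \<le> N" for X Y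
  proof -
    have N0: "0 < N" using N by linarith
    have "(1 - X / N - Y / N) *\<^sub>R p + (X / N) *\<^sub>R (p + N *\<^sub>R u) + (Y / N) *\<^sub>R (p + N *\<^sub>R w) \<in> P"
    proof (rule convex_combination_3[OF cvx P])
      have "(X + Y) / N \<le> 1" using that N0 by simp
      then show "0 \<le> 1 - X / N - Y / N" by (simp add: add_divide_distrib)
    qed (use that N0 in auto)
    moreover have "(1 - X / N - Y / N) *\<^sub>R p + (X / N) *\<^sub>R (p + N *\<^sub>R u) + (Y / N) *\<^sub>R (p + N *\<^sub>R w) = p + X *\<^sub>R u + Y *\<^sub>R w"
      using N0 by (simp add: algebra_simps)
    ultimately show ?thesis by simp
  qed
  show ?thesis
  proof (rule covered_by_parallelepiped[OF L(1) _ _ P(1) _ _ _ _ _ _ _ _ _ x])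
    show "s *\<^sub>R u \<in> int_lattice" "(N - s) *\<^sub>R w \<in> int_lattice" using L N by (auto intro!: int_lattice_closed(5))
    show "p + s *\<^sub>R u \<in> P" using tri[of s 0] N by simp
    show "p + (N - s) *\<^sub>R w \<in> P" using tri[of 0 "N - s"] N by simp
    show "p + s *\<^sub>R u + (N - s) *\<^sub>R w \<in> P" using tri[of s "N - s"] N by simp
    show "det3 (s *\<^sub>R u) ((N - s) *\<^sub>R w) (2 *\<^sub>R c - 2 *\<^sub>R p - s *\<^sub>R u - (N - s) *\<^sub>R w) \<noteq> 0"
      using det N by (simp add: det3_linear(2,4))
    show "z = p + (X / s) *\<^sub>R (s *\<^sub>R u) + (Y / (N - s)) *\<^sub>R ((N - s) *\<^sub>R w)" using z N by simp
    show "0 \<le> X / s" "X / s \<le> 1" "0 \<le> Y / (N - s)" "Y / (N - s) \<le> 1" using z N by (auto simp: field_simps)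
  qed
qed

text \<open>The facets \<open>h = 0\<close> and \<open>k1 = 0\<close> meet in the edge from \<open>v +
a\<close> to \<open>v + b\<close>. The edge of \<open>P\<close> at \<open>v + a\<close> outside the
first of them has a direction \<open>d\<close> with \<open>g d = 0\<close>, since it belongs to the
facet \<open>g = 0\<close> that contains \<open>v\<close> and \<open>v + a\<close>. So \<open>d\<close>
differs from \<open>e\<close> by a multiple of \<open>a\<close>, which also determines the slope of
\<open>k1\<close>.\<close>
lemma side_of_triangle_facet:
  assumes co: "corner P v a b e f g h" and co1: "corner P (v + a) (- a) (b - a) d k1 k2 k3" and hd: "h d = 1"
  shows "f d \<in> \<int>" "v + e + (1 + f d) *\<^sub>R a \<in> P" "\<And>x. x \<in> P \<Longrightarrow> f (x - v) + g (x - v) \<le> 1 + f d * h (x - v)"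
proof -
  have fr: "lattice_frame a b e f g h" and fr1: "lattice_frame (- a) (b - a) d k1 k2 k3" and veP: "v + e \<in> P"
    and nn: "\<And>x. x \<in> P \<Longrightarrow> 0 \<le> g (x - v)" and nn1: "\<And>x. x \<in> P \<Longrightarrow> 0 \<le> k1 (x - (v + a)) \<and> 0 \<le> k2 (x - (v + a))"
    and dP: "v + a + d \<in> P"
    using co co1 by (auto simp: corner_def)
  note D = lattice_frameD[OF fr] and D1 = lattice_frameD[OF fr1]
  show "f d \<in> \<int>" using D(17)[OF D1(6)] .
  have l: "l z = k1 z * l (- a) + k2 z * l (b - a) + k3 z * l d" if "linear l" for l :: "real^3 \<Rightarrow> real" and z
  proof -
    have "l z = l (k1 z *\<^sub>R (- a) + k2 z *\<^sub>R (b - a) + k3 z *\<^sub>R d)" unfolding D1(16) ..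
    then show ?thesis using that by (simp only: linear_add linear_scale real_scaleR_def)
  qed
  have val: "f (- a) = -1" "f (b - a) = -1" "g (- a) = 0" "g (b - a) = 1" "h (- a) = 0" "h (b - a) = 0"
    using D(1-3) D(7-15) by (simp_all add: linear_diff linear_neg)
  have hz: "h z = k3 z" and gz: "g z = k2 z + k3 z * g d" and fz: "f z = - k1 z - k2 z + k3 z * f d" for z
    using l[OF D(1), of z] l[OF D(2), of z] l[OF D(3), of z] val hd by simp_all
  have "v + a + d - v = a + d" by simp
  then have "g (a + d) \<ge> 0" using nn[OF dP] by simp
  then have "0 \<le> g d" using D(2,10) by (simp add: linear_add)
  moreover have "0 \<le> - g d"
  proof -
    have z: "v + e - (v + a) = e - a" by simp
    have "h (e - a) = 1" "g (e - a) = 0" using D by (simp_all add: linear_diff)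
    then have "k2 (e - a) = - g d" using hz[of "e - a"] gz[of "e - a"] by simp
    then show ?thesis using nn1[OF veP] unfolding z by simp
  qed
  \<comment> \<open>The two inequalities say that \<open>v + a + d\<close> is in the cone at
  \<open>v\<close>, and \<open>v + e\<close> in the cone at \<open>v + a\<close>.\<close>
  ultimately have gd: "g d = 0" by simp
  have d: "d = e + f d *\<^sub>R a" using D(16)[of d] gd hd by (simp add: add.commute)
  have "v + e + (1 + f d) *\<^sub>R a = v + a + (e + f d *\<^sub>R a)" by (simp add: algebra_simps)
  also have "\<dots> = v + a + d" by (simp only: d[symmetric])
  finally show "v + e + (1 + f d) *\<^sub>R a \<in> P" using dP by (rule ssubst)
  fix x assume x: "x \<in> P"
  have z: "x - (v + a) = (x - v) - a" by simp
  have c: "f (x - (v + a)) = f (x - v) - 1" "g (x - (v + a)) = g (x - v)" "h (x - (v + a)) = h (x - v)"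
    unfolding z linear_diff[OF D(1), of "x - v" a] linear_diff[OF D(2), of "x - v" a] linear_diff[OF D(3), of "x - v" a] using D by simp_all
  have "0 \<le> k1 (x - (v + a))" using nn1[OF x] by blast
  then show "f (x - v) + g (x - v) \<le> 1 + f d * h (x - v)"
    using fz[of "x - (v + a)"] gz[of "x - (v + a)"] hz[of "x - (v + a)"] c gd by (simp add: mult.commute)
qed

lemma lattice_points_of_unimodular_triangle:
  assumes fr: "planar_frame h a b f g" and L: "p \<in> int_lattice" "x \<in> int_lattice" and x: "x \<in> convex hull {p, p + a, p + b}"
  shows "x \<in> {p, p + a, p + b}"
proof -
  note D = planar_frameD[OF fr]
  obtain u s t where ust: "0 \<le> u" "0 \<le> s" "0 \<le> t" "u + s + t = 1" "x = u *\<^sub>R p + s *\<^sub>R (p + a) + t *\<^sub>R (p + b)"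
    using x unfolding convex_hull_3 by blast
  have u: "u = 1 - s - t" using ust by simp
  have xp: "x - p = s *\<^sub>R a + t *\<^sub>R b" unfolding ust(5) u by (simp add: algebra_simps)
  have "f (x - p) = s" "g (x - p) = t" unfolding xp using D by (simp_all add: linear_add linear_scale)
  moreover have "f (x - p) \<in> \<int>" "g (x - p) \<in> \<int>" using D(11,12) int_lattice_closed(3)[OF L(2,1)] by blast+
  ultimately obtain i j :: int where ij: "s = of_int i" "t = of_int j" by (auto elim!: Ints_cases)
  have "0 \<le> i" "0 \<le> j" "i + j \<le> 1" using ust u ij by linarith+
  then have "i = 0 \<and> j = 0 \<or> i = 1 \<and> j = 0 \<or> i = 0 \<and> j = 1" by linarith
  moreover have "x = p + s *\<^sub>R a + t *\<^sub>R b" using xp by (simp add: algebra_simps)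
  ultimately show ?thesis using ij by auto
qed

end

section \<open>Covering the polytope\<close>

context facet
begin

text \<open>The triangle and its reflection in one of its edges form a parallelogram.\<close>
lemma covered_by_reflected_triangle:
  assumes T: "triangle_in_polygon h F v0 v1 v2 X Y" and refl: "v1 + v2 - v0 \<in> F"
    and y: "y \<in> convex hull {v0, v1, v2}" and x: "x = c + r *\<^sub>R (y - c)" "0 \<le> r" "r \<le> 1"
  shows "unimodularly_covered P x"
proof -
  interpret T: triangle_in_polygon h F v0 v1 v2 X Y by (rule T)
  have FP: "F \<subseteq> P" by (auto simp: F_def)
  obtain u s t where ust: "0 \<le> u" "0 \<le> s" "0 \<le> t" "u + s + t = 1" "y = u *\<^sub>R v0 + s *\<^sub>R v1 + t *\<^sub>R v2"
    using y unfolding convex_hull_3 by blast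
  have u: "u = 1 - s - t" using ust by simp
  let ?e = "2 *\<^sub>R c - 2 *\<^sub>R v0 - (v1 - v0) - (v2 - v0)"
  have "?e = 2 *\<^sub>R (c - v) - 2 *\<^sub>R (v0 - v) - (v1 - v0) - (v2 - v0)" by (simp add: scaleR_diff_right)
  then have "h ?e = 2 * h (c - v) - 2 * h (v0 - v) - h (v1 - v0) - h (v2 - v0)"
    using Dv(3) by (simp only: linear_diff[OF Dv(3), of _ "v2 - v0"] linear_diff[OF Dv(3), of _ "v1 - v0"] 
       linear_diff[OF Dv(3), of "2 *\<^sub>R (c - v)" "2 *\<^sub>R (v0 - v)"] linear_scale real_scaleR_def)
  then have he: "h ?e \<noteq> 0" using T.f_corner T.vF(1) corner_functional_pos[OF co] by (simp add: F_def)
  show ?thesis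
  proof (rule covered_by_parallelepiped[OF T.vL T.D(3,4) _ _ _ _ det3_planar[OF T.frame Dv(3) he] _ _ _ _ _ x])
    show "v0 \<in> P" "v0 + (v1 - v0) \<in> P" "v0 + (v2 - v0) \<in> P" using T.vF FP by auto
    have eq: "v0 + (v1 - v0) + (v2 - v0) = v1 + v2 - v0" by simp
    show "v0 + (v1 - v0) + (v2 - v0) \<in> P" unfolding eq using refl FP by blast
    show "y = v0 + s *\<^sub>R (v1 - v0) + t *\<^sub>R (v2 - v0)" unfolding ust(5) u by (simp add: algebra_simps)
    show "0 \<le> s" "s \<le> 1" "0 \<le> t" "t \<le> 1" using ust by auto
  qed
qed

lemma covered_below_nontriangle:
  assumes nt: "\<not> poly.is_unimodular_triangle" and y: "y \<in> F" and x: "x = c + r *\<^sub>R (y - c)" "0 \<le> r" "r \<le> 1"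
  shows "unimodularly_covered P x"
proof -
  obtain v0 v1 v2 X Y where T: "triangle_in_polygon h F v0 v1 v2 X Y" and yt: "y \<in> convex hull {v0, v1, v2}"
    using unimodular_triangle_in_face[OF y] .
  interpret T: triangle_in_polygon h F v0 v1 v2 X Y by (rule T)
  interpret S: triangle_in_polygon h F v0 v2 v1 Y X by (rule T.swap)
  have perm: "{v1, v0, v2} = {v0, v1, v2}" "{v2, v0, v1} = {v0, v1, v2}" by auto
  from T.reflected_triangle[OF nt] show ?thesis
  proof (elim disjE)
    assume "v1 + v2 - v0 \<in> F"
    then show ?thesis by (rule covered_by_reflected_triangle[OF T _ yt x])
  next
    assume "v0 + v2 - v1 \<in> F"
    then show ?thesis by (rule covered_by_reflected_triangle[OF T.rebase _ _ x]) (use yt perm in simp)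
  next
    assume "v0 + v1 - v2 \<in> F"
    then show ?thesis by (rule covered_by_reflected_triangle[OF S.rebase _ _ x]) (use yt perm in simp)
  qed
qed

lemma planar_corner_v: "planar_corner h F v a b f g"
  using planar_corner_if_two[OF co Dv(3) F_def corner_points(1) Dv(13,14)] Dv(15) by simp

lemma v_extreme_F: "v extreme_point_of F"
  using v corner_points(1) extreme_point_of_face[OF face] by blast

context
  assumes triangle: "poly.is_unimodular_triangle"
begin

lemma lattice_points_F: assumes "x \<in> F" "x \<in> int_lattice" shows "x = v \<or> x = v + a \<or> x = v + b"
proof -
  obtain p a' b' g' k' where p: "p extreme_point_of F" and pc: "planar_corner h F p a' b' g' k'" and F: "F = convex hull {p, p + a', p + b'}"
    using triangle unfolding poly.is_unimodular_triangle_def by blast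
  have fr: "planar_frame h a' b' g' k'" using pc by (simp add: planar_corner_def)
  have lat: "q \<in> {p, p + a', p + b'}" if "q \<in> F" "q \<in> int_lattice" for q
    using lattice_points_of_unimodular_triangle[OF fr poly.lattice[OF p] that(2)] that(1) F by blast
  have vL: "v \<in> int_lattice" by (rule lattice[OF v])
  have sub: "{v, v + a, v + b} \<subseteq> {p, p + a', p + b'}"
    using lat corner_points vL Dv(4,5) int_lattice_closed(2) by blast
  have ne: "a \<noteq> 0" "b \<noteq> 0" "a \<noteq> b" using Dv(7,8,11) linear_0[OF Dv(1)] linear_0[OF Dv(2)] by auto
  have "card {p, p + a', p + b'} \<le> 3" by (simp add: card_insert_if)
  moreover have "card {v, v + a, v + b} = 3" using ne by simp
  ultimately have "{v, v + a, v + b} = {p, p + a', p + b'}" using sub by (intro card_seteq) auto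
  then show ?thesis using lat[OF assms] by blast
qed

text \<open>The row from \<open>v\<close> in direction \<open>a\<close> ends in a vertex, for which only
\<open>v + a\<close> is left.\<close>
lemma extreme_F: "v + a extreme_point_of F" "v + b extreme_point_of F"
proof -
  have ne: "a \<noteq> 0" "b \<noteq> 0" using Dv(7,11) linear_0[OF Dv(1)] linear_0[OF Dv(2)] by auto
  obtain q l where q: "q extreme_point_of F" "q = v + l *\<^sub>R a" "1 \<le> l" using poly.row_end[OF v_extreme_F planar_corner_v] by blast
  have "q = v \<or> q = v + a \<or> q = v + b" using lattice_points_F[of q] poly.lattice[OF q(1)] q(1) unfolding extreme_point_of_def by blast
  moreover have "q \<noteq> v" using q ne by auto
  moreover have "q \<noteq> v + b"
  proof
    assume "q = v + b" then have "b = l *\<^sub>R a" using q by simp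
    then have "g b = l * g a" using Dv(2) by (simp add: linear_scale)
    then show False using Dv by simp
  qed
  ultimately show "v + a extreme_point_of F" using q by blast
  obtain q l where q: "q extreme_point_of F" "q = v + l *\<^sub>R b" "1 \<le> l"
    using poly.row_end[OF v_extreme_F planar_corner_swap[OF planar_corner_v]] by blast
  have "q = v \<or> q = v + a \<or> q = v + b" using lattice_points_F[of q] poly.lattice[OF q(1)] q(1) unfolding extreme_point_of_def by blast
  moreover have "q \<noteq> v" using q ne by auto
  moreover have "q \<noteq> v + a"
  proof
    assume "q = v + a" then have "a = l *\<^sub>R b" using q by simp
    then have "f a = l * f b" using Dv(1) by (simp add: linear_scale)
    then show False using Dv by simp
  qed
  ultimately show "v + b extreme_point_of F" using q by blast
qed

lemma normalised_corner:
  assumes w: "w extreme_point_of F" and pts: "\<And>x. x \<in> F \<Longrightarrow> x \<in> int_lattice \<Longrightarrow> x = w \<or> x = p \<or> x = q"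
  obtains d k1 k2 k3 where "corner P w (p - w) (q - w) d k1 k2 k3" "h d = 1"
proof -
  note ex = extreme_of_face[OF w]
  obtain a1 a2 d k1 k2 k3 where cw: "corner P w a1 a2 d k1 k2 k3" and ha: "h a1 = 0" "h a2 = 0" "h d = 1"
    using face_corner[OF ex] .
  have fr: "lattice_frame a1 a2 d k1 k2 k3" using cw by (simp add: corner_def)
  note D = lattice_frameD[OF fr]
  have pc: "planar_corner h F w a1 a2 k1 k2" using planar_corner_if_two[OF cw Dv(3) F_def ex(2) ha(1,2)] ha(3) by simp
  then have wF: "w + a1 \<in> F" "w + a2 \<in> F" by (auto simp: planar_corner_def)
  have wL: "w \<in> int_lattice" by (rule poly.lattice[OF w])
  have ne: "a1 \<noteq> 0" "a2 \<noteq> 0" "a1 \<noteq> a2" using D(7,8,11) linear_0[OF D(1)] linear_0[OF D(2)] by auto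
  have "w + a1 = p \<or> w + a1 = q" using pts[OF wF(1) int_lattice_closed(2)[OF wL D(4)]] ne by auto
  moreover have "w + a2 = p \<or> w + a2 = q" using pts[OF wF(2) int_lattice_closed(2)[OF wL D(5)]] ne by auto
  moreover have "w + a1 \<noteq> w + a2" using ne by simp
  ultimately have "w + a1 = p \<and> w + a2 = q \<or> w + a1 = q \<and> w + a2 = p" by metis
  then have "a1 = p - w \<and> a2 = q - w \<or> a1 = q - w \<and> a2 = p - w" by (metis add_diff_cancel_left')
  then show thesis using that cw corner_swap[OF cw] ha(3) by blast
qed

text \<open>The facet on the third side of the triangle can be reached from \<open>v + a\<close> and
from \<open>v + b\<close>, which gives the same slope \<open>K\<close>. For \<open>K \<le> 0\<close> the
polytope would not become wider above the triangle. But it contains the reflected triangle: \<open>z =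
2(c - v)\<close> satisfies \<open>f z \<ge> 1\<close>, \<open>g z \<ge> 1\<close>, and so \<open>2 \<le>
1 + K * h z\<close> with \<open>h z > 0\<close>.\<close>
lemma triangle_facet_wedge:
  obtains K where "K \<in> \<int>" "1 \<le> K" "v + e + (1 + K) *\<^sub>R a \<in> P" "v + e + (1 + K) *\<^sub>R b \<in> P"
    "\<And>x. x \<in> P \<Longrightarrow> f (x - v) + g (x - v) \<le> 1 + K * h (x - v)"
proof -
  obtain d k1 k2 k3 where c1: "corner P (v + a) (v - (v + a)) (v + b - (v + a)) d k1 k2 k3" "h d = 1"
    by (rule normalised_corner[OF extreme_F(1), of v "v + b"]) (use lattice_points_F in blast)+
  obtain d' k1' k2' k3' where c2: "corner P (v + b) (v - (v + b)) (v + a - (v + b)) d' k1' k2' k3'" "h d' = 1"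
    by (rule normalised_corner[OF extreme_F(2), of v "v + a"]) (use lattice_points_F in blast)+
  have c1': "corner P (v + a) (- a) (b - a) d k1 k2 k3" using c1(1) by simp
  have c2': "corner P (v + b) (- b) (a - b) d' k1' k2' k3'" using c2(1) by simp
  note A = side_of_triangle_facet[OF co c1' c1(2)]
  note B = side_of_triangle_facet[OF corner_swap[OF co] c2' c2(2)]
  have val: "f (v + e + r *\<^sub>R b - v) = 0" "g (v + e + r *\<^sub>R b - v) = r" "h (v + e + r *\<^sub>R b - v) = 1"
     "f (v + e + r *\<^sub>R a - v) = r" "g (v + e + r *\<^sub>R a - v) = 0" "h (v + e + r *\<^sub>R a - v) = 1" for r
  proof -
    have eq: "v + e + r *\<^sub>R b - v = e + r *\<^sub>R b" "v + e + r *\<^sub>R a - v = e + r *\<^sub>R a" by simp_all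
    show "f (v + e + r *\<^sub>R b - v) = 0" "g (v + e + r *\<^sub>R b - v) = r" "h (v + e + r *\<^sub>R b - v) = 1"
     "f (v + e + r *\<^sub>R a - v) = r" "g (v + e + r *\<^sub>R a - v) = 0" "h (v + e + r *\<^sub>R a - v) = 1"
      unfolding eq using Dv by (simp_all add: linear_add linear_scale)
  qed
  have "g d' \<le> f d" using A(3)[OF B(2)] unfolding val by simp
  moreover have "f d \<le> g d'" using B(3)[OF A(2)] unfolding val by simp
  ultimately have K: "g d' = f d" by simp
  define H where "H = h (c - v)"
  have H: "0 < H" unfolding H_def by (rule corner_functional_pos[OF co])
  have P3: "2 *\<^sub>R c - v \<in> P" "2 *\<^sub>R c - (v + a) \<in> P" "2 *\<^sub>R c - (v + b) \<in> P"
    using corner_points reflect by (auto simp: F_def)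
  have nn: "0 \<le> f (x - v)" "0 \<le> g (x - v)" if "x \<in> P" for x using co that by (auto simp: corner_def)
  define z where "z = 2 *\<^sub>R c - v - v"
  have z: "2 *\<^sub>R c - (v + a) - v = z - a" "2 *\<^sub>R c - (v + b) - v = z - b" by (simp_all add: z_def)
  have "0 \<le> f (z - a)" "0 \<le> g (z - b)" using nn(1)[OF P3(2)] nn(2)[OF P3(3)] unfolding z by simp_all
  then have "1 \<le> f z" "1 \<le> g z" using Dv by (simp_all add: linear_diff)
  moreover have "f z + g z \<le> 1 + f d * h z" using A(3)[OF P3(1)] by (simp add: z_def)
  moreover have "z = 2 *\<^sub>R (c - v)" by (simp add: z_def scaleR_diff_right scaleR_2)
  then have "h z = 2 * H" using Dv(3) by (simp add: linear_scale H_def)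
  ultimately have "1 \<le> f d * (2 * H)" by simp
  then have "0 < f d" using H by (metis less_le_trans mult_pos_pos zero_less_mult_pos2 zero_less_numeral zero_less_one)
  then have "1 \<le> f d" using A(1) by (auto elim!: Ints_cases)
  then show thesis using that[of "f d"] A B(2) K by simp
qed

text \<open>Up to height 1 the frustum of the facet consists of points of \<open>P\<close> and contains
\<open>x\<close>. Above that height, the segment from \<open>c\<close> to \<open>y\<close> meets the top
of the frustum in a point \<open>z\<close> beyond \<open>x\<close>. The top is a triangle of size
\<open>1 + K \<ge> 2\<close>, so \<open>z\<close> lies in a lattice parallelogram in \<open>P\<close>,
which can play the role of a parallelogram in the facet.\<close>
lemma covered_below_triangle:
  assumes y: "y \<in> F" and xP: "x \<in> P" and x: "x = c + r *\<^sub>R (y - c)" "0 \<le> r" "r \<le> 1"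
  shows "unimodularly_covered P x"
proof -
  obtain K where K: "K \<in> \<int>" "1 \<le> K" and top: "v + e + (1 + K) *\<^sub>R a \<in> P" "v + e + (1 + K) *\<^sub>R b \<in> P"
    and wedge: "\<And>x. x \<in> P \<Longrightarrow> f (x - v) + g (x - v) \<le> 1 + K * h (x - v)"
    using triangle_facet_wedge by blast
  have vL: "v \<in> int_lattice" by (rule lattice[OF v])
  have nn: "0 \<le> f (x - v)" "0 \<le> g (x - v)" "0 \<le> h (x - v)" if "x \<in> P" for x using co that by (auto simp: corner_def)
  have veP: "v + e \<in> P" using co by (simp add: corner_def)
  define H where "H = h (c - v)"
  have H: "0 < H" unfolding H_def by (rule corner_functional_pos[OF co])
  have hx: "h (x - v) = (1 - r) * H"
  proof -
    have "x - v = (1 - r) *\<^sub>R (c - v) + r *\<^sub>R (y - v)" unfolding x(1) by (simp add: algebra_simps)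
    then have "h (x - v) = (1 - r) * h (c - v) + r * h (y - v)" using Dv(3) by (simp only: linear_add linear_scale real_scaleR_def)
    then show ?thesis using y by (simp add: F_def H_def)
  qed
  show ?thesis
  proof (cases "h (x - v) \<le> 1")
    case True
    interpret fru: frustum v a b e f g h K
      using frame_v vL K by (intro frustum.intro) auto
    have "x \<in> fru.Q" unfolding fru.Q_def fru.all_less_3 fru.\<phi>_simps using nn[OF xP] wedge[OF xP] True by simp
    then have "unimodularly_covered fru.Q x" by (rule fru.frustum_covered)
    moreover have "fru.vertices \<subseteq> P" unfolding fru.vertices_def using top veP corner_points by (auto simp: F_def)
    then have "fru.Q \<subseteq> P" using fru.Q_hull cvx hull_minimal by (metis subset_trans)
    ultimately show ?thesis by (rule unimodularly_covered_mono)
  next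
    case False
    then have big: "1 < (1 - r) * H" using hx by simp
    have H1: "1 < H" 
    proof -
      have "(1 - r) * H \<le> 1 * H" using x H by (intro mult_right_mono) auto
      then show ?thesis using big by simp
    qed
    define \<sigma> where "\<sigma> = 1 / H"
    have \<sigma>: "0 < \<sigma>" "\<sigma> < 1" "\<sigma> * H = 1" using H1 by (auto simp: \<sigma>_def)
    define z where "z = y + \<sigma> *\<^sub>R (c - y)"
    have yP: "y \<in> P" using y by (simp add: F_def)
    have zP: "z \<in> P" unfolding z_def using \<sigma> yP centre by (intro convex_step[OF cvx]) auto
    have "z - v = (1 - \<sigma>) *\<^sub>R (y - v) + \<sigma> *\<^sub>R (c - v)" unfolding z_def by (simp add: algebra_simps)
    then have "h (z - v) = (1 - \<sigma>) * h (y - v) + \<sigma> * h (c - v)" using Dv(3) by (simp only: linear_add linear_scale real_scaleR_def)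
    then have hz: "h (z - v) = 1" using y \<sigma>(3) by (simp add: F_def H_def)
    define r' where "r' = r / (1 - \<sigma>)"
    have r': "0 \<le> r'" "r' \<le> 1"
    proof -
      have "\<sigma> * 1 \<le> \<sigma> * ((1 - r) * H)" using big \<sigma> by (intro mult_left_mono) auto
      also have "\<dots> = 1 - r" using \<sigma>(3) by (metis mult.assoc mult.commute mult.right_neutral)
      finally have "r \<le> 1 - \<sigma>" by simp
      then show "0 \<le> r'" "r' \<le> 1" using x \<sigma> by (auto simp: r'_def)
    qed
    have zc: "z - c = (1 - \<sigma>) *\<^sub>R (y - c)" unfolding z_def by (simp add: algebra_simps)
    have x': "x = c + r' *\<^sub>R (z - c)" unfolding zc r'_def x(1) using \<sigma> by simp
    define N \<alpha> \<beta> \<gamma> where Nabc: "N = 1 + K" "\<alpha> = f (z - v)" "\<beta> = g (z - v)" "\<gamma> = N - \<alpha> - \<beta>"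
    have N: "N \<in> \<int>" "2 \<le> N" using K by (auto simp: Nabc)
    have abc: "0 \<le> \<alpha>" "0 \<le> \<beta>" "0 \<le> \<gamma>" using nn[OF zP] wedge[OF zP] hz by (auto simp: Nabc)
    have z: "z = v + e + \<alpha> *\<^sub>R a + \<beta> *\<^sub>R b"
      using Dv(16)[of "z - v"] unfolding hz Nabc(2,3)[symmetric] by (simp add: algebra_simps)
    have detpos: "det3 u w (2 *\<^sub>R c - 2 *\<^sub>R p - s *\<^sub>R u - t *\<^sub>R w) \<noteq> 0"
      if uw: "u = a \<and> w = b \<or> u = - a \<and> w = b - a \<or> u = - b \<and> w = a - b" and p: "h (p - v) = 1" for p u w s t
    proof -
      let ?e = "2 *\<^sub>R c - 2 *\<^sub>R p - s *\<^sub>R u - t *\<^sub>R w"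
      have "h u = 0" "h w = 0" using uw Dv by (auto simp: linear_diff linear_neg)
      moreover have "?e = 2 *\<^sub>R (c - v) - 2 *\<^sub>R (p - v) - s *\<^sub>R u - t *\<^sub>R w" by (simp add: scaleR_diff_right)
      then have "h ?e = 2 * h (c - v) - 2 * h (p - v) - s * h u - t * h w"
        by (simp only: linear_diff[OF Dv(3), of _ "t *\<^sub>R w"] linear_diff[OF Dv(3), of _ "s *\<^sub>R u"] 
           linear_diff[OF Dv(3), of "2 *\<^sub>R (c - v)" "2 *\<^sub>R (p - v)"] linear_scale[OF Dv(3)] real_scaleR_def)
      ultimately have "h ?e \<noteq> 0" using p H1 by (simp add: H_def)
      then have "det3 a b ?e \<noteq> 0" using det3_planar[of h a b f g ?e] planar_corner_v Dv(3) unfolding planar_corner_def by blast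
      moreover have "det3 u w q = det3 a b q \<or> det3 u w q = - det3 a b q" for q
        using uw by (auto simp: det3_components algebra_simps)
      ultimately show ?thesis by (metis neg_equal_0_iff_equal)
    qed
    have heights: "h (v + e - v) = 1" "h (v + e + N *\<^sub>R a - v) = 1" "h (v + e + N *\<^sub>R b - v) = 1"
    proof -
      have eq: "v + e - v = e" "v + e + N *\<^sub>R a - v = e + N *\<^sub>R a" "v + e + N *\<^sub>R b - v = e + N *\<^sub>R b" by simp_all
      show "h (v + e - v) = 1" "h (v + e + N *\<^sub>R a - v) = 1" "h (v + e + N *\<^sub>R b - v) = 1"
        unfolding eq using Dv by (simp_all add: linear_add linear_scale)
    qed
    have topN: "v + e + N *\<^sub>R a \<in> P" "v + e + N *\<^sub>R b \<in> P" using top by (simp_all add: Nabc)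
    have L0: "v + e \<in> int_lattice" using int_lattice_closed(2)[OF vL Dv(6)] .
    have L1: "v + e + N *\<^sub>R a \<in> int_lattice" using int_lattice_closed(2)[OF L0 int_lattice_closed(5)[OF Dv(4) N(1)]] .
    have L2: "v + e + N *\<^sub>R b \<in> int_lattice" using int_lattice_closed(2)[OF L0 int_lattice_closed(5)[OF Dv(5) N(1)]] .
    have Lab: "- a \<in> int_lattice" "b - a \<in> int_lattice" "- b \<in> int_lattice" "a - b \<in> int_lattice"
      using int_lattice_closed(4)[OF Dv(4)] int_lattice_closed(3)[OF Dv(5,4)] int_lattice_closed(4)[OF Dv(5)] int_lattice_closed(3)[OF Dv(4,5)] .
    obtain s where s: "s \<in> \<int>" "1 \<le> s" "s \<le> N - 1" and
      alt: "\<alpha> \<le> s \<and> \<beta> \<le> N - s \<or> \<gamma> \<le> s \<and> \<beta> \<le> N - s \<or> \<gamma> \<le> s \<and> \<alpha> \<le> N - s"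
      using split_three_coordinates[OF abc _ N] Nabc(4) by auto
    from alt consider "\<alpha> \<le> s" "\<beta> \<le> N - s" | "\<gamma> \<le> s" "\<beta> \<le> N - s" | "\<gamma> \<le> s" "\<alpha> \<le> N - s" by blast
    then show ?thesis
    proof cases
      case 1
      show ?thesis
        by (rule covered_by_triangle_corner[OF L0 Dv(4,5) N(1) s veP topN detpos[OF _ heights(1)] z abc(1) 1(1) abc(2) 1(2) x' r']) blast
    next
      case 2
      have P: "v + e + N *\<^sub>R a + N *\<^sub>R (- a) \<in> P" "v + e + N *\<^sub>R a + N *\<^sub>R (b - a) \<in> P"
        using veP topN by (simp_all add: algebra_simps)
      have z': "z = v + e + N *\<^sub>R a + \<gamma> *\<^sub>R (- a) + \<beta> *\<^sub>R (b - a)" unfolding z Nabc(4) by (simp add: algebra_simps)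
      show ?thesis
        by (rule covered_by_triangle_corner[OF L1 Lab(1,2) N(1) s topN(1) P detpos[OF _ heights(2)] z' abc(3) 2(1) abc(2) 2(2) x' r']) blast
    next
      case 3
      have P: "v + e + N *\<^sub>R b + N *\<^sub>R (- b) \<in> P" "v + e + N *\<^sub>R b + N *\<^sub>R (a - b) \<in> P"
        using veP topN by (simp_all add: algebra_simps)
      have z': "z = v + e + N *\<^sub>R b + \<gamma> *\<^sub>R (- b) + \<alpha> *\<^sub>R (a - b)" unfolding z Nabc(4) by (simp add: algebra_simps)
      show ?thesis
        by (rule covered_by_triangle_corner[OF L2 Lab(3,4) N(1) s topN(2) P detpos[OF _ heights(3)] z' abc(3) 3(1) abc(1) 3(2) x' r']) blast
    qed
  qed
qed

end

end

theorem (in centred_smooth_polytope) covered: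
  assumes x: "x \<in> P" shows "unimodularly_covered P x"
proof -
  obtain r y v a b e f g h where r: "0 \<le> r" "r \<le> 1" "x = c + r *\<^sub>R (y - c)" and y: "y \<in> P" "h (y - v) = 0"
    and v: "v extreme_point_of P" "corner P v a b e f g h"
    using ray_to_face[OF x] by metis
  interpret facet P c v a b e f g h "{x \<in> P. h (x - v) = 0}" using v by unfold_locales auto
  have yF: "y \<in> {x \<in> P. h (x - v) = 0}" using y by simp
  show ?thesis
  proof (cases "poly.is_unimodular_triangle")
    case True then show ?thesis by (rule covered_below_triangle[OF _ yF x r(3,1,2)])
  next
    case False then show ?thesis by (rule covered_below_nontriangle[OF _ yF r(3,1,2)])
  qed
qed

theorem corollary1p3:
  fixes P :: "(real^3) set"
  assumes "lattice_3_polytope P"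
    and "smooth_polytope P"
    and "centrally_symmetric P"
  shows "\<exists>\<T>. unimodular_cover \<T> P"
proof -
  obtain c where c: "(\<lambda>x. 2 *\<^sub>R c - x) ` P = P" using assms(3) unfolding centrally_symmetric_def by blast
  have "P \<noteq> {}" using assms(1) unfolding lattice_3_polytope_def by auto
  interpret centred_smooth_polytope P c
    by (rule centred_smooth_polytope.intro[OF assms(2) _ \<open>P \<noteq> {}\<close>]) (use c in blast)
  have "unimodular_cover {T. unimodular_tetrahedron T \<and> T \<subseteq> P} P"
    unfolding unimodular_cover_def using covered unfolding unimodularly_covered_def by blast
  then show ?thesis by blast
qed

end
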